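(* Let $1\to N\to G\overset{\pi}{\to} Q\to 1$ be a short exact sequence of compactly generated groups. Let $\ell_G$ be the word-length on $G$ corresponding to a relatively compact generating set $S$ of $G$, and let $\ell_Q$ be the word-length on $Q$ corresponding to the generating set $\pi(S)$. Suppose that $Q$ has property RD with respect to $\ell_Q$, and that $N$ has property RD with respect to the restriction $\ell_G|_N$. Then $G$ has property RD.
   Context: All groups are locally compact topological groups, endowed with right-invariant Haar measures. A group is compactly generated if it is generated by a relatively compact subset. In a short exact sequence of such groups, $N$ is identified with a closed normal subgroup of $G$ and $Q$ with the quotient topological group $G/N$, $\pi$ being the quotient map. A length on a locally compact group $G$ is a Borel function $\ell\colon G\to[0,\infty)$ with $\ell(1)=0$, $\ell(x^{-1})=\ell(x)$ and $\ell(xy)\le \ell(x)+\ell(y)$ for all $x,y\in G$. If $G$ is generated by a relatively compact subset $S$, the corresponding word-length is $\ell(x)=\min\{n : x\in (S\cup S^{-1})^n\}$; word-lengths are always taken with respect to relatively compact generating sets. For $f\in C_c(G)$ (compactly supported continuous functions), let $T_f$ be the left convolution operator on $L^2(G)$ given by $T_fg(x)=\int_G f(y^{-1})g(yx)\,dy$ (right Haar measure), and let $\|f\|_{op}$ be its operator norm. Put $\ell(f)=\sup\{\ell(x): f(x)\neq 0\}$. The group $G$ has property RD with respect to a length $\ell$ if there exist constants $s,C>0$ such that $\|f\|_{op}\le C(1+\ell(f))^s\|f\|_2$ for every $f\in C_c(G)$. A compactly generated group is said to have property RD if it has property RD with respect to some length (equivalently, with respect to any of its word-lengths). *)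

theory Defs
  imports "HOL-Analysis.Analysis" "HOL-Algebra.Coset" "HOL-Algebra.Generated_Groups"
begin

section \<open>Locally compact groups\<close>

definition relatively_compact_in :: "'a topology \<Rightarrow> 'a set \<Rightarrow> bool" where
  "relatively_compact_in T S \<longleftrightarrow> S \<subseteq> topspace T \<and> compactin T (Abstract_Topology.closure_of T S)"

locale locally_compact_group = group G for G (structure) and T :: "'a topology" +
  assumes topspace_eq: "topspace T = carrier G"
    and continuous_mult: "continuous_map (prod_topology T T) T (\<lambda>(x, y). x \<otimes> y)"
    and continuous_inv: "continuous_map T T (\<lambda>x. inv x)"
    and Hausdorff: "Hausdorff_space T"
    and locally_compact: "locally_compact_space T"

locale compactly_generated_group = locally_compact_group +
  assumes compactly_generated: "\<exists>S. relatively_compact_in T S \<and> generate G S = carrier G"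

definition quotient_topology :: "'a topology \<Rightarrow> ('a \<Rightarrow> 'b) \<Rightarrow> 'b topology" where
  "quotient_topology X p =
     topology (\<lambda>U. U \<subseteq> p ` topspace X \<and> openin X {x \<in> topspace X. p x \<in> U})"

lemma openin_quotient_topology:
  "openin (quotient_topology X p) U \<longleftrightarrow>
     U \<subseteq> p ` topspace X \<and> openin X {x \<in> topspace X. p x \<in> U}"
proof -
  have "istopology (\<lambda>U. U \<subseteq> p ` topspace X \<and> openin X {x \<in> topspace X. p x \<in> U})"
    unfolding istopology_def
  proof (intro conjI allI impI)
    fix U V
    assume U: "U \<subseteq> p ` topspace X \<and> openin X {x \<in> topspace X. p x \<in> U}"
      and V: "V \<subseteq> p ` topspace X \<and> openin X {x \<in> topspace X. p x \<in> V}"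
    show "U \<inter> V \<subseteq> p ` topspace X" using U by blast
    have eq: "{x \<in> topspace X. p x \<in> U \<inter> V} =
        {x \<in> topspace X. p x \<in> U} \<inter> {x \<in> topspace X. p x \<in> V}" by blast
    show "openin X {x \<in> topspace X. p x \<in> U \<inter> V}"
      unfolding eq using U[THEN conjunct2] V[THEN conjunct2] by (rule openin_Int)
  next
    fix \<K>
    assume K: "\<forall>K\<in>\<K>. K \<subseteq> p ` topspace X \<and> openin X {x \<in> topspace X. p x \<in> K}"
    show "\<Union> \<K> \<subseteq> p ` topspace X" using K by blast
    have eq: "{x \<in> topspace X. p x \<in> \<Union> \<K>} =
        \<Union> ((\<lambda>K. {x \<in> topspace X. p x \<in> K}) ` \<K>)" by blast
    show "openin X {x \<in> topspace X. p x \<in> \<Union> \<K>}"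
      unfolding eq by (rule openin_Union) (use K in blast)
  qed
  then show ?thesis by (simp add: quotient_topology_def topology_inverse')
qed

lemma topspace_quotient_topology: "topspace (quotient_topology X p) = p ` topspace X"
proof
  show "topspace (quotient_topology X p) \<subseteq> p ` topspace X"
    using openin_topspace[of "quotient_topology X p"]
    unfolding openin_quotient_topology by (rule conjunct1)
  have "{x \<in> topspace X. p x \<in> p ` topspace X} = topspace X" by blast
  then have "openin (quotient_topology X p) (p ` topspace X)"
    by (simp add: openin_quotient_topology)
  then show "p ` topspace X \<subseteq> topspace (quotient_topology X p)"
    by (rule openin_subset)
qed

lemma quotient_map_quotient_topology: "quotient_map X (quotient_topology X p) p"
  by (auto simp: quotient_map_def openin_quotient_topology topspace_quotient_topology)


section \<open>Right Haar measure\<close>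

definition borel_sigma :: "'a topology \<Rightarrow> 'a measure" where
  "borel_sigma T = sigma (topspace T) {U. openin T U}"

text \<open>A Haar measure is a nonzero invariant Radon measure; the regularity clauses are needed
  for uniqueness up to scaling when the group is not second countable.\<close>

definition right_haar_measure ::
  "('a, 'c) monoid_scheme \<Rightarrow> 'a topology \<Rightarrow> 'a measure \<Rightarrow> bool" where
  "right_haar_measure G T \<mu> \<longleftrightarrow>
     space \<mu> = topspace T \<and>
     sets \<mu> = sets (borel_sigma T) \<and>
     emeasure \<mu> (space \<mu>) \<noteq> 0 \<and>
     (\<forall>K. compactin T K \<longrightarrow> emeasure \<mu> K < \<infinity>) \<and>
     (\<forall>A\<in>sets \<mu>. emeasure \<mu> A = (INF U\<in>{U. openin T U \<and> A \<subseteq> U}. emeasure \<mu> U)) \<and>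
     (\<forall>U. openin T U \<longrightarrow>
        emeasure \<mu> U = (SUP K\<in>{K. compactin T K \<and> K \<subseteq> U}. emeasure \<mu> K)) \<and>
     (\<forall>A\<in>sets \<mu>. \<forall>x\<in>carrier G. emeasure \<mu> (A #>\<^bsub>G\<^esub> x) = emeasure \<mu> A)"


section \<open>Lengths\<close>

definition is_length ::
  "('a, 'c) monoid_scheme \<Rightarrow> 'a topology \<Rightarrow> ('a \<Rightarrow> real) \<Rightarrow> bool" where
  "is_length G T l \<longleftrightarrow>
     l \<in> borel_measurable (borel_sigma T) \<and>
     (\<forall>x\<in>carrier G. 0 \<le> l x) \<and>
     l \<one>\<^bsub>G\<^esub> = 0 \<and>
     (\<forall>x\<in>carrier G. l (inv\<^bsub>G\<^esub> x) = l x) \<and>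
     (\<forall>x\<in>carrier G. \<forall>y\<in>carrier G. l (x \<otimes>\<^bsub>G\<^esub> y) \<le> l x + l y)"

primrec set_power :: "('a, 'c) monoid_scheme \<Rightarrow> 'a set \<Rightarrow> nat \<Rightarrow> 'a set" where
  "set_power G A 0 = {\<one>\<^bsub>G\<^esub>}"
| "set_power G A (Suc n) = set_power G A n <#>\<^bsub>G\<^esub> A"

definition word_length :: "('a, 'c) monoid_scheme \<Rightarrow> 'a set \<Rightarrow> 'a \<Rightarrow> real" where
  "word_length G S x = real (LEAST n. x \<in> set_power G (S \<union> set_inv\<^bsub>G\<^esub> S) n)"


section \<open>Convolution operators and property RD\<close>

definition Cc :: "'a topology \<Rightarrow> ('a \<Rightarrow> complex) set" where
  "Cc T = {f. continuous_map T euclidean f \<and>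
              compactin T (Abstract_Topology.closure_of T {x \<in> topspace T. f x \<noteq> 0})}"

definition square_integrable :: "'a measure \<Rightarrow> ('a \<Rightarrow> complex) set" where
  "square_integrable \<mu> =
     {g. g \<in> borel_measurable \<mu> \<and> integrable \<mu> (\<lambda>x. (cmod (g x))\<^sup>2)}"

definition L2_norm :: "'a measure \<Rightarrow> ('a \<Rightarrow> complex) \<Rightarrow> real" where
  "L2_norm \<mu> g = sqrt (LINT x|\<mu>. (cmod (g x))\<^sup>2)"

definition left_convolution ::
  "('a, 'c) monoid_scheme \<Rightarrow> 'a measure \<Rightarrow> ('a \<Rightarrow> complex) \<Rightarrow> ('a \<Rightarrow> complex) \<Rightarrow> 'a \<Rightarrow> complex"
  where
  "left_convolution G \<mu> f g x = (LINT y|\<mu>. f (inv\<^bsub>G\<^esub> y) * g (y \<otimes>\<^bsub>G\<^esub> x))"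

text \<open>For \<open>f\<close> in \<open>Cc T\<close> and \<open>g\<close> square-integrable, the convolution integral converges at every
  point and is again square-integrable, so the Bochner integrals never take their default value.\<close>

definition convolution_op_norm ::
  "('a, 'c) monoid_scheme \<Rightarrow> 'a measure \<Rightarrow> ('a \<Rightarrow> complex) \<Rightarrow> ennreal" where
  "convolution_op_norm G \<mu> f =
     (SUP g\<in>{g \<in> square_integrable \<mu>. L2_norm \<mu> g \<le> 1}.
        ennreal (L2_norm \<mu> (left_convolution G \<mu> f g)))"

text \<open>The supremum is taken in \<open>[0,\<infinity>)\<close>, so that the zero function has length 0. A Borel length is
  bounded on compact sets, hence the supremum is finite for \<open>f\<close> in \<open>Cc T\<close>.\<close>

definition support_length ::
  "('a, 'c) monoid_scheme \<Rightarrow> ('a \<Rightarrow> real) \<Rightarrow> ('a \<Rightarrow> complex) \<Rightarrow> real" where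
  "support_length G l f = Sup (insert 0 (l ` {x \<in> carrier G. f x \<noteq> 0}))"

text \<open>Being a length, in particular being Borel, is part of having property RD with respect to
  \<open>l\<close>. This matters for word-lengths, which need not be Borel when the generating set is not:
  a non-Borel one can be unbounded on every nonempty open set.\<close>

definition RD_wrt ::
  "('a, 'c) monoid_scheme \<Rightarrow> 'a topology \<Rightarrow> 'a measure \<Rightarrow> ('a \<Rightarrow> real) \<Rightarrow> bool" where
  "RD_wrt G T \<mu> l \<longleftrightarrow>
     is_length G T l \<and>
     (\<exists>s>0. \<exists>C>0. \<forall>f\<in>Cc T.
        convolution_op_norm G \<mu> f
          \<le> ennreal (C * (1 + support_length G l f) powr s * L2_norm \<mu> f))"

definition property_RD ::
  "('a, 'c) monoid_scheme \<Rightarrow> 'a topology \<Rightarrow> 'a measure \<Rightarrow> bool" where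
  "property_RD G T \<mu> \<longleftrightarrow> (\<exists>l. RD_wrt G T \<mu> l)"

end

theory Submission
  imports Defs "HOL-Real_Asymp.Real_Asymp"
begin

text \<open>
  The convolution of functions on \<open>G\<close> is disintegrated over the cosets of \<open>N\<close>. Writing \<open>f\<^sub>z\<close> for the
  function \<open>n \<mapsto> f (n z)\<close> on \<open>N\<close> and using Weil's formula for \<open>\<integral>\<^sub>G\<close>, one finds that up to constants
  \<open>\<langle>u, f * g\<rangle>\<close> is the integral over pairs of cosets of \<open>x\<close> and \<open>y\<close> of
  \<open>\<integral>\<integral> u\<^sub>x(m) f(m x y\<^sup>-\<^sup>1 n\<^sup>-\<^sup>1) g\<^sub>y(n) dm dn\<close>. If \<open>f\<close> does not vanish on the coset of \<open>x y\<^sup>-\<^sup>1\<close>, that coset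
  has a representative \<open>w\<close> no longer than the support of \<open>f\<close>, and a conjugation by \<open>w\<close> turns the double
  integral into a convolution on \<open>N\<close> with \<open>f\<^sub>w\<close>, whose support has length at most twice that of \<open>f\<close>.
  Property RD of \<open>N\<close> bounds it by \<open>\<parallel>f\<^sub>w\<parallel> \<parallel>g\<^sub>y\<parallel> \<parallel>u\<^sub>x\<parallel>\<close> (\<open>fibre_trilinear\<close>). What remains is a convolution
  on \<open>Q\<close> of the functions \<open>z \<mapsto> \<parallel>f\<^sub>z\<parallel>\<close> and \<open>y \<mapsto> \<parallel>g\<^sub>y\<parallel>\<close>, and property RD of \<open>Q\<close> bounds that
  (\<open>trilinear_extension_bound\<close>).

  This argument needs conjugation by elements of \<open>G\<close> to preserve the Haar measure of \<open>N\<close>. Property RD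
  of \<open>N\<close> with respect to the length restricted from \<open>G\<close> forces it (\<open>modulus_le_1\<close>): if conjugation by
  \<open>z\<close> scaled the measure by \<open>c > 1\<close>, conjugating by powers of \<open>z\<close> would make the quotient of
  the operator norm by the \<open>L\<^sup>2\<close>-norm grow exponentially while the lengths of supports grow linearly.

  Three devices keep the analysis elementary for groups that need not be second countable. All
  estimates are made for the trilinear form \<open>\<langle>u, f * g\<rangle>\<close> on nonnegative continuous functions of compact
  support, for which Fubini's theorem holds for product \<open>\<sigma>\<close>-algebras
  (\<open>compact_support_Tonelli\<close>); duality recovers the operator norm on all of \<open>L\<^sup>2\<close>
  (\<open>trilinear_bound_square_integrable\<close>). Weil's formula and the scaling factor of a conjugation both
  come from the uniqueness of the Haar functional on this cone (\<open>haar_functional_unique\<close>). Functions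
  on the quotient are obtained from functions on \<open>G\<close> that are constant on cosets, so that no
  measurable section is needed.

  Finally, the word-length of \<open>S\<close> need not be Borel on \<open>G\<close>, so the conclusion is proved for the
  word-length of a relatively compact open set containing \<open>S\<close>. The two are comparable because, by
  Steinhaus' theorem, the Borel word-lengths on \<open>N\<close> and \<open>Q\<close> are bounded on compact sets
  (\<open>word_length_bounded_on_compact\<close>).
\<close>

section \<open>Continuous functions of compact support\<close>

text \<open>The cone of nonnegative continuous functions of compact support, as real-valued functions;
  values outside the topological space are unconstrained.\<close>

definition CP :: "'a topology \<Rightarrow> ('a \<Rightarrow> real) set" where
  "CP T = {f. continuous_map T euclideanreal f \<and> (\<forall>x\<in>topspace T. 0 \<le> f x) \<and>
              (\<exists>K. compactin T K \<and> (\<forall>x\<in>topspace T - K. f x = 0))}"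

lemma CP_I:
  assumes "continuous_map T euclideanreal f" "\<And>x. x \<in> topspace T \<Longrightarrow> 0 \<le> f x"
    "compactin T K" "\<And>x. x \<in> topspace T \<Longrightarrow> x \<notin> K \<Longrightarrow> f x = 0"
  shows "f \<in> CP T"
  using assms unfolding CP_def by blast

lemma CP_cont: "f \<in> CP T \<Longrightarrow> continuous_map T euclideanreal f"
  and CP_nonneg: "f \<in> CP T \<Longrightarrow> x \<in> topspace T \<Longrightarrow> 0 \<le> f x"
  by (auto simp: CP_def)

lemma CP_support:
  assumes "f \<in> CP T"
  obtains K where "compactin T K" "\<And>x. x \<in> topspace T \<Longrightarrow> x \<notin> K \<Longrightarrow> f x = 0"
  using assms unfolding CP_def by blast

lemma CP_mult:
  assumes "f \<in> CP T" "continuous_map T euclideanreal g" "\<And>x. x \<in> topspace T \<Longrightarrow> 0 \<le> g x"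
  shows "(\<lambda>x. f x * g x) \<in> CP T"
proof -
  obtain K where K: "compactin T K" "\<And>x. x \<in> topspace T \<Longrightarrow> x \<notin> K \<Longrightarrow> f x = 0"
    using CP_support[OF assms(1)] by blast
  show ?thesis
    using assms K CP_cont[OF assms(1)] CP_nonneg[OF assms(1)]
    by (intro CP_I[OF _ _ K(1)] continuous_map_real_mult) auto
qed

lemma CP_compose:
  assumes f: "f \<in> CP X" and p: "continuous_map Y X p" and p': "continuous_map X Y p'"
    and inverse: "\<And>y. y \<in> topspace Y \<Longrightarrow> p' (p y) = y"
  shows "(\<lambda>y. f (p y)) \<in> CP Y"
proof -
  obtain K where K: "compactin X K" "\<And>x. x \<in> topspace X \<Longrightarrow> x \<notin> K \<Longrightarrow> f x = 0"
    using CP_support[OF f] by blast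
  have p_in: "p y \<in> topspace X" if "y \<in> topspace Y" for y
    using p that by (auto simp: continuous_map_def)
  show ?thesis
  proof (rule CP_I[OF _ _ image_compactin[OF K(1) p']])
    show "continuous_map Y euclideanreal (\<lambda>y. f (p y))"
      using continuous_map_compose[OF p CP_cont[OF f]] by (simp add: o_def)
    fix y assume y: "y \<in> topspace Y"
    show "0 \<le> f (p y)" using CP_nonneg[OF f p_in[OF y]] .
    assume "y \<notin> p' ` K"
    then have "p y \<notin> K" using inverse[OF y] by (metis image_eqI)
    then show "f (p y) = 0" using K(2) p_in[OF y] by blast
  qed
qed

lemma slice_continuous:
  assumes "continuous_map (prod_topology X Y) Z (\<lambda>(x, y). h x y)" "x \<in> topspace X"
  shows "continuous_map Y Z (h x)"
  using continuous_map_compose[of Y "prod_topology X Y" "\<lambda>y. (x, y)", OF _ assms(1)] assms(2)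
  by (simp add: o_def continuous_map_pairwise)

lemma space_borel_sigma [simp]: "space (borel_sigma T) = topspace T"
  unfolding borel_sigma_def by (rule space_measure_of) (use openin_subset in blast)

lemma openin_sets_borel_sigma: "openin T U \<Longrightarrow> U \<in> sets (borel_sigma T)"
  unfolding borel_sigma_def by (subst sets_measure_of) (use openin_subset in blast)+

lemma closedin_sets_borel_sigma:
  assumes "closedin T C"
  shows "C \<in> sets (borel_sigma T)"
proof -
  have "topspace T - C \<in> sets (borel_sigma T)"
    using assms by (intro openin_sets_borel_sigma) (simp add: closedin_def)
  then have "space (borel_sigma T) - (topspace T - C) \<in> sets (borel_sigma T)"
    by blast
  moreover have "topspace T - (topspace T - C) = C"
    using closedin_subset[OF assms] by blast
  ultimately show ?thesis by simp
qed

lemma continuous_map_measurable_borel_sigma: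
  assumes "continuous_map X Y f"
  shows "f \<in> measurable (borel_sigma X) (borel_sigma Y)"
  unfolding borel_sigma_def[of Y]
proof (rule measurable_measure_of)
  show "{U. openin Y U} \<subseteq> Pow (topspace Y)"
    using openin_subset by blast
  show "f \<in> space (borel_sigma X) \<rightarrow> topspace Y"
    using assms by (auto simp: continuous_map_def)
  fix U assume "U \<in> {U. openin Y U}"
  then have "openin X {x \<in> topspace X. f x \<in> U}"
    using assms by (auto simp: continuous_map_def)
  moreover have "f -` U \<inter> space (borel_sigma X) = {x \<in> topspace X. f x \<in> U}"
    by auto
  ultimately show "f -` U \<inter> space (borel_sigma X) \<in> sets (borel_sigma X)"
    by (simp add: openin_sets_borel_sigma)
qed

lemma borel_sigma_euclidean: "sets (borel_sigma euclidean) = sets borel"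
  unfolding borel_sigma_def borel_def by (simp flip: open_openin)

lemma continuous_map_borel_measurable:
  "continuous_map T euclidean f \<Longrightarrow> f \<in> borel_measurable (borel_sigma T)"
  using continuous_map_measurable_borel_sigma[of T euclidean f]
    measurable_cong_sets[OF refl borel_sigma_euclidean] by metis

lemma continuous_map_real_eps:
  "continuous_map X euclideanreal f \<longleftrightarrow>
    (\<forall>x\<in>topspace X. \<forall>e>0. \<exists>U. openin X U \<and> x \<in> U \<and> (\<forall>y\<in>U. \<bar>f y - f x\<bar> < e))"
  using Met_TC.continuous_map_to_metric[of X f]
  by (simp add: dist_real_def abs_minus_commute)

lemma continuous_map_compact_bounded:
  assumes "continuous_map T euclideanreal f" "compactin T K"
  obtains B where "0 < B" "\<And>x. x \<in> K \<Longrightarrow> \<bar>f x\<bar> \<le> B"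
proof -
  have "compact (f ` K)"
    using image_compactin[OF assms(2,1)] by simp
  then obtain B where "\<forall>y\<in>f ` K. norm y \<le> B"
    using compact_imp_bounded bounded_iff by metis
  then show ?thesis
    by (intro that[of "max B 1"]) (auto simp: le_max_iff_disj)
qed

text \<open>A Borel measure that is finite on compact sets, with no regularity: weighted measures
  \<open>g \<mu>\<close> with a locally integrable Borel density \<open>g\<close> are also of this kind.\<close>

locale locally_finite_measure =
  fixes T :: "'a topology" and \<mu> :: "'a measure"
  assumes sets_borel: "sets \<mu> = sets (borel_sigma T)"
    and finite_compact: "compactin T K \<Longrightarrow> emeasure \<mu> K < \<infinity>"
    and Hausdorff_T: "Hausdorff_space T"
begin

lemma space_mu: "space \<mu> = topspace T"
  using sets_eq_imp_space_eq[OF sets_borel] by simp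

lemma measurable_mu: "measurable \<mu> N = measurable (borel_sigma T) N"
  by (rule measurable_cong_sets[OF sets_borel refl])

lemma continuous_measurable: "continuous_map T euclidean f \<Longrightarrow> f \<in> borel_measurable \<mu>"
  unfolding measurable_mu by (rule continuous_map_borel_measurable)

lemma compact_sets: "compactin T K \<Longrightarrow> K \<in> sets \<mu>"
  unfolding sets_borel
  by (rule closedin_sets_borel_sigma, rule compactin_imp_closedin[OF Hausdorff_T])

lemma open_sets: "openin T U \<Longrightarrow> U \<in> sets \<mu>"
  unfolding sets_borel by (rule openin_sets_borel_sigma)

lemma integrable_compact_support:
  fixes f :: "'a \<Rightarrow> real"
  assumes "continuous_map T euclideanreal f" "compactin T K"
    "\<And>x. x \<in> topspace T \<Longrightarrow> x \<notin> K \<Longrightarrow> f x = 0"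
  shows "integrable \<mu> f"
proof -
  obtain B where B: "0 < B" "\<And>x. x \<in> K \<Longrightarrow> \<bar>f x\<bar> \<le> B"
    using continuous_map_compact_bounded[OF assms(1,2)] by blast
  show ?thesis
  proof (rule Bochner_Integration.integrable_bound)
    show "integrable \<mu> (\<lambda>x. B * indicator K x)"
      using compact_sets[OF assms(2)] finite_compact[OF assms(2)] by simp
    show "f \<in> borel_measurable \<mu>"
      by (rule continuous_measurable[OF assms(1)])
    show "AE x in \<mu>. norm (f x) \<le> norm (B * indicator K x)"
      using B assms(3) by (intro AE_I2) (auto simp: space_mu indicator_def)
  qed
qed

lemma CP_integrable: "f \<in> CP T \<Longrightarrow> integrable \<mu> f"
  using integrable_compact_support CP_cont CP_support by metis

lemma CP_nn_integral:
  "f \<in> CP T \<Longrightarrow> (\<integral>\<^sup>+x. ennreal (f x) \<partial>\<mu>) = ennreal (LINT x|\<mu>. f x)"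
  by (rule nn_integral_eq_integral[OF CP_integrable]) (auto intro!: AE_I2 simp: CP_nonneg space_mu)

lemma CP_integral_nonneg: "f \<in> CP T \<Longrightarrow> 0 \<le> (LINT x|\<mu>. f x)"
  by (rule integral_nonneg_AE) (auto intro!: AE_I2 simp: CP_nonneg space_mu)

text \<open>Only local uniformity of the supports in the parameter is required: for translates of a
  function on a noncompact group there is no common compact support.\<close>

lemma continuous_map_parametric_integral:
  fixes h :: "'b \<Rightarrow> 'a \<Rightarrow> real"
  assumes h: "continuous_map (prod_topology X T) euclideanreal (\<lambda>(x, y). h x y)"
    and loc: "\<And>x. x \<in> topspace X \<Longrightarrow> \<exists>U K. openin X U \<and> x \<in> U \<and> compactin T K \<and>
                (\<forall>x'\<in>U. \<forall>y\<in>topspace T - K. h x' y = 0)"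
  shows "continuous_map X euclideanreal (\<lambda>x. LINT y|\<mu>. h x y)"
  unfolding continuous_map_real_eps
proof (intro ballI allI impI)
  fix x0 and e :: real assume x0: "x0 \<in> topspace X" and "0 < e"
  obtain U K where U: "openin X U" "x0 \<in> U" and K: "compactin T K"
    and supp: "\<And>x y. x \<in> U \<Longrightarrow> y \<in> topspace T \<Longrightarrow> y \<notin> K \<Longrightarrow> h x y = 0"
    using loc[OF x0] by blast
  define d where "d = e / (measure \<mu> K + 1)"
  have "0 < d" using \<open>0 < e\<close> by (simp add: d_def add_nonneg_pos)
  have Ksub: "K \<subseteq> topspace T" using compactin_subset_topspace[OF K] .
  have slice: "continuous_map T euclideanreal (h x)" if "x \<in> topspace X" for x
    by (rule slice_continuous[OF h that])
  have diff: "continuous_map (prod_topology X T) euclideanreal (\<lambda>z. (case z of (x, y) \<Rightarrow> h x y) - h x0 (snd z))"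
    using continuous_map_compose[OF continuous_map_snd slice[OF x0], of X]
    by (intro continuous_map_diff h) (simp add: o_def)
  define W where "W = {z \<in> topspace (prod_topology X T). \<bar>(case z of (x, y) \<Rightarrow> h x y) - h x0 (snd z)\<bar> < d}"
  have "openin (prod_topology X T) {z \<in> topspace (prod_topology X T).
      (case z of (x, y) \<Rightarrow> h x y) - h x0 (snd z) \<in> {-d<..<d}}"
    by (rule openin_continuous_map_preimage[OF diff]) simp
  moreover have "W = {z \<in> topspace (prod_topology X T).
      (case z of (x, y) \<Rightarrow> h x y) - h x0 (snd z) \<in> {-d<..<d}}"
    unfolding W_def by (auto simp: abs_less_iff)
  ultimately have "openin (prod_topology X T) W" by simp
  moreover have "{x0} \<times> K \<subseteq> W"
    using x0 Ksub \<open>0 < d\<close> by (auto simp: W_def)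
  ultimately obtain V V' where V: "openin X V" "x0 \<in> V" "K \<subseteq> V'" "V \<times> V' \<subseteq> W"
    using tube_lemma_right[OF _ K x0] by metis
  show "\<exists>U. openin X U \<and> x0 \<in> U \<and> (\<forall>x\<in>U. \<bar>(LINT y|\<mu>. h x y) - (LINT y|\<mu>. h x0 y)\<bar> < e)"
  proof (intro exI[of _ "U \<inter> V"] conjI ballI)
    show "openin X (U \<inter> V)" using U V by blast
    show "x0 \<in> U \<inter> V" using U V by blast
    fix x assume x: "x \<in> U \<inter> V"
    then have xX: "x \<in> topspace X" using openin_subset[OF U(1)] by blast
    have int: "integrable \<mu> (h x)" "integrable \<mu> (h x0)"
      using integrable_compact_support[OF slice K] supp xX x0 x U(2) by blast+
    have bd: "\<bar>h x y - h x0 y\<bar> \<le> d * indicator K y" if "y \<in> topspace T" for y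
    proof (cases "y \<in> K")
      case True
      then have "(x, y) \<in> W" using V x by blast
      then show ?thesis using True by (simp add: W_def)
    next
      case False
      then show ?thesis using supp[of x y] supp[of x0 y] that x U by simp
    qed
    have "\<bar>(LINT y|\<mu>. h x y) - (LINT y|\<mu>. h x0 y)\<bar> = \<bar>LINT y|\<mu>. h x y - h x0 y\<bar>"
      using int by simp
    also have "\<dots> \<le> (LINT y|\<mu>. \<bar>h x y - h x0 y\<bar>)"
      by (rule integral_abs_bound)
    also have "\<dots> \<le> (LINT y|\<mu>. d * indicator K y)"
      using int compact_sets[OF K] finite_compact[OF K]
      by (intro integral_mono) (auto simp: space_mu bd)
    also have "\<dots> = d * measure \<mu> K"
      using Ksub by (simp add: space_mu Int_absorb2)
    also have "\<dots> < d * (measure \<mu> K + 1)"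
      using \<open>0 < d\<close> by simp
    also have "\<dots> = e"
      unfolding d_def by (simp add: add_nonneg_eq_0_iff)
    finally show "\<bar>(LINT y|\<mu>. h x y) - (LINT y|\<mu>. h x0 y)\<bar> < e" .
  qed
qed

end

text \<open>The product of the two Borel \<open>\<sigma>\<close>-algebras may be smaller than the Borel \<open>\<sigma>\<close>-algebra of the
  product, but it contains enough sets to make continuous functions of compact support
  measurable: by compactness such a function is a uniform limit of functions
  \<open>\<lambda>(x, y). h (c x) y\<close> where \<open>c\<close> is Borel with finitely many values.\<close>

lemma compact_support_product_measurable:
  fixes h :: "'a \<Rightarrow> 'b \<Rightarrow> real"
  assumes h: "continuous_map (prod_topology X Y) euclideanreal (\<lambda>(x, y). h x y)"
    and HX: "Hausdorff_space X" and A: "compactin X A" and B: "compactin Y B"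
    and supp: "\<And>x y. x \<in> topspace X \<Longrightarrow> y \<in> topspace Y \<Longrightarrow> (x, y) \<notin> A \<times> B \<Longrightarrow> h x y = 0"
  shows "(\<lambda>(x, y). h x y) \<in> borel_measurable (borel_sigma X \<Otimes>\<^sub>M borel_sigma Y)"
proof -
  let ?P = "borel_sigma X \<Otimes>\<^sub>M borel_sigma Y"
  have Asub: "A \<subseteq> topspace X" and Bsub: "B \<subseteq> topspace Y"
    using A B compactin_subset_topspace by blast+
  have slice: "continuous_map Y euclideanreal (h x)" if "x \<in> topspace X" for x
    by (rule slice_continuous[OF h that])
  have approx: "\<exists>u \<in> borel_measurable ?P. \<forall>z\<in>space ?P. \<bar>u z - h (fst z) (snd z)\<bar> < e"
    if "0 < e" for e
  proof -
    have ex: "\<exists>V. openin X V \<and> x \<in> V \<and> (\<forall>x'\<in>V. \<forall>y\<in>B. \<bar>h x' y - h x y\<bar> < e)" if x: "x \<in> A" for x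
    proof -
      have x': "x \<in> topspace X" using x Asub by blast
      have diff: "continuous_map (prod_topology X Y) euclideanreal
          (\<lambda>z. (case z of (x, y) \<Rightarrow> h x y) - h x (snd z))"
        using continuous_map_compose[OF continuous_map_snd slice[OF x'], of X]
        by (intro continuous_map_diff h) (simp add: o_def)
      define W where "W = {z \<in> topspace (prod_topology X Y).
          (case z of (x, y) \<Rightarrow> h x y) - h x (snd z) \<in> {-e<..<e}}"
      have op: "openin (prod_topology X Y) W"
        unfolding W_def by (rule openin_continuous_map_preimage[OF diff]) simp
      have "{x} \<times> B \<subseteq> W" using x' Bsub \<open>0 < e\<close> by (auto simp: W_def)
      then obtain V V' where V: "openin X V" "x \<in> V" "B \<subseteq> V'" "V \<times> V' \<subseteq> W"
        using tube_lemma_right[OF op B x'] by metis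
      then have "\<bar>h x1 y - h x y\<bar> < e" if "x1 \<in> V" "y \<in> B" for x1 y
      proof -
        have "(x1, y) \<in> W" using V that by blast
        then show ?thesis by (auto simp: W_def abs_less_iff)
      qed
      then show ?thesis using V by blast
    qed
    then obtain V where V: "\<And>x. x \<in> A \<Longrightarrow> openin X (V x)" "\<And>x. x \<in> A \<Longrightarrow> x \<in> V x"
      "\<And>x x' y. x \<in> A \<Longrightarrow> x' \<in> V x \<Longrightarrow> y \<in> B \<Longrightarrow> \<bar>h x' y - h x y\<bar> < e"
      by metis
    obtain F where F: "finite F" "F \<subseteq> A" "A \<subseteq> \<Union> (V ` F)"
      using compactinD[OF A, of "V ` A"] V
      by (smt (verit) UN_I finite_subset_image imageE subsetI)
    obtain c :: "nat \<Rightarrow> 'a" and n where c: "F = c ` {..<n}"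
      using finite_imp_nat_seg_image_inj_on[OF F(1)] by (metis lessThan_def)
    \<comment> \<open>The first patch containing \<open>x\<close>; the disjunct \<open>i = n\<close> makes the minimum exist outside \<open>A\<close>.\<close>
    define J where "J x = (LEAST i. x \<in> V (c i) \<and> i < n \<or> i = n)" for x
    have J: "J x < n \<and> x \<in> V (c (J x))" if xA: "x \<in> A" for x
    proof -
      obtain i where i: "i < n" "x \<in> V (c i)" using F(3) xA c by blast
      have "J x \<le> i" unfolding J_def by (rule Least_le) (use i in simp)
      moreover have "x \<in> V (c (J x)) \<and> J x < n \<or> J x = n"
        unfolding J_def by (rule LeastI[of _ n]) simp
      ultimately show ?thesis using i by auto
    qed
    have Jm: "J \<in> measurable (borel_sigma X) (count_space UNIV)"
      unfolding J_def
    proof (rule measurable_Least)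
      fix i
      show "Measurable.pred (borel_sigma X) (\<lambda>x. x \<in> V (c i) \<and> i < n \<or> i = n)"
      proof (cases "i < n")
        case True
        then have op: "openin X (V (c i))"
          using V(1) F(2) c by blast
        have "{x \<in> space (borel_sigma X). x \<in> V (c i) \<and> i < n \<or> i = n} = V (c i)"
          using openin_subset[OF op] True by auto
        then show ?thesis
          unfolding pred_def using openin_sets_borel_sigma[OF op] by simp
      qed simp
    qed
    have AM: "A \<in> sets (borel_sigma X)"
      by (rule closedin_sets_borel_sigma[OF compactin_imp_closedin[OF HX A]])
    show ?thesis
    proof (intro bexI[of _ "\<lambda>z. if fst z \<in> A then (if J (fst z) < n then h (c (J (fst z))) (snd z) else 0) else 0"] ballI)
      fix z assume "z \<in> space ?P"
      then have z: "fst z \<in> topspace X" "snd z \<in> topspace Y" by (auto simp: space_pair_measure)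
      have cA: "c i \<in> A" if "i < n" for i using c F(2) that by blast
      show "\<bar>(if fst z \<in> A then (if J (fst z) < n then h (c (J (fst z))) (snd z) else 0) else 0)
             - h (fst z) (snd z)\<bar> < e"
      proof (cases "fst z \<in> A")
        case True
        note J = J[OF True]
        show ?thesis
        proof (cases "snd z \<in> B")
          case True
          then have "\<bar>h (fst z) (snd z) - h (c (J (fst z))) (snd z)\<bar> < e"
            using V(3) cA J by blast
          then show ?thesis using \<open>fst z \<in> A\<close> J by (simp add: abs_minus_commute)
        next
          case False
          then have "h (fst z) (snd z) = 0" "h (c (J (fst z))) (snd z) = 0"
            using supp z cA J Asub by blast+
          then show ?thesis using \<open>0 < e\<close> by simp
        qed
      next
        case False
        then have "(fst z, snd z) \<notin> A \<times> B" by (auto simp: mem_Times_iff)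
        then show ?thesis using supp[OF z] False \<open>0 < e\<close> by simp
      qed
    next
      have hm: "(\<lambda>z. h (c i) (snd z)) \<in> borel_measurable ?P" if "i < n" for i
        using measurable_compose[OF measurable_snd continuous_map_borel_measurable[OF slice]]
          c F(2) Asub that by blast
      have "(\<lambda>z. if J (fst z) < n then h (c (J (fst z))) (snd z) else 0) \<in> borel_measurable ?P"
      proof (rule measurable_compose_countable[where f = "\<lambda>i z. if i < n then h (c i) (snd z) else 0"])
        fix i show "(\<lambda>z. if i < n then h (c i) (snd z) else 0) \<in> borel_measurable ?P"
          using hm by (cases "i < n") auto
        show "(\<lambda>z. J (fst z)) \<in> measurable ?P (count_space UNIV)"
          by (rule measurable_compose[OF measurable_fst Jm])
      qed
      moreover have "Measurable.pred ?P (\<lambda>z. fst z \<in> A)"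
        by (rule pred_sets2[OF AM measurable_fst])
      ultimately show "(\<lambda>z. if fst z \<in> A then (if J (fst z) < n then h (c (J (fst z))) (snd z) else 0) else 0) \<in> borel_measurable ?P"
        unfolding pred_def by (rule measurable_If[OF _ borel_measurable_const])
    qed
  qed
  have "\<forall>k::nat. \<exists>u \<in> borel_measurable ?P. \<forall>z\<in>space ?P. \<bar>u z - h (fst z) (snd z)\<bar> < inverse (Suc k)"
    using approx by simp
  then obtain u where u: "\<And>k. u k \<in> borel_measurable ?P"
    "\<And>k z. z \<in> space ?P \<Longrightarrow> \<bar>u k z - h (fst z) (snd z)\<bar> < inverse (real (Suc k))"
    by metis
  \<comment> \<open>Pointwise limit of the approximations with error \<open>1 / (k + 1)\<close>.\<close>
  show ?thesis
  proof (rule borel_measurable_LIMSEQ_real[of ?P u])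
    fix z assume z: "z \<in> space ?P"
    have "(\<lambda>k. u k z - h (fst z) (snd z)) \<longlonglongrightarrow> 0"
    proof (rule Lim_null_comparison[OF _ LIMSEQ_inverse_real_of_nat])
      show "\<forall>\<^sub>F k in sequentially. norm (u k z - h (fst z) (snd z)) \<le> inverse (real (Suc k))"
        using u(2)[OF z] by (intro always_eventually allI) (simp add: less_imp_le)
    qed
    then show "(\<lambda>k. u k z) \<longlonglongrightarrow> (case z of (x, y) \<Rightarrow> h x y)"
      by (simp add: LIM_zero_iff split_beta)
  qed (rule u(1))
qed

text \<open>The weight \<open>w\<close> may be any Borel function of the second variable; with a Borel \<open>w\<close> the integrand
  need not be continuous.\<close>

lemma compact_support_Tonelli:
  fixes h :: "'a \<Rightarrow> 'b \<Rightarrow> real"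
  assumes M: "locally_finite_measure X M" "sigma_finite_measure M"
    and N: "locally_finite_measure Y N" "sigma_finite_measure N"
    and h: "continuous_map (prod_topology X Y) euclideanreal (\<lambda>(x, y). h x y)"
    and A: "compactin X A" and B: "compactin Y B"
    and supp: "\<And>x y. x \<in> topspace X \<Longrightarrow> y \<in> topspace Y \<Longrightarrow> (x, y) \<notin> A \<times> B \<Longrightarrow> h x y = 0"
    and w: "w \<in> borel_measurable N"
  shows "(\<integral>\<^sup>+x. \<integral>\<^sup>+y. ennreal (h x y) * w y \<partial>N \<partial>M) = (\<integral>\<^sup>+y. \<integral>\<^sup>+x. ennreal (h x y) * w y \<partial>M \<partial>N)"
proof -
  interpret M: locally_finite_measure X M by fact
  interpret N: locally_finite_measure Y N by fact
  interpret pair_sigma_finite M N using M(2) N(2) by (simp add: pair_sigma_finite_def)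
  have [measurable]: "(\<lambda>(x, y). h x y) \<in> borel_measurable (M \<Otimes>\<^sub>M N)"
    using compact_support_product_measurable[OF h M.Hausdorff_T A B supp]
      measurable_cong_sets[OF sets_pair_measure_cong[OF M.sets_borel N.sets_borel] refl] by blast
  note w[measurable]
  have "(\<lambda>(x, y). ennreal (h x y) * w y) \<in> borel_measurable (M \<Otimes>\<^sub>M N)"
    by measurable
  then show ?thesis using Fubini' by force
qed

section \<open>Powers of subsets of a group\<close>

context group
begin

lemma set_multI: "a \<in> A \<Longrightarrow> b \<in> B \<Longrightarrow> a \<otimes> b \<in> A <#> B"
  unfolding set_mult_def by blast

lemma set_power_closed: "A \<subseteq> carrier G \<Longrightarrow> set_power G A n \<subseteq> carrier G"
  by (induction n) (auto simp: set_mult_closed)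

lemma set_power_mono: "A \<subseteq> B \<Longrightarrow> set_power G A n \<subseteq> set_power G B n"
  by (induction n) (auto simp: set_mult_def)

lemma set_power_Suc_0: "A \<subseteq> carrier G \<Longrightarrow> a \<in> A \<Longrightarrow> a \<in> set_power G A (Suc 0)"
  using set_multI[of \<one> "{\<one>}" a A] by (simp add: subset_iff)

lemma set_power_add:
  assumes "A \<subseteq> carrier G" "x \<in> set_power G A m"
  shows "y \<in> set_power G A n \<Longrightarrow> x \<otimes> y \<in> set_power G A (m + n)"
proof (induction n arbitrary: y)
  case 0
  then have "y = \<one>" by simp
  moreover have "x \<in> carrier G" using assms(2) set_power_closed[OF assms(1)] by blast
  ultimately show ?case using assms(2) by simp
next
  case (Suc n)
  then obtain z a where za: "z \<in> set_power G A n" "a \<in> A" "y = z \<otimes> a"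
    by (auto simp: set_mult_def)
  have "x \<in> carrier G" "z \<in> carrier G" "a \<in> carrier G"
    using za assms set_power_closed[OF assms(1)] by blast+
  then show ?case
    using set_multI[OF Suc.IH[OF za(1)] za(2)] za(3) by (simp add: m_assoc)
qed

lemma set_power_inv:
  assumes "A \<subseteq> carrier G" "\<And>a. a \<in> A \<Longrightarrow> inv a \<in> A"
  shows "x \<in> set_power G A n \<Longrightarrow> inv x \<in> set_power G A n"
proof (induction n arbitrary: x)
  case (Suc n)
  then obtain z a where za: "z \<in> set_power G A n" "a \<in> A" "x = z \<otimes> a"
    by (auto simp: set_mult_def)
  have "z \<in> carrier G" "a \<in> carrier G"
    using za assms set_power_closed[OF assms(1)] by blast+
  then have "inv x = inv a \<otimes> inv z" using za(3) by (simp add: inv_mult_group)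
  then show ?case
    using set_power_add[OF assms(1) set_power_Suc_0[OF assms(1) assms(2)[OF za(2)]] Suc.IH[OF za(1)]]
    by simp
qed simp

lemma generate_subset_set_power:
  assumes "A \<subseteq> carrier G" "\<And>a. a \<in> A \<Longrightarrow> inv a \<in> A" "x \<in> generate G A"
  shows "\<exists>n. x \<in> set_power G A n"
  using assms(3)
proof (induction rule: generate.induct)
  case one
  show ?case by (intro exI[of _ 0]) simp
next
  case (incl h)
  then show ?case using set_power_Suc_0[OF assms(1)] by blast
next
  case (inv h)
  then show ?case using set_power_Suc_0[OF assms(1) assms(2)[OF inv(1)]] by blast
next
  case (eng h1 h2)
  then obtain m n where "h1 \<in> set_power G A m" "h2 \<in> set_power G A n" by blast
  then show ?case using set_power_add[OF assms(1), of h1 m h2 n] by blast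
qed

end


section \<open>Locally compact groups and their Haar measures\<close>

lemma (in group) r_coset_eq_preimage:
  assumes "A \<subseteq> carrier G" "a \<in> carrier G"
  shows "A #> a = {x \<in> carrier G. x \<otimes> inv a \<in> A}"
proof (intro Set.set_eqI iffI)
  fix x assume x: "x \<in> {x \<in> carrier G. x \<otimes> inv a \<in> A}"
  then have "x = (x \<otimes> inv a) \<otimes> a" using assms(2) by (simp add: m_assoc)
  then show "x \<in> A #> a" using x unfolding r_coset_def by blast
qed (use assms in \<open>auto simp: r_coset_def m_assoc subset_iff\<close>)

context locally_compact_group
begin

lemma topspace_carrier [simp]: "topspace T = carrier G"
  by (rule topspace_eq)

lemma openin_carrier: "openin T (carrier G)"
  using openin_topspace[of T] by simp

lemma carrier_of_openin: "openin T U \<Longrightarrow> x \<in> U \<Longrightarrow> x \<in> carrier G"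
  using openin_subset by fastforce

lemma carrier_of_compactin: "compactin T K \<Longrightarrow> x \<in> K \<Longrightarrow> x \<in> carrier G"
  using compactin_subset_topspace by fastforce

lemma CP_ge0: "f \<in> CP T \<Longrightarrow> x \<in> carrier G \<Longrightarrow> 0 \<le> f x"
  using CP_nonneg[of f T x] by simp

lemma continuous_map_mult:
  assumes "continuous_map X T f" "continuous_map X T g"
  shows "continuous_map X T (\<lambda>x. f x \<otimes> g x)"
  using continuous_map_compose[OF continuous_map_pairedI[OF assms] continuous_mult]
  by (simp add: o_def)

lemma continuous_map_m_inv: "continuous_map X T f \<Longrightarrow> continuous_map X T (\<lambda>x. inv (f x))"
  using continuous_map_compose[OF _ continuous_inv, of X f] by (simp add: o_def)

lemma continuous_map_id': "continuous_map T T (\<lambda>x. x)"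
  using continuous_map_id[of T] by (simp add: id_def)

lemma continuous_map_const': "a \<in> carrier G \<Longrightarrow> continuous_map X T (\<lambda>x. a)"
  by simp

lemmas cont_intros = continuous_map_mult continuous_map_m_inv continuous_map_id'
  continuous_map_const' continuous_map_fst continuous_map_snd
  continuous_map_fst_of[unfolded o_def] continuous_map_snd_of[unfolded o_def]

lemma continuous_map_CP_compose:
  "f \<in> CP T \<Longrightarrow> continuous_map X T p \<Longrightarrow> continuous_map X euclideanreal (\<lambda>x. f (p x))"
  using continuous_map_compose[OF _ CP_cont, of X T p f] by (simp add: o_def)

lemma compactin_set_mult:
  assumes "compactin T A" "compactin T B"
  shows "compactin T (A <#> B)"
proof -
  have "compactin T ((\<lambda>(x, y). x \<otimes> y) ` (A \<times> B))"
    by (rule image_compactin[OF _ continuous_mult]) (simp add: compactin_Times assms)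
  moreover have "(\<lambda>(x, y). x \<otimes> y) ` (A \<times> B) = A <#> B"
    by (auto simp: set_mult_def)
  ultimately show ?thesis by simp
qed

lemma compactin_inv_image: "compactin T A \<Longrightarrow> compactin T ((\<lambda>x. inv x) ` A)"
  by (rule image_compactin[OF _ continuous_inv])

lemma compactin_set_power: "compactin T A \<Longrightarrow> compactin T (set_power G A n)"
  by (induction n) (auto simp: compactin_set_mult)

lemma relatively_compact_nhd:
  assumes "compactin T K"
  obtains U L where "openin T U" "compactin T L" "K \<subseteq> U" "U \<subseteq> L"
  using assms locally_compact that
  unfolding locally_compact_space_compact_closed_compact[OF disjI1[OF Hausdorff]] by blast

lemma relatively_compact_nhd_point:
  assumes "x \<in> carrier G"
  obtains U L where "openin T U" "compactin T L" "x \<in> U" "U \<subseteq> L"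
proof -
  have "compactin T {x}" using assms by simp
  then obtain U L where "openin T U" "compactin T L" "{x} \<subseteq> U" "U \<subseteq> L"
    by (rule relatively_compact_nhd)
  then show ?thesis using that[of U L] by simp
qed

lemma CP_right_translate:
  assumes f: "f \<in> CP T" and a: "a \<in> carrier G"
  shows "(\<lambda>x. f (x \<otimes> a)) \<in> CP T"
  by (rule CP_compose[OF f, of _ _ "\<lambda>x. x \<otimes> inv a"])
     (use a in \<open>auto intro!: cont_intros simp: m_assoc\<close>)

lemma CP_left_translate:
  assumes f: "f \<in> CP T" and a: "a \<in> carrier G"
  shows "(\<lambda>x. f (a \<otimes> x)) \<in> CP T"
  by (rule CP_compose[OF f, of _ _ "\<lambda>x. inv a \<otimes> x"])
     (use a in \<open>auto intro!: cont_intros simp: m_assoc[symmetric]\<close>)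

lemma CP_inverse: "f \<in> CP T \<Longrightarrow> (\<lambda>x. f (inv x)) \<in> CP T"
  by (rule CP_compose[OF _ continuous_inv continuous_inv]) auto

text \<open>Urysohn's lemma with compact support.\<close>

lemma CP_bump:
  assumes K: "compactin T K" and U: "openin T U" "K \<subseteq> U"
  obtains f where "f \<in> CP T" "\<And>x. x \<in> carrier G \<Longrightarrow> f x \<le> 1" "\<And>x. x \<in> K \<Longrightarrow> f x = 1"
    "\<And>x. x \<in> carrier G \<Longrightarrow> x \<notin> U \<Longrightarrow> f x = 0"
proof -
  obtain V L where V: "openin T V" "compactin T L" "K \<subseteq> V" "V \<subseteq> L"
    using relatively_compact_nhd[OF K] by blast
  have cr: "completely_regular_space T"
    by (rule locally_compact_regular_imp_completely_regular_space[OF locally_compact])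
       (simp add: Hausdorff)
  have cl: "closedin T (topspace T - (U \<inter> V))"
    using U V by (intro closedin_diff openin_Int closedin_topspace) auto
  have dj: "disjnt (topspace T - (U \<inter> V)) K"
    using U V by (auto simp: disjnt_def)
  obtain f where f: "continuous_map T (top_of_set {0..1}) f"
    "f ` K \<subseteq> {0::real}" "f ` (topspace T - (U \<inter> V)) \<subseteq> {1}"
    by (rule Urysohn_completely_regular_closed_compact[OF _ cr cl K dj, of 0 1]) auto
  have fc: "continuous_map T euclideanreal f" and f01: "\<And>x. x \<in> carrier G \<Longrightarrow> f x \<in> {0..1}"
    using f(1) by (auto simp: continuous_map_in_subtopology)
  show ?thesis
  proof (rule that)
    show "(\<lambda>x. 1 - f x) \<in> CP T"
    proof (rule CP_I[OF _ _ V(2)])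
      show "continuous_map T euclideanreal (\<lambda>x. 1 - f x)"
        by (intro continuous_map_diff fc) simp
      show "1 - f x = 0" if "x \<in> topspace T" "x \<notin> L" for x
        using f(3) V(4) that by (metis DiffI IntD2 diff_self image_subset_iff singletonD subsetD)
    qed (use f01 in auto)
    show "1 - f x \<le> 1" if "x \<in> carrier G" for x using f01[OF that] by simp
    show "1 - f x = 1" if "x \<in> K" for x using f(2) that by auto
    show "1 - f x = 0" if "x \<in> carrier G" "x \<notin> U" for x using f(3) that by auto
  qed
qed

lemma CP_bump_one:
  obtains f where "f \<in> CP T" "f \<one> = 1"
proof -
  have "compactin T {\<one>}" by simp
  then show ?thesis using CP_bump[OF _ openin_carrier, of "{\<one>}"] that by auto
qed

end

context compactly_generated_group
begin

lemma sigma_compact: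
  obtains K :: "nat \<Rightarrow> 'a set" where "\<And>n. compactin T (K n)" "incseq K" "(\<Union>n. K n) = carrier G"
proof -
  obtain S where S: "relatively_compact_in T S" "generate G S = carrier G"
    using compactly_generated by blast
  define C where "C = T closure_of S"
  define B where "B = C \<union> (\<lambda>x. inv x) ` C"
  have C: "compactin T C" "S \<subseteq> C"
    using S closure_of_subset[of S T] by (auto simp: C_def relatively_compact_in_def)
  have Csub: "C \<subseteq> carrier G" using compactin_subset_topspace[OF C(1)] by simp
  have B: "compactin T B"
    unfolding B_def by (intro compactin_Un C compactin_inv_image)
  have Bsub: "B \<subseteq> carrier G" using compactin_subset_topspace[OF B] by simp
  have Binv: "inv b \<in> B" if "b \<in> B" for b
    using that Csub unfolding B_def by (auto simp: subset_iff image_iff)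
  have gen: "\<exists>n. x \<in> set_power G B n" if "x \<in> carrier G" for x
  proof (rule generate_subset_set_power[OF Bsub Binv])
    have "S \<subseteq> B" using C(2) by (auto simp: B_def)
    then show "x \<in> generate G B" using mono_generate[of S B] S(2) that by blast
  qed
  define K where "K n = (\<Union>i\<le>n. set_power G B i)" for n
  show ?thesis
  proof (rule that)
    show "compactin T (K n)" for n
      unfolding K_def by (rule compactin_Union) (auto intro: compactin_set_power[OF B])
    show "incseq K" unfolding K_def incseq_def by (intro allI impI UN_mono) auto
    show "(\<Union>n. K n) = carrier G"
      using gen set_power_closed[OF Bsub] by (fastforce simp: K_def)
  qed
qed

end

text \<open>Compact generation makes the Haar measure \<open>\<sigma>\<close>-finite, which Tonelli's theorem needs.\<close>

locale haar_group = compactly_generated_group G T for G (structure) and T +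
  fixes \<mu> :: "'a measure"
  assumes haar: "right_haar_measure G T \<mu>"

sublocale haar_group \<subseteq> locally_finite_measure T \<mu>
proof
  show "sets \<mu> = sets (borel_sigma T)" "Hausdorff_space T"
    using haar Hausdorff by (simp_all add: right_haar_measure_def)
  show "emeasure \<mu> K < \<infinity>" if "compactin T K" for K
    using haar that by (simp add: right_haar_measure_def)
qed

context haar_group
begin

lemma space_carrier [simp]: "space \<mu> = carrier G"
  using space_mu by simp

lemma emeasure_translate:
  "A \<in> sets \<mu> \<Longrightarrow> x \<in> carrier G \<Longrightarrow> emeasure \<mu> (A #> x) = emeasure \<mu> A"
  using haar by (simp add: right_haar_measure_def)

lemma sigma_finite: "sigma_finite_measure \<mu>"
proof -
  obtain K where K: "\<And>n. compactin T (K n)" "incseq K" "(\<Union>n. K n) = carrier G"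
    using sigma_compact by blast
  show ?thesis
  proof
    show "\<exists>A. countable A \<and> A \<subseteq> sets \<mu> \<and> \<Union> A = space \<mu> \<and> (\<forall>a\<in>A. emeasure \<mu> a \<noteq> \<infinity>)"
      using K(3) compact_sets[OF K(1)] finite_compact[OF K(1)]
      by (intro exI[of _ "range K"]) (auto simp: less_top)
  qed
qed

lemma translate_measurable: "a \<in> carrier G \<Longrightarrow> (\<lambda>x. x \<otimes> a) \<in> measurable \<mu> \<mu>"
  unfolding measurable_mu measurable_cong_sets[OF refl sets_borel]
  by (intro continuous_map_measurable_borel_sigma cont_intros)

lemma distr_translate:
  assumes a: "a \<in> carrier G"
  shows "distr \<mu> \<mu> (\<lambda>x. x \<otimes> a) = \<mu>"
proof (rule measure_eqI)
  fix A assume "A \<in> sets (distr \<mu> \<mu> (\<lambda>x. x \<otimes> a))"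
  then have A: "A \<in> sets \<mu>" by simp
  have sub: "A \<subseteq> carrier G" using sets.sets_into_space[OF A] by simp
  have "(\<lambda>x. x \<otimes> a) -` A \<inter> space \<mu> = A #> inv a"
    using r_coset_eq_preimage[OF sub inv_closed[OF a]] a by auto
  then show "emeasure (distr \<mu> \<mu> (\<lambda>x. x \<otimes> a)) A = emeasure \<mu> A"
    using emeasure_translate[OF A] a A by (simp add: emeasure_distr translate_measurable)
qed simp

lemma nn_integral_translate:
  assumes "a \<in> carrier G" "u \<in> borel_measurable \<mu>"
  shows "(\<integral>\<^sup>+x. u (x \<otimes> a) \<partial>\<mu>) = (\<integral>\<^sup>+x. u x \<partial>\<mu>)"
  using nn_integral_distr[OF translate_measurable[OF assms(1)], of u] assms
  by (simp add: distr_translate)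

lemma integral_translate:
  fixes u :: "'a \<Rightarrow> 'e::{banach, second_countable_topology}"
  assumes "a \<in> carrier G" "u \<in> borel_measurable \<mu>"
  shows "(LINT x|\<mu>. u (x \<otimes> a)) = (LINT x|\<mu>. u x)"
  using integral_distr[OF translate_measurable[OF assms(1)], of u] assms
  by (simp add: distr_translate)

lemma right_coset_open:
  assumes "openin T U" "a \<in> carrier G"
  shows "openin T (U #> a)"
proof -
  have "openin T {x \<in> topspace T. x \<otimes> inv a \<in> U}"
    by (rule openin_continuous_map_preimage[OF _ assms(1)]) (use assms in \<open>auto intro!: cont_intros\<close>)
  then show ?thesis
    using r_coset_eq_preimage[OF _ assms(2), of U] openin_subset[OF assms(1)] by simp
qed

lemma compact_translate_cover:
  assumes K: "compactin T K" and U: "openin T U" "\<one> \<in> U"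
  obtains F where "finite F" "F \<subseteq> K" "K \<subseteq> (\<Union>x\<in>F. U #> x)"
proof -
  have Ksub: "K \<subseteq> carrier G" using carrier_of_compactin[OF K] by blast
  have "\<exists>\<F>. finite \<F> \<and> \<F> \<subseteq> (\<lambda>x. U #> x) ` K \<and> K \<subseteq> \<Union>\<F>"
  proof (rule compactinD[OF K])
    show "openin T V" if "V \<in> (\<lambda>x. U #> x) ` K" for V
      using that Ksub right_coset_open[OF U(1)] by blast
    show "K \<subseteq> \<Union> ((\<lambda>x. U #> x) ` K)"
    proof
      fix x assume x: "x \<in> K"
      then have "x = \<one> \<otimes> x" using Ksub by auto
      then have "x \<in> U #> x" using U(2) unfolding r_coset_def by blast
      then show "x \<in> \<Union> ((\<lambda>x. U #> x) ` K)" using x by blast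
    qed
  qed
  then obtain \<F> where \<F>: "finite \<F>" "\<F> \<subseteq> (\<lambda>x. U #> x) ` K" "K \<subseteq> \<Union>\<F>" by blast
  obtain F where "F \<subseteq> K" "finite F" "\<F> = (\<lambda>x. U #> x) ` F"
    using finite_subset_image[OF \<F>(1,2)] by blast
  then show ?thesis using that \<F>(3) by blast
qed

text \<open>A null open set would make every compact set null, as a finite union of translates covers it.\<close>

lemma emeasure_open_pos:
  assumes U: "openin T U" "x \<in> U"
  shows "0 < emeasure \<mu> U"
proof (rule ccontr)
  assume "\<not> 0 < emeasure \<mu> U"
  then have U0: "emeasure \<mu> U = 0" by simp
  have x: "x \<in> carrier G" using carrier_of_openin[OF U] .
  define V where "V = U #> inv x"
  have V: "openin T V" using right_coset_open[OF U(1)] x by (simp add: V_def)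
  have "x \<otimes> inv x \<in> V" using U(2) unfolding V_def r_coset_def by blast
  then have oneV: "\<one> \<in> V" using x by simp
  have V0: "emeasure \<mu> V = 0"
    using emeasure_translate[OF open_sets[OF U(1)]] x U0 by (simp add: V_def)
  have null: "emeasure \<mu> K = 0" if K: "compactin T K" for K
  proof -
    obtain F where F: "finite F" "F \<subseteq> K" "K \<subseteq> (\<Union>x\<in>F. V #> x)"
      using compact_translate_cover[OF K V oneV] by blast
    have Fc: "y \<in> carrier G" if "y \<in> F" for y using that F(2) carrier_of_compactin[OF K] by blast
    have "V #> y \<in> null_sets \<mu>" if "y \<in> F" for y
      using right_coset_open[OF V Fc[OF that]] emeasure_translate[OF open_sets[OF V] Fc[OF that]] V0
      by (simp add: null_sets_def open_sets)
    then have "(\<Union>y\<in>F. V #> y) \<in> null_sets \<mu>"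
      using F(1) by (intro null_sets.finite_UN) auto
    then show ?thesis
      using null_sets_subset[OF _ compact_sets[OF K] F(3)] by blast
  qed
  obtain K where K: "\<And>n::nat. compactin T (K n)" "incseq K" "(\<Union>n. K n) = carrier G"
    using sigma_compact by blast
  have "(\<Union>n. K n) \<in> null_sets \<mu>"
    by (rule null_sets_UN) (use null K(1) compact_sets in \<open>auto simp: null_sets_def\<close>)
  then show False using haar K(3) by (auto simp: right_haar_measure_def null_sets_def)
qed

lemma CP_integral_pos:
  assumes f: "f \<in> CP T" and x: "x \<in> carrier G" "0 < f x"
  shows "0 < (LINT y|\<mu>. f y)"
proof -
  have "openin T {y \<in> topspace T. f y \<in> {0<..}}"
    by (rule openin_continuous_map_preimage[OF CP_cont[OF f]]) simp
  from emeasure_open_pos[OF this] have pos: "0 < emeasure \<mu> {y \<in> carrier G. 0 < f y}"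
    using x by auto
  have "(LINT y|\<mu>. f y) \<noteq> 0"
  proof
    assume "(LINT y|\<mu>. f y) = 0"
    then have "AE y in \<mu>. f y = 0"
      using integral_nonneg_eq_0_iff_AE[OF CP_integrable[OF f] AE_I2] by (simp add: CP_ge0[OF f])
    moreover have "{y \<in> space \<mu>. f y \<noteq> 0} \<in> sets \<mu>"
      using continuous_measurable[OF CP_cont[OF f]] by measurable
    ultimately have "emeasure \<mu> {y \<in> space \<mu>. f y \<noteq> 0} = 0"
      by (simp add: AE_iff_measurable[OF _ refl])
    moreover have "{y \<in> space \<mu>. f y \<noteq> 0} = {y \<in> carrier G. 0 < f y}"
      using CP_ge0[OF f] by (force simp: less_le)
    ultimately show False using pos by simp
  qed
  then show ?thesis using CP_integral_nonneg[OF f] by linarith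
qed

end

context haar_group
begin

section \<open>Uniqueness of the Haar functional\<close>

text \<open>A functional on the cone \<open>CP T\<close> that is invariant under right translations and satisfies
  Fubini's theorem with the Haar measure. It need not be given by a measure, since the integral
  over a quotient followed by the integral over a subgroup is one of the intended instances.\<close>

definition haar_functional :: "(('a \<Rightarrow> real) \<Rightarrow> ennreal) \<Rightarrow> bool" where
  "haar_functional I \<longleftrightarrow>
    (\<forall>f g. (\<forall>x\<in>carrier G. f x = g x) \<longrightarrow> I f = I g) \<and>
    (\<forall>f\<in>CP T. \<forall>c\<ge>0. I (\<lambda>x. c * f x) = ennreal c * I f) \<and>
    (\<forall>f\<in>CP T. \<forall>a\<in>carrier G. I (\<lambda>x. f (x \<otimes> a)) = I f) \<and>
    (\<forall>h A B. continuous_map (prod_topology T T) euclideanreal (\<lambda>(x, y). h x y) \<longrightarrow>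
        (\<forall>x\<in>carrier G. \<forall>y\<in>carrier G. 0 \<le> h x y) \<longrightarrow>
        compactin T A \<longrightarrow> compactin T B \<longrightarrow>
        (\<forall>x\<in>carrier G. \<forall>y\<in>carrier G. (x, y) \<notin> A \<times> B \<longrightarrow> h x y = 0) \<longrightarrow>
        I (\<lambda>x. LINT y|\<mu>. h x y) = (\<integral>\<^sup>+y. I (\<lambda>x. h x y) \<partial>\<mu>))"

lemma haar_functionalI:
  assumes "\<And>f g. (\<And>x. x \<in> carrier G \<Longrightarrow> f x = g x) \<Longrightarrow> I f = I g"
    and "\<And>f c. f \<in> CP T \<Longrightarrow> 0 \<le> c \<Longrightarrow> I (\<lambda>x. c * f x) = ennreal c * I f"
    and "\<And>f a. f \<in> CP T \<Longrightarrow> a \<in> carrier G \<Longrightarrow> I (\<lambda>x. f (x \<otimes> a)) = I f"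
    and "\<And>h A B. continuous_map (prod_topology T T) euclideanreal (\<lambda>(x, y). h x y) \<Longrightarrow>
        (\<And>x y. x \<in> carrier G \<Longrightarrow> y \<in> carrier G \<Longrightarrow> 0 \<le> h x y) \<Longrightarrow>
        compactin T A \<Longrightarrow> compactin T B \<Longrightarrow>
        (\<And>x y. x \<in> carrier G \<Longrightarrow> y \<in> carrier G \<Longrightarrow> (x, y) \<notin> A \<times> B \<Longrightarrow> h x y = 0) \<Longrightarrow>
        I (\<lambda>x. LINT y|\<mu>. h x y) = (\<integral>\<^sup>+y. I (\<lambda>x. h x y) \<partial>\<mu>)"
  shows "haar_functional I"
  unfolding haar_functional_def
proof (intro conjI allI ballI impI)
  show "I f = I g" if "\<forall>x\<in>carrier G. f x = g x" for f g
    by (rule assms(1)) (use that in blast)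
  show "I (\<lambda>x. c * f x) = ennreal c * I f" if "f \<in> CP T" "0 \<le> c" for f c
    by (rule assms(2)) (use that in blast)+
  show "I (\<lambda>x. f (x \<otimes> a)) = I f" if "f \<in> CP T" "a \<in> carrier G" for f a
    by (rule assms(3)) (use that in blast)+
  show "I (\<lambda>x. LINT y|\<mu>. h x y) = (\<integral>\<^sup>+y. I (\<lambda>x. h x y) \<partial>\<mu>)"
    if h: "continuous_map (prod_topology T T) euclideanreal (\<lambda>(x, y). h x y)"
      "\<forall>x\<in>carrier G. \<forall>y\<in>carrier G. 0 \<le> h x y" "compactin T A" "compactin T B"
      "\<forall>x\<in>carrier G. \<forall>y\<in>carrier G. (x, y) \<notin> A \<times> B \<longrightarrow> h x y = 0" for h A B
    by (rule assms(4)[OF h(1) _ h(3,4)]) (use h(2,5) in blast)+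
qed

lemma
  assumes "haar_functional I"
  shows haar_functional_cong: "(\<And>x. x \<in> carrier G \<Longrightarrow> f x = g x) \<Longrightarrow> I f = I g"
    and haar_functional_homog: "f \<in> CP T \<Longrightarrow> 0 \<le> c \<Longrightarrow> I (\<lambda>x. c * f x) = ennreal c * I f"
    and haar_functional_invar: "f \<in> CP T \<Longrightarrow> a \<in> carrier G \<Longrightarrow> I (\<lambda>x. f (x \<otimes> a)) = I f"
    and haar_functional_fubini: "continuous_map (prod_topology T T) euclideanreal (\<lambda>(x, y). h x y) \<Longrightarrow>
        (\<And>x y. x \<in> carrier G \<Longrightarrow> y \<in> carrier G \<Longrightarrow> 0 \<le> h x y) \<Longrightarrow>
        compactin T A \<Longrightarrow> compactin T B \<Longrightarrow>
        (\<And>x y. x \<in> carrier G \<Longrightarrow> y \<in> carrier G \<Longrightarrow> (x, y) \<notin> A \<times> B \<Longrightarrow> h x y = 0) \<Longrightarrow>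
        I (\<lambda>x. LINT y|\<mu>. h x y) = (\<integral>\<^sup>+y. I (\<lambda>x. h x y) \<partial>\<mu>)"
proof -
  note H = assms[unfolded haar_functional_def]
  show "(\<And>x. x \<in> carrier G \<Longrightarrow> f x = g x) \<Longrightarrow> I f = I g"
    using H[THEN conjunct1] by blast
  show "f \<in> CP T \<Longrightarrow> 0 \<le> c \<Longrightarrow> I (\<lambda>x. c * f x) = ennreal c * I f"
    using H[THEN conjunct2, THEN conjunct1] by blast
  show "f \<in> CP T \<Longrightarrow> a \<in> carrier G \<Longrightarrow> I (\<lambda>x. f (x \<otimes> a)) = I f"
    using H[THEN conjunct2, THEN conjunct2, THEN conjunct1] by blast
  assume h: "continuous_map (prod_topology T T) euclideanreal (\<lambda>(x, y). h x y)"
    "\<And>x y. x \<in> carrier G \<Longrightarrow> y \<in> carrier G \<Longrightarrow> 0 \<le> h x y" "compactin T A" "compactin T B"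
    "\<And>x y. x \<in> carrier G \<Longrightarrow> y \<in> carrier G \<Longrightarrow> (x, y) \<notin> A \<times> B \<Longrightarrow> h x y = 0"
  show "I (\<lambda>x. LINT y|\<mu>. h x y) = (\<integral>\<^sup>+y. I (\<lambda>x. h x y) \<partial>\<mu>)"
    by (rule H[THEN conjunct2, THEN conjunct2, THEN conjunct2, rule_format, OF h(1) _ h(3,4)])
       (use h(2,5) in blast)+
qed

text \<open>Such a functional is proportional to the Haar integral: evaluate it on
  \<open>\<lambda>x. f x * g (y \<otimes> inv x)\<close>, integrated over \<open>y\<close>, in two ways. The substitution
  \<open>y \<mapsto> y \<otimes> x\<close> gives \<open>I f * \<integral> g\<close>, and \<open>x \<mapsto> x \<otimes> y\<close> gives
  \<open>I (\<lambda>x. g (inv x) * \<integral> f (x \<otimes> y) dy)\<close>. The function \<open>g\<close> is chosen to make the latter equal to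
  \<open>I p\<close>, and it does not depend on \<open>I\<close>.\<close>

lemma haar_functional_ratio:
  assumes I: "haar_functional I"
    and f: "f \<in> CP T" and z: "z \<in> carrier G" "0 < f z" and p: "p \<in> CP T"
  defines "g \<equiv> \<lambda>y. p (inv y) / (LINT t|\<mu>. f (inv y \<otimes> t))"
  shows "I p = I f * (\<integral>\<^sup>+y. ennreal (g y) \<partial>\<mu>)"
proof -
  note cong = haar_functional_cong[OF I] and homog = haar_functional_homog[OF I]
    and invar = haar_functional_invar[OF I] and fubini = haar_functional_fubini[OF I]
  obtain A where A: "compactin T A" "\<And>x. x \<in> topspace T \<Longrightarrow> x \<notin> A \<Longrightarrow> f x = 0"
    using CP_support[OF f] by blast
  define k where "k x = (LINT t|\<mu>. f (x \<otimes> t))" for x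
  have kpos: "0 < k x" if x: "x \<in> carrier G" for x
    unfolding k_def
    by (rule CP_integral_pos[OF CP_left_translate[OF f x], of "inv x \<otimes> z"])
       (use x z in \<open>simp_all add: m_assoc[symmetric]\<close>)
  have kcont: "continuous_map T euclideanreal k"
    unfolding k_def
  proof (rule continuous_map_parametric_integral)
    show "continuous_map (prod_topology T T) euclideanreal (\<lambda>(x, t). f (x \<otimes> t))"
      unfolding split_beta by (intro continuous_map_CP_compose[OF f] cont_intros)
    fix x assume "x \<in> topspace T"
    then obtain U L where U: "openin T U" "compactin T L" "x \<in> U" "U \<subseteq> L"
      using relatively_compact_nhd_point[of x] by auto
    have "f (x' \<otimes> y) = 0" if x': "x' \<in> U" and y: "y \<in> topspace T - ((\<lambda>x. inv x) ` L <#> A)" for x' y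
    proof -
      have c: "x' \<in> carrier G" "y \<in> carrier G" using x' y carrier_of_openin[OF U(1)] by auto
      have "x' \<otimes> y \<notin> A"
        using set_multI[of "inv x'" "(\<lambda>x. inv x) ` L" "x' \<otimes> y" A] x' y U(4) c
        by (auto simp: m_assoc[symmetric])
      then show ?thesis using A(2) c by simp
    qed
    then show "\<exists>U K. openin T U \<and> x \<in> U \<and> compactin T K \<and>
        (\<forall>x'\<in>U. \<forall>y\<in>topspace T - K. f (x' \<otimes> y) = 0)"
      using U compactin_set_mult[OF compactin_inv_image[OF U(2)] A(1)] by blast
  qed
  have g_eq: "g = (\<lambda>y. p (inv y) * inverse (k (inv y)))"
    by (simp add: g_def k_def divide_inverse)
  have g: "g \<in> CP T"
    unfolding g_eq
  proof (rule CP_mult[OF CP_inverse[OF p]])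
    have "continuous_map T euclideanreal (\<lambda>y. k (inv y))"
      using continuous_map_compose[OF continuous_inv kcont] by (simp add: o_def)
    moreover have "k (inv y) \<noteq> 0" if "y \<in> topspace T" for y
      using kpos[of "inv y"] that by simp
    ultimately show "continuous_map T euclideanreal (\<lambda>y. inverse (k (inv y)))"
      by (rule continuous_map_real_inverse)
    show "0 \<le> inverse (k (inv x))" if "x \<in> topspace T" for x
      using kpos[of "inv x"] that by simp
  qed
  obtain B where B: "compactin T B" "\<And>x. x \<in> topspace T \<Longrightarrow> x \<notin> B \<Longrightarrow> g x = 0"
    using CP_support[OF g] by blast
  have "I f * (\<integral>\<^sup>+y. ennreal (g y) \<partial>\<mu>) = I (\<lambda>x. (LINT y|\<mu>. g y) * f x)"
    using homog[OF f CP_integral_nonneg[OF g]] CP_nn_integral[OF g] by (simp add: mult.commute)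
  also have "\<dots> = I (\<lambda>x. LINT y|\<mu>. f x * g (y \<otimes> inv x))"
  proof (rule cong)
    fix x assume x: "x \<in> carrier G"
    then show "(LINT y|\<mu>. g y) * f x = (LINT y|\<mu>. f x * g (y \<otimes> inv x))"
      using integral_translate[of "inv x" g] continuous_measurable[OF CP_cont[OF g]] by simp
  qed
  also have "\<dots> = (\<integral>\<^sup>+y. I (\<lambda>x. f x * g (y \<otimes> inv x)) \<partial>\<mu>)"
  proof (rule fubini)
    show "continuous_map (prod_topology T T) euclideanreal (\<lambda>(x, y). f x * g (y \<otimes> inv x))"
      unfolding split_beta
      by (intro continuous_map_real_mult continuous_map_CP_compose[OF f] continuous_map_CP_compose[OF g] cont_intros)
    show "compactin T A" "compactin T (B <#> A)"
      using A B by (auto intro: compactin_set_mult)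
    fix x y assume xy: "x \<in> carrier G" "y \<in> carrier G"
    show "0 \<le> f x * g (y \<otimes> inv x)" using xy CP_ge0[OF f] CP_ge0[OF g] by simp
    assume "(x, y) \<notin> A \<times> (B <#> A)"
    then have "x \<notin> A \<or> y \<otimes> inv x \<notin> B"
      using set_multI[of "y \<otimes> inv x" B x A] xy by (auto simp: m_assoc)
    then show "f x * g (y \<otimes> inv x) = 0" using A(2) B(2) xy by auto
  qed
  also have "\<dots> = (\<integral>\<^sup>+y. I (\<lambda>x. f (x \<otimes> y) * g (inv x)) \<partial>\<mu>)"
  proof (rule nn_integral_cong)
    fix y assume "y \<in> space \<mu>"
    then have y: "y \<in> carrier G" by simp
    have "(\<lambda>x. f x * g (y \<otimes> inv x)) \<in> CP T"
      by (rule CP_mult[OF f])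
         (use y CP_ge0[OF g] in \<open>auto intro!: continuous_map_CP_compose[OF g] cont_intros\<close>)
    from invar[OF this y] have "I (\<lambda>x. f x * g (y \<otimes> inv x)) = I (\<lambda>x. f (x \<otimes> y) * g (y \<otimes> inv (x \<otimes> y)))"
      by simp
    also have "\<dots> = I (\<lambda>x. f (x \<otimes> y) * g (inv x))"
    proof (rule cong)
      fix x assume "x \<in> carrier G"
      then have "y \<otimes> inv (x \<otimes> y) = inv x"
        using y by (simp add: inv_mult_group m_assoc[symmetric])
      then show "f (x \<otimes> y) * g (y \<otimes> inv (x \<otimes> y)) = f (x \<otimes> y) * g (inv x)" by simp
    qed
    finally show "I (\<lambda>x. f x * g (y \<otimes> inv x)) = I (\<lambda>x. f (x \<otimes> y) * g (inv x))" .
  qed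
  also have "\<dots> = I (\<lambda>x. LINT y|\<mu>. f (x \<otimes> y) * g (inv x))"
  proof (rule fubini[symmetric])
    show "continuous_map (prod_topology T T) euclideanreal (\<lambda>(x, y). f (x \<otimes> y) * g (inv x))"
      unfolding split_beta
      by (intro continuous_map_real_mult continuous_map_CP_compose[OF f] continuous_map_CP_compose[OF g] cont_intros)
    show "compactin T ((\<lambda>x. inv x) ` B)" "compactin T (B <#> A)"
      using A B by (auto intro: compactin_set_mult compactin_inv_image)
    fix x y assume xy: "x \<in> carrier G" "y \<in> carrier G"
    show "0 \<le> f (x \<otimes> y) * g (inv x)" using xy CP_ge0[OF f] CP_ge0[OF g] by simp
    assume n: "(x, y) \<notin> (\<lambda>x. inv x) ` B \<times> (B <#> A)"
    have "inv x \<notin> B \<or> x \<otimes> y \<notin> A"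
    proof (rule ccontr)
      assume "\<not> ?thesis"
      then have "inv x \<in> B" "x \<otimes> y \<in> A" by auto
      then have "inv x \<otimes> (x \<otimes> y) \<in> B <#> A" "inv (inv x) \<in> (\<lambda>x. inv x) ` B"
        using set_multI by blast+
      then show False using n xy by (simp add: m_assoc[symmetric])
    qed
    then show "f (x \<otimes> y) * g (inv x) = 0" using A(2) B(2) xy by auto
  qed
  also have "\<dots> = I p"
  proof (rule cong)
    fix x assume x: "x \<in> carrier G"
    have "(LINT y|\<mu>. f (x \<otimes> y) * g (inv x)) = g (inv x) * k x"
      by (simp add: k_def)
    also have "\<dots> = p x"
      using kpos[OF x] x by (simp add: g_eq)
    finally show "(LINT y|\<mu>. f (x \<otimes> y) * g (inv x)) = p x" .
  qed
  finally show ?thesis by simp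
qed

lemma haar_functional_integral: "haar_functional (\<lambda>q. \<integral>\<^sup>+y. ennreal (q y) \<partial>\<mu>)"
proof (rule haar_functionalI)
  show "(\<integral>\<^sup>+y. ennreal (f y) \<partial>\<mu>) = (\<integral>\<^sup>+y. ennreal (g y) \<partial>\<mu>)"
    if "\<And>x. x \<in> carrier G \<Longrightarrow> f x = g x" for f g
    by (rule nn_integral_cong) (use that in simp)
  show "(\<integral>\<^sup>+y. ennreal (c * f y) \<partial>\<mu>) = ennreal c * (\<integral>\<^sup>+y. ennreal (f y) \<partial>\<mu>)"
    if "f \<in> CP T" "0 \<le> c" for f c
    using that continuous_measurable[OF CP_cont[OF that(1)]]
    by (simp add: ennreal_mult' nn_integral_cmult)
  show "(\<integral>\<^sup>+y. ennreal (f (y \<otimes> a)) \<partial>\<mu>) = (\<integral>\<^sup>+y. ennreal (f y) \<partial>\<mu>)"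
    if "f \<in> CP T" "a \<in> carrier G" for f a
    using nn_integral_translate[OF that(2), of "\<lambda>x. ennreal (f x)"]
      continuous_measurable[OF CP_cont[OF that(1)]] by simp
  fix h :: "'a \<Rightarrow> 'a \<Rightarrow> real" and A B
  assume h: "continuous_map (prod_topology T T) euclideanreal (\<lambda>(x, y). h x y)"
    "\<And>x y. x \<in> carrier G \<Longrightarrow> y \<in> carrier G \<Longrightarrow> 0 \<le> h x y"
    and A: "compactin T A" and B: "compactin T B"
    and supp: "\<And>x y. x \<in> carrier G \<Longrightarrow> y \<in> carrier G \<Longrightarrow> (x, y) \<notin> A \<times> B \<Longrightarrow> h x y = 0"
  have "(\<integral>\<^sup>+x. ennreal (LINT y|\<mu>. h x y) \<partial>\<mu>) = (\<integral>\<^sup>+x. \<integral>\<^sup>+y. ennreal (h x y) * 1 \<partial>\<mu> \<partial>\<mu>)"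
  proof (rule nn_integral_cong)
    fix x assume "x \<in> space \<mu>"
    then have x: "x \<in> carrier G" by simp
    have "continuous_map T euclideanreal (\<lambda>y. h x y)"
      using slice_continuous[OF h(1)] x by simp
    then have "(\<lambda>y. h x y) \<in> CP T"
      by (rule CP_I[OF _ _ B]) (use h(2) supp x in auto)
    then show "ennreal (LINT y|\<mu>. h x y) = (\<integral>\<^sup>+y. ennreal (h x y) * 1 \<partial>\<mu>)"
      by (simp add: CP_nn_integral)
  qed
  also have "\<dots> = (\<integral>\<^sup>+y. \<integral>\<^sup>+x. ennreal (h x y) * 1 \<partial>\<mu> \<partial>\<mu>)"
    by (rule compact_support_Tonelli[OF locally_finite_measure_axioms sigma_finite
          locally_finite_measure_axioms sigma_finite h(1) A B supp]) simp_all
  finally show "(\<integral>\<^sup>+x. ennreal (LINT y|\<mu>. h x y) \<partial>\<mu>) = (\<integral>\<^sup>+y. \<integral>\<^sup>+x. ennreal (h x y) \<partial>\<mu> \<partial>\<mu>)"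
    by simp
qed
theorem haar_functional_unique:
  assumes I: "haar_functional I"
    and f: "f \<in> CP T" and z: "z \<in> carrier G" "0 < f z" and p: "p \<in> CP T"
  shows "I p * (\<integral>\<^sup>+y. ennreal (f y) \<partial>\<mu>) = I f * (\<integral>\<^sup>+y. ennreal (p y) \<partial>\<mu>)"
proof -
  obtain N where "I p = I f * N" "(\<integral>\<^sup>+y. ennreal (p y) \<partial>\<mu>) = (\<integral>\<^sup>+y. ennreal (f y) \<partial>\<mu>) * N"
    using haar_functional_ratio[OF I f z p] haar_functional_ratio[OF haar_functional_integral f z p]
    by blast
  then show ?thesis by (simp only: mult.assoc mult.commute[of N])
qed


lemma haar_functional_proportional:
  assumes I: "haar_functional I"
    and pos: "\<And>f. f \<in> CP T \<Longrightarrow> 0 < f \<one> \<Longrightarrow> 0 < I f \<and> I f < \<infinity>"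
  obtains \<kappa> where "0 < \<kappa>" "\<And>p. p \<in> CP T \<Longrightarrow> I p = ennreal \<kappa> * (\<integral>\<^sup>+x. ennreal (p x) \<partial>\<mu>)"
proof -
  obtain f where f: "f \<in> CP T" "f \<one> = 1" by (rule CP_bump_one)
  define i where "i = (LINT x|\<mu>. f x)"
  have i: "0 < i" unfolding i_def by (rule CP_integral_pos[OF f(1), of \<one>]) (use f(2) in auto)
  obtain w where w: "I f = ennreal w" "0 < w"
    using pos[OF f(1)] f(2) by (cases "I f") auto
  show ?thesis
  proof (rule that[of "w / i"])
    show "0 < w / i" using w i by simp
    fix p assume p: "p \<in> CP T"
    have "I p * ennreal i = ennreal w * (\<integral>\<^sup>+x. ennreal (p x) \<partial>\<mu>)"
      using haar_functional_unique[OF I f(1) _ _ p, of \<one>] f(2) w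
      by (simp add: CP_nn_integral[OF f(1)] i_def)
    then have "I p * (ennreal i * ennreal (1 / i)) = (ennreal w * ennreal (1 / i)) * (\<integral>\<^sup>+x. ennreal (p x) \<partial>\<mu>)"
      by (metis mult.assoc mult.commute)
    then show "I p = ennreal (w / i) * (\<integral>\<^sup>+x. ennreal (p x) \<partial>\<mu>)"
      using i w(2) by (simp flip: ennreal_mult)
  qed
qed


section \<open>Borel lengths are bounded on compact sets\<close>

lemma outer_regular:
  "A \<in> sets \<mu> \<Longrightarrow> emeasure \<mu> A = (INF U\<in>{U. openin T U \<and> A \<subseteq> U}. emeasure \<mu> U)"
  using haar unfolding right_haar_measure_def by blast

lemma inner_regular_open:
  "openin T U \<Longrightarrow> emeasure \<mu> U = (SUP K\<in>{K. compactin T K \<and> K \<subseteq> U}. emeasure \<mu> K)"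
  using haar unfolding right_haar_measure_def by blast

text \<open>Steinhaus' theorem. By regularity there are an open \<open>U\<close> containing \<open>A\<close> and a compact \<open>K\<close> in
  \<open>U\<close> such that \<open>E = A \<inter> K\<close> has more than half the measure of \<open>U\<close>. For \<open>v\<close> near \<open>\<one>\<close> the translate
  \<open>E #> v\<close> stays in \<open>U\<close>, so it meets \<open>E\<close>.\<close>

lemma difference_set_nhd:
  assumes A: "A \<in> sets \<mu>" "0 < emeasure \<mu> A" "emeasure \<mu> A < \<infinity>"
  obtains V where "openin T V" "\<one> \<in> V" "\<And>v. v \<in> V \<Longrightarrow> \<exists>a\<in>A. \<exists>b\<in>A. v = inv a \<otimes> b"
proof -
  define m where "m = measure \<mu> A"
  have mA: "emeasure \<mu> A = ennreal m"
    using A(3) unfolding m_def by (intro emeasure_eq_ennreal_measure) auto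
  then have "0 < m" using A(2) by simp
  note m = mA this
  have Asub: "A \<subseteq> carrier G" using sets.sets_into_space[OF A(1)] by simp
  have "(INF U\<in>{U. openin T U \<and> A \<subseteq> U}. emeasure \<mu> U) < ennreal (2 * m)"
    unfolding outer_regular[OF A(1), symmetric] m(1) using m(2) by (simp add: ennreal_less_iff)
  then obtain U where U: "openin T U" "A \<subseteq> U" "emeasure \<mu> U < ennreal (2 * m)"
    by (auto simp: INF_less_iff)
  define u where "u = measure \<mu> U"
  have u: "emeasure \<mu> U = ennreal u"
    using U(3) unfolding u_def by (intro emeasure_eq_ennreal_measure) auto
  have u2: "u < 2 * m" using U(3) u by (simp add: ennreal_less_iff u_def)
  have mu: "m \<le> u"
    using emeasure_mono[OF U(2) open_sets[OF U(1)]] m u by (simp add: u_def)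
  have "ennreal (3 / 2 * u - m) < (SUP K\<in>{K. compactin T K \<and> K \<subseteq> U}. emeasure \<mu> K)"
  proof -
    have "(SUP K\<in>{K. compactin T K \<and> K \<subseteq> U}. emeasure \<mu> K) = ennreal u"
      using inner_regular_open[OF U(1)] u by simp
    then show ?thesis using u2 mu m(2) by (simp add: ennreal_less_iff)
  qed
  then obtain K where K: "compactin T K" "K \<subseteq> U" "ennreal (3 / 2 * u - m) < emeasure \<mu> K"
    by (auto simp: less_SUP_iff)
  define W where "W = {z \<in> topspace (prod_topology T T). (\<lambda>(x, y). x \<otimes> y) z \<in> U}"
  have W: "openin (prod_topology T T) W"
    unfolding W_def by (rule openin_continuous_map_preimage[OF continuous_mult U(1)])
  have KW: "K \<times> {\<one>} \<subseteq> W"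
    using K carrier_of_compactin[OF K(1)] by (auto simp: W_def)
  obtain U' V where V: "openin T V" "\<one> \<in> V" "K \<subseteq> U'" "U' \<times> V \<subseteq> W"
    using tube_lemma_left[OF W K(1) _ KW] by auto
  define E where "E = A \<inter> K"
  have E: "E \<in> sets \<mu>" using A(1) compact_sets[OF K(1)] by (simp add: E_def)
  have EU: "E \<subseteq> U" using U(2) by (auto simp: E_def)
  have fin: "emeasure \<mu> X \<noteq> \<infinity>" if "X \<in> sets \<mu>" "X \<subseteq> U" for X
    using emeasure_mono[OF that(2) open_sets[OF U(1)]] u by (auto simp: top_unique)
  have mE: "u / 2 < measure \<mu> E"
  proof -
    have KU: "emeasure \<mu> K = ennreal (measure \<mu> K)"
      using fin[OF compact_sets[OF K(1)] K(2)] by (intro emeasure_eq_ennreal_measure) auto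
    then have "3 / 2 * u - m < measure \<mu> K"
      using K(3) ennreal_leI[of "measure \<mu> K" "3 / 2 * u - m"] by (metis not_le)
    moreover have "measure \<mu> (A \<union> K) = m + measure \<mu> K - measure \<mu> E"
      unfolding E_def m_def
      by (rule measure_Un3) (use A compact_sets[OF K(1)] KU m in \<open>auto simp: fmeasurable_def\<close>)
    moreover have "measure \<mu> (A \<union> K) \<le> u"
      unfolding u_def
      by (rule measure_mono_fmeasurable)
         (use A K(2) U compact_sets[OF K(1)] open_sets[OF U(1)] u in \<open>auto simp: fmeasurable_def\<close>)
    ultimately show ?thesis by linarith
  qed
  show ?thesis
  proof (rule that[OF V(1,2)])
    fix v assume v: "v \<in> V"
    have vc: "v \<in> carrier G" using carrier_of_openin[OF V(1) v] .
    have EvU: "E #> v \<subseteq> U"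
    proof
      fix x assume "x \<in> E #> v"
      then obtain e where e: "e \<in> E" "x = e \<otimes> v" unfolding r_coset_def by blast
      then have "(e, v) \<in> W" using V(3,4) v by (auto simp: E_def)
      then show "x \<in> U" using e by (simp add: W_def)
    qed
    have Ev: "E #> v \<in> sets \<mu>"
    proof -
      have "E #> v = (\<lambda>x. x \<otimes> inv v) -` E \<inter> space \<mu>"
        using r_coset_eq_preimage[of E v] vc Asub by (auto simp: E_def)
      then show ?thesis using measurable_sets[OF translate_measurable E] vc by simp
    qed
    have "E \<inter> (E #> v) \<noteq> {}"
    proof
      assume "E \<inter> (E #> v) = {}"
      then have "measure \<mu> (E \<union> (E #> v)) = measure \<mu> E + measure \<mu> (E #> v)"
        using E Ev fin EU EvU by (intro measure_Union) auto
      moreover have "measure \<mu> (E #> v) = measure \<mu> E"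
        using emeasure_translate[OF E vc] by (simp add: measure_def)
      moreover have "measure \<mu> (E \<union> (E #> v)) \<le> u"
        unfolding u_def
        by (rule measure_mono_fmeasurable)
           (use E Ev EU EvU open_sets[OF U(1)] u in \<open>auto simp: fmeasurable_def\<close>)
      ultimately show False using mE by linarith
    qed
    then obtain b a where ab: "b \<in> E" "a \<in> E" "b = a \<otimes> v" unfolding r_coset_def by blast
    then have "v = inv a \<otimes> b" using vc Asub by (auto simp: E_def m_assoc[symmetric])
    then show "\<exists>a\<in>A. \<exists>b\<in>A. v = inv a \<otimes> b" using ab by (auto simp: E_def)
  qed
qed

text \<open>Some sublevel set of the length has positive measure, so the length is bounded near \<open>\<one>\<close> by
  Steinhaus' theorem; finitely many translates cover a compact set.\<close>

lemma length_bounded_on_compact: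
  assumes l: "is_length G T l" and K: "compactin T K"
  obtains M where "0 \<le> M" "\<And>x. x \<in> K \<Longrightarrow> l x \<le> M"
proof -
  have lm: "l \<in> borel_measurable \<mu>" using l by (simp add: is_length_def measurable_mu)
  obtain C where C: "\<And>n::nat. compactin T (C n)" "incseq C" "(\<Union>n. C n) = carrier G"
    using sigma_compact by blast
  define D where "D = (\<lambda>(n, m). {x \<in> space \<mu>. l x \<le> real n} \<inter> C m)"
  have "{x \<in> space \<mu>. l x \<le> real n} \<in> sets \<mu>" for n
    using lm by measurable
  then have D: "D z \<in> sets \<mu>" for z
    using compact_sets[OF C(1)] by (auto simp: D_def split_beta)
  have "\<exists>z. emeasure \<mu> (D z) \<noteq> 0"
  proof (rule ccontr)
    assume "\<not> ?thesis"
    then have "(\<Union>z. D z) \<in> null_sets \<mu>"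
      using D by (intro null_sets_UN) (auto simp: null_sets_def)
    moreover have "(\<Union>z. D z) = carrier G"
    proof (intro Set.set_eqI iffI)
      fix x assume x: "x \<in> carrier G"
      then obtain m where "x \<in> C m" using C(3) by blast
      moreover obtain n where "l x \<le> real n" using real_arch_simple by blast
      ultimately have "x \<in> D (n, m)" using x by (simp add: D_def)
      then show "x \<in> (\<Union>z. D z)" by blast
    qed (auto simp: D_def)
    ultimately show False using haar by (auto simp: right_haar_measure_def null_sets_def)
  qed
  then obtain n m where nm: "emeasure \<mu> (D (n, m)) \<noteq> 0" by auto
  have "emeasure \<mu> (D (n, m)) < \<infinity>"
    using emeasure_mono[of "D (n, m)" "C m" \<mu>] compact_sets[OF C(1)] finite_compact[OF C(1)[of m]]
    by (auto simp: D_def intro: le_less_trans)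
  then obtain V where V: "openin T V" "\<one> \<in> V" "\<And>v. v \<in> V \<Longrightarrow> \<exists>a\<in>D (n, m). \<exists>b\<in>D (n, m). v = inv a \<otimes> b"
    using difference_set_nhd[OF D, of "(n, m)"] nm by (auto simp: zero_less_iff_neq_zero)
  have lV: "l v \<le> 2 * real n" if "v \<in> V" for v
  proof -
    obtain a b where ab: "a \<in> D (n, m)" "b \<in> D (n, m)" "v = inv a \<otimes> b"
      using V(3)[OF \<open>v \<in> V\<close>] by blast
    have c: "a \<in> carrier G" "b \<in> carrier G" "l a \<le> real n" "l b \<le> real n"
      using ab by (auto simp: D_def)
    have "l v \<le> l (inv a) + l b" "l (inv a) = l a"
      using l ab(3) c(1,2) inv_closed[OF c(1)] unfolding is_length_def by blast+
    then show ?thesis using c by linarith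
  qed
  obtain F where F: "finite F" "F \<subseteq> K" "K \<subseteq> (\<Union>x\<in>F. V #> x)"
    using compact_translate_cover[OF K V(1,2)] by blast
  show ?thesis
  proof (rule that)
    show "0 \<le> 2 * real n + (\<Sum>y\<in>F. \<bar>l y\<bar>)" by (simp add: sum_nonneg)
    fix x assume "x \<in> K"
    then obtain v y where vy: "y \<in> F" "v \<in> V" "x = v \<otimes> y" using F(3) unfolding r_coset_def by blast
    have "v \<in> carrier G" "y \<in> carrier G"
      using vy F(2) carrier_of_openin[OF V(1)] carrier_of_compactin[OF K] by blast+
    then have "l x \<le> l v + l y"
      using l vy(3) unfolding is_length_def by blast
    moreover have "l y \<le> (\<Sum>y\<in>F. \<bar>l y\<bar>)"
      using member_le_sum[OF vy(1), of "\<lambda>y. \<bar>l y\<bar>"] F(1) by simp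
    ultimately show "l x \<le> 2 * real n + (\<Sum>y\<in>F. \<bar>l y\<bar>)" using lV[OF vy(2)] by linarith
  qed
qed

end

section \<open>Property RD as a bound for a trilinear form\<close>

text \<open>The \<open>L\<^sup>2\<close>-norm, for functions in \<open>CP T\<close>; the integral takes its default value \<open>0\<close> when the
  square is not integrable.\<close>

definition CP_norm :: "'a measure \<Rightarrow> ('a \<Rightarrow> real) \<Rightarrow> real" where
  "CP_norm \<mu> f = sqrt (LINT x|\<mu>. (f x)\<^sup>2)"

text \<open>The pairing \<open>\<langle>u, f * g\<rangle>\<close> of \<open>u\<close> with the convolution of \<open>f\<close> and \<open>g\<close>.\<close>

definition trilinear ::
  "('a, 'c) monoid_scheme \<Rightarrow> 'a measure \<Rightarrow> ('a \<Rightarrow> real) \<Rightarrow> ('a \<Rightarrow> real) \<Rightarrow> ('a \<Rightarrow> real) \<Rightarrow> ennreal"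
  where
  "trilinear G \<mu> f g u =
     (\<integral>\<^sup>+x. \<integral>\<^sup>+y. ennreal (u x * f (x \<otimes>\<^bsub>G\<^esub> inv\<^bsub>G\<^esub> y) * g y) \<partial>\<mu> \<partial>\<mu>)"

text \<open>The bound on the trilinear form that is equivalent to property RD, with its two constants.
  A free upper bound \<open>L\<close> for the length on the support of \<open>f\<close> replaces the supremum.\<close>

definition trilinear_RD ::
  "('a, 'c) monoid_scheme \<Rightarrow> 'a topology \<Rightarrow> 'a measure \<Rightarrow> ('a \<Rightarrow> real) \<Rightarrow> real \<Rightarrow> real \<Rightarrow> bool"
  where
  "trilinear_RD G T \<mu> l s C \<longleftrightarrow>
     (\<forall>f\<in>CP T. \<forall>g\<in>CP T. \<forall>u\<in>CP T. \<forall>L\<ge>0. (\<forall>x\<in>carrier G. f x \<noteq> 0 \<longrightarrow> l x \<le> L) \<longrightarrow>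
        trilinear G \<mu> f g u
          \<le> ennreal (C * (1 + L) powr s * CP_norm \<mu> f * CP_norm \<mu> g * CP_norm \<mu> u))"

lemma trilinear_RD_D:
  assumes "trilinear_RD G T \<mu> l s C" "f \<in> CP T" "g \<in> CP T" "u \<in> CP T" "0 \<le> L"
    "\<And>x. x \<in> carrier G \<Longrightarrow> f x \<noteq> 0 \<Longrightarrow> l x \<le> L"
  shows "trilinear G \<mu> f g u
    \<le> ennreal (C * (1 + L) powr s * CP_norm \<mu> f * CP_norm \<mu> g * CP_norm \<mu> u)"
  using assms unfolding trilinear_RD_def by blast

lemma ennreal_power2_le_imp_le:
  assumes "a\<^sup>2 \<le> (ennreal b)\<^sup>2" "0 \<le> b"
  shows "a \<le> ennreal b"
proof (cases a)
  case (real r)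
  then have "r\<^sup>2 \<le> b\<^sup>2" using assms by (simp add: ennreal_power)
  then show ?thesis using real assms(2) power2_le_imp_le[of r b] by (simp add: ennreal_leI)
next
  case top
  then show ?thesis using assms by (simp add: ennreal_power top_unique)
qed

lemma CP_norm_nonneg: "0 \<le> CP_norm \<mu> f"
  by (simp add: CP_norm_def)

lemma CP_norm_square: "(CP_norm \<mu> f)\<^sup>2 = (LINT x|\<mu>. (f x)\<^sup>2)"
  by (simp add: CP_norm_def)

lemma CP_norm_cong: "(\<And>x. x \<in> space \<mu> \<Longrightarrow> f x = g x) \<Longrightarrow> CP_norm \<mu> f = CP_norm \<mu> g"
  unfolding CP_norm_def by (intro arg_cong[of _ _ sqrt] Bochner_Integration.integral_cong) auto

lemma CP_square: "f \<in> CP T \<Longrightarrow> (\<lambda>x. (f x)\<^sup>2) \<in> CP T"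
  unfolding power2_eq_square by (rule CP_mult) (auto simp: CP_cont CP_nonneg)

context locally_finite_measure
begin

lemma CP_norm_nn: "f \<in> CP T \<Longrightarrow> (\<integral>\<^sup>+x. (ennreal (f x))\<^sup>2 \<partial>\<mu>) = ennreal ((CP_norm \<mu> f)\<^sup>2)"
proof -
  assume f: "f \<in> CP T"
  have "(\<integral>\<^sup>+x. (ennreal (f x))\<^sup>2 \<partial>\<mu>) = (\<integral>\<^sup>+x. ennreal ((f x)\<^sup>2) \<partial>\<mu>)"
    by (rule nn_integral_cong) (use CP_nonneg[OF f] in \<open>simp add: space_mu ennreal_power\<close>)
  then show ?thesis using CP_nn_integral[OF CP_square[OF f]] by (simp add: CP_norm_square)
qed

lemma CP_Cauchy_Schwarz:
  assumes f: "f \<in> CP T" and g: "g \<in> CP T"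
  shows "(\<integral>\<^sup>+x. ennreal (f x * g x) \<partial>\<mu>) \<le> ennreal (CP_norm \<mu> f * CP_norm \<mu> g)"
proof -
  have fg: "(\<lambda>x. f x * g x) \<in> CP T"
    by (rule CP_mult[OF f CP_cont[OF g]]) (use CP_nonneg[OF g] in auto)
  have "(\<integral>\<^sup>+x. ennreal (f x * g x) \<partial>\<mu>) = (\<integral>\<^sup>+x. ennreal (f x) * ennreal (g x) \<partial>\<mu>)"
    by (rule nn_integral_cong) (use CP_nonneg[OF f] in \<open>simp add: space_mu ennreal_mult'\<close>)
  then have "(\<integral>\<^sup>+x. ennreal (f x * g x) \<partial>\<mu>)\<^sup>2
      \<le> ennreal ((CP_norm \<mu> f)\<^sup>2) * ennreal ((CP_norm \<mu> g)\<^sup>2)"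
    using Cauchy_Schwarz_nn_integral[of "\<lambda>x. ennreal (f x)" \<mu> "\<lambda>x. ennreal (g x)"]
      continuous_measurable[OF CP_cont[OF f]] continuous_measurable[OF CP_cont[OF g]]
    by (simp add: CP_norm_nn[OF f] CP_norm_nn[OF g])
  then have "(LINT x|\<mu>. f x * g x)\<^sup>2 \<le> (CP_norm \<mu> f * CP_norm \<mu> g)\<^sup>2"
    using CP_integral_nonneg[OF fg]
    by (simp add: CP_nn_integral[OF fg] ennreal_power ennreal_mult'[symmetric] power_mult_distrib)
  then have "(LINT x|\<mu>. f x * g x) \<le> CP_norm \<mu> f * CP_norm \<mu> g"
    by (rule power2_le_imp_le) (simp add: CP_norm_nonneg)
  then show ?thesis by (simp add: CP_nn_integral[OF fg] ennreal_leI)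
qed

end

context haar_group
begin

lemma CP_norm_translate:
  assumes "a \<in> carrier G" "f \<in> CP T"
  shows "CP_norm \<mu> (\<lambda>x. f (x \<otimes> a)) = CP_norm \<mu> f"
  using integral_translate[OF assms(1), of "\<lambda>x. (f x)\<^sup>2"] continuous_measurable[OF CP_cont[OF assms(2)]]
  by (simp add: CP_norm_def)

lemma CP_convolution_integrand:
  assumes f: "f \<in> CP T" and g: "g \<in> CP T" and x: "x \<in> carrier G"
  shows "(\<lambda>y. f (x \<otimes> inv y) * g y) \<in> CP T"
proof -
  have "(\<lambda>y. g y * f (x \<otimes> inv y)) \<in> CP T"
    by (rule CP_mult[OF g])
       (use x CP_ge0[OF f] in \<open>auto intro!: continuous_map_CP_compose[OF f] cont_intros\<close>)
  then show ?thesis by (simp add: mult.commute)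
qed

lemma CP_convolution:
  assumes f: "f \<in> CP T" and g: "g \<in> CP T"
  shows "(\<lambda>x. LINT y|\<mu>. f (x \<otimes> inv y) * g y) \<in> CP T"
proof -
  obtain A where A: "compactin T A" "\<And>x. x \<in> topspace T \<Longrightarrow> x \<notin> A \<Longrightarrow> f x = 0"
    using CP_support[OF f] by blast
  obtain B where B: "compactin T B" "\<And>x. x \<in> topspace T \<Longrightarrow> x \<notin> B \<Longrightarrow> g x = 0"
    using CP_support[OF g] by blast
  show ?thesis
  proof (rule CP_I)
    show "continuous_map T euclideanreal (\<lambda>x. LINT y|\<mu>. f (x \<otimes> inv y) * g y)"
    proof (rule continuous_map_parametric_integral)
      show "continuous_map (prod_topology T T) euclideanreal (\<lambda>(x, y). f (x \<otimes> inv y) * g y)"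
        unfolding split_beta
        by (intro continuous_map_real_mult continuous_map_CP_compose[OF f]
            continuous_map_CP_compose[OF g] cont_intros)
      fix x assume "x \<in> topspace T"
      then show "\<exists>U K. openin T U \<and> x \<in> U \<and> compactin T K \<and>
          (\<forall>x'\<in>U. \<forall>y\<in>topspace T - K. f (x' \<otimes> inv y) * g y = 0)"
        using B openin_carrier by - (rule exI[of _ "carrier G"], rule exI[of _ B], auto)
    qed
    show "0 \<le> (LINT y|\<mu>. f (x \<otimes> inv y) * g y)" if "x \<in> topspace T" for x
      using CP_integral_nonneg[OF CP_convolution_integrand[OF f g]] that by simp
    show "compactin T (A <#> B)" by (rule compactin_set_mult[OF A(1) B(1)])
    show "(LINT y|\<mu>. f (x \<otimes> inv y) * g y) = 0" if x: "x \<in> topspace T" "x \<notin> A <#> B" for x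
    proof -
      have "f (x \<otimes> inv y) * g y = 0" if y: "y \<in> carrier G" for y
      proof (cases "y \<in> B")
        case True
        then have "x \<otimes> inv y \<notin> A"
          using set_multI[of "x \<otimes> inv y" A y B] x y by (auto simp: m_assoc)
        then show ?thesis using A(2) x y by simp
      next
        case False
        then show ?thesis using B(2) y by simp
      qed
      then have "(LINT y|\<mu>. f (x \<otimes> inv y) * g y) = (LINT y|\<mu>. 0)"
        by (intro Bochner_Integration.integral_cong) auto
      then show ?thesis by simp
    qed
  qed
qed

lemma trilinear_convolution:
  assumes f: "f \<in> CP T" and g: "g \<in> CP T" and u: "u \<in> CP T"
  shows "trilinear G \<mu> f g u = (\<integral>\<^sup>+x. ennreal (u x * (LINT y|\<mu>. f (x \<otimes> inv y) * g y)) \<partial>\<mu>)"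
  unfolding trilinear_def
proof (rule nn_integral_cong)
  fix x assume "x \<in> space \<mu>"
  then have x: "x \<in> carrier G" by simp
  note c = CP_convolution_integrand[OF f g x]
  have "(\<integral>\<^sup>+y. ennreal (u x * f (x \<otimes> inv y) * g y) \<partial>\<mu>)
      = (\<integral>\<^sup>+y. ennreal (u x) * ennreal (f (x \<otimes> inv y) * g y) \<partial>\<mu>)"
    by (rule nn_integral_cong) (use CP_ge0[OF u x] in \<open>simp add: ennreal_mult' mult.assoc\<close>)
  also have "\<dots> = ennreal (u x) * ennreal (LINT y|\<mu>. f (x \<otimes> inv y) * g y)"
    using continuous_measurable[OF CP_cont[OF c]] by (simp add: nn_integral_cmult CP_nn_integral[OF c])
  finally show "(\<integral>\<^sup>+y. ennreal (u x * f (x \<otimes> inv y) * g y) \<partial>\<mu>) = ennreal (u x * (LINT y|\<mu>. f (x \<otimes> inv y) * g y))"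
    using CP_ge0[OF u x] by (simp add: ennreal_mult')
qed

lemma CP_complex_Cc:
  assumes f: "f \<in> CP T"
  shows "(\<lambda>x. complex_of_real (f x)) \<in> Cc T"
proof -
  obtain A where A: "compactin T A" "\<And>x. x \<in> topspace T \<Longrightarrow> x \<notin> A \<Longrightarrow> f x = 0"
    using CP_support[OF f] by blast
  have "continuous_map euclideanreal (euclidean :: complex topology) complex_of_real"
    by (simp add: continuous_on_of_real)
  from continuous_map_compose[OF CP_cont[OF f] this]
  have "continuous_map T euclidean (\<lambda>x. complex_of_real (f x))" by (simp add: o_def)
  moreover have "T closure_of {x \<in> topspace T. complex_of_real (f x) \<noteq> 0} \<subseteq> A"
    using A by (intro closure_of_minimal compactin_imp_closedin[OF Hausdorff_T]) auto
  then have "compactin T (T closure_of {x \<in> topspace T. complex_of_real (f x) \<noteq> 0})"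
    by (rule closed_compactin[OF A(1) _ closedin_closure_of])
  ultimately show ?thesis unfolding Cc_def by blast
qed

lemma RD_wrt_imp_trilinear:
  assumes RD: "RD_wrt G T \<mu> l"
  obtains s C where "0 < s" "0 < C"
    "trilinear_RD G T \<mu> l s C"
proof -
  obtain s C where s: "0 < s" "0 < C" and op: "\<And>f. f \<in> Cc T \<Longrightarrow> convolution_op_norm G \<mu> f
      \<le> ennreal (C * (1 + support_length G l f) powr s * L2_norm \<mu> f)"
    using RD unfolding RD_wrt_def by blast
  show ?thesis
  proof (rule that[OF s], unfold trilinear_RD_def, intro ballI allI impI)
    fix f g u L
    assume f: "f \<in> CP T" and g: "g \<in> CP T" and u: "u \<in> CP T" and L: "0 \<le> (L::real)"
      and fL: "\<forall>x\<in>carrier G. f x \<noteq> 0 \<longrightarrow> l x \<le> L"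
    let ?f = "\<lambda>x. complex_of_real (f x)"
    define c where "c x = (LINT y|\<mu>. f (x \<otimes> inv y) * g y)" for x
    have c: "c \<in> CP T" unfolding c_def by (rule CP_convolution[OF f g])
    define D where "D = C * (1 + L) powr s * CP_norm \<mu> f"
    have D: "0 \<le> D" using s CP_norm_nonneg[of \<mu> f] by (simp add: D_def)
    have norm_real: "L2_norm \<mu> (\<lambda>x. complex_of_real (h x)) = CP_norm \<mu> h" for h
      by (simp add: L2_norm_def CP_norm_def)
    have sl: "support_length G l ?f \<le> L" "0 \<le> support_length G l ?f"
    proof -
      have bd: "y \<le> L" if "y \<in> insert 0 (l ` {x \<in> carrier G. ?f x \<noteq> 0})" for y
        using that fL L by auto
      then show "support_length G l ?f \<le> L"
        unfolding support_length_def by (intro cSup_least) auto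
      show "0 \<le> support_length G l ?f"
        unfolding support_length_def using bd by (intro cSup_upper bdd_aboveI[of _ L]) auto
    qed
    have op': "convolution_op_norm G \<mu> ?f \<le> ennreal D"
    proof (rule order_trans[OF op[OF CP_complex_Cc[OF f]]])
      have "(1 + support_length G l ?f) powr s \<le> (1 + L) powr s"
        using sl s by (intro powr_mono2) auto
      then show "ennreal (C * (1 + support_length G l ?f) powr s * L2_norm \<mu> ?f) \<le> ennreal D"
        unfolding D_def norm_real using s CP_norm_nonneg
        by (intro ennreal_leI mult_right_mono mult_left_mono) auto
    qed
    \<comment> \<open>The operator norm only sees functions of norm at most \<open>1\<close>; since \<open>g\<close> may have norm \<open>0\<close>, all
      admissible multiples are needed rather than the normalization of \<open>g\<close>.\<close>
    have scaled: "t * CP_norm \<mu> c \<le> D" if t: "0 < t" "t * CP_norm \<mu> g \<le> 1" for t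
    proof -
      let ?g = "\<lambda>x. complex_of_real (t * g x)"
      have ng: "CP_norm \<mu> (\<lambda>x. t * h x) = t * CP_norm \<mu> h" for h
        using t by (simp add: CP_norm_def power_mult_distrib real_sqrt_mult)
      have "integrable \<mu> (\<lambda>x. (t * g x)\<^sup>2)"
        using CP_integrable[OF CP_square[OF g]] by (simp add: power_mult_distrib)
      moreover have "?g \<in> borel_measurable \<mu>"
        using continuous_measurable[OF CP_cont[OF g]] by measurable
      ultimately have "?g \<in> square_integrable \<mu>" "L2_norm \<mu> ?g \<le> 1"
        using t ng[of g] norm_real[of "\<lambda>x. t * g x"]
        by (simp_all only: square_integrable_def mem_Collect_eq norm_of_real power2_abs)
      then have "ennreal (L2_norm \<mu> (left_convolution G \<mu> ?f ?g)) \<le> convolution_op_norm G \<mu> ?f"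
        unfolding convolution_op_norm_def by (intro SUP_upper) simp
      also have "L2_norm \<mu> (left_convolution G \<mu> ?f ?g) = L2_norm \<mu> (\<lambda>x. complex_of_real (t * c x))"
        unfolding L2_norm_def
      proof (intro arg_cong[of _ _ sqrt] Bochner_Integration.integral_cong refl)
        fix x assume "x \<in> space \<mu>"
        then have x: "x \<in> carrier G" by simp
        have "left_convolution G \<mu> ?f ?g x = (LINT y|\<mu>. complex_of_real (t * (f (inv y) * g (y \<otimes> x))))"
          unfolding left_convolution_def
          by (intro Bochner_Integration.integral_cong) (auto simp: mult_ac)
        also have "\<dots> = complex_of_real (t * (LINT y|\<mu>. f (inv y) * g (y \<otimes> x)))"
          by (simp only: integral_complex_of_real integral_mult_right_zero)
        also have "(LINT y|\<mu>. f (inv y) * g (y \<otimes> x)) = (LINT y|\<mu>. f (x \<otimes> inv (y \<otimes> x)) * g (y \<otimes> x))"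
          by (intro Bochner_Integration.integral_cong)
             (use x in \<open>auto simp: inv_mult_group m_assoc[symmetric]\<close>)
        also have "\<dots> = c x"
          unfolding c_def
          by (rule integral_translate[OF x continuous_measurable[OF CP_cont[OF CP_convolution_integrand[OF f g x]]]])
        finally show "(cmod (left_convolution G \<mu> ?f ?g x))\<^sup>2 = (cmod (complex_of_real (t * c x)))\<^sup>2" by simp
      qed
      also have "\<dots> = t * CP_norm \<mu> c" by (simp only: norm_real ng)
      finally have "ennreal (t * CP_norm \<mu> c) \<le> ennreal D" using op' by (rule order_trans)
      then show ?thesis using D by simp
    qed
    have cD: "CP_norm \<mu> c \<le> D * CP_norm \<mu> g"
    proof (cases "CP_norm \<mu> g = 0")
      case True
      have "CP_norm \<mu> c = 0"
      proof (rule ccontr)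
        assume "CP_norm \<mu> c \<noteq> 0"
        then have pos: "0 < CP_norm \<mu> c" using CP_norm_nonneg[of \<mu> c] by simp
        then have "(D + 1) / CP_norm \<mu> c * CP_norm \<mu> c \<le> D"
          using D True by (intro scaled) auto
        then show False using pos by simp
      qed
      then show ?thesis using True by simp
    next
      case False
      then have pos: "0 < CP_norm \<mu> g" using CP_norm_nonneg[of \<mu> g] by simp
      then show ?thesis using scaled[of "1 / CP_norm \<mu> g"] by (simp add: pos_divide_le_eq)
    qed
    have "trilinear G \<mu> f g u \<le> ennreal (CP_norm \<mu> u * CP_norm \<mu> c)"
      unfolding trilinear_convolution[OF f g u] c_def[symmetric] by (rule CP_Cauchy_Schwarz[OF u c])
    also have "\<dots> \<le> ennreal (CP_norm \<mu> u * (D * CP_norm \<mu> g))"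
      by (intro ennreal_leI mult_left_mono cD CP_norm_nonneg)
    finally show "trilinear G \<mu> f g u
        \<le> ennreal (C * (1 + L) powr s * CP_norm \<mu> f * CP_norm \<mu> g * CP_norm \<mu> u)"
      by (simp add: D_def mult_ac)
  qed
qed

text \<open>The bound of the trilinear form on \<open>CP T\<close> extends to all square-integrable \<open>g\<close> without any
  density argument: by duality it bounds the adjoint convolution \<open>v\<close> of \<open>u\<close> and \<open>f\<close>, and
  \<open>\<langle>u, f * g\<rangle> = \<langle>v, g\<rangle>\<close>. The convolution \<open>w = f * g\<close> is continuous, so \<open>u\<close> may then be taken to be
  \<open>w\<close> multiplied by cutoff functions.\<close>

lemma trilinear_bound_square_integrable:
  assumes f: "f \<in> CP T" and D: "0 \<le> D"
    and bound: "\<And>g u. g \<in> CP T \<Longrightarrow> u \<in> CP T \<Longrightarrow>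
        trilinear G \<mu> f g u \<le> ennreal (D * CP_norm \<mu> g * CP_norm \<mu> u)"
    and g: "g \<in> borel_measurable \<mu>" and g1: "(\<integral>\<^sup>+y. (g y)\<^sup>2 \<partial>\<mu>) \<le> 1"
  defines "w \<equiv> \<lambda>x. \<integral>\<^sup>+y. ennreal (f (x \<otimes> inv y)) * g y \<partial>\<mu>"
  shows "w \<in> borel_measurable \<mu>" "(\<integral>\<^sup>+x. (w x)\<^sup>2 \<partial>\<mu>) \<le> ennreal (D\<^sup>2)"
proof -
  note g[measurable]
  obtain A where A: "compactin T A" "\<And>x. x \<in> topspace T \<Longrightarrow> x \<notin> A \<Longrightarrow> f x = 0"
    using CP_support[OF f] by blast
  \<comment> \<open>The measure with density \<open>g\<close> is locally finite, since \<open>g \<le> 1 + g\<^sup>2\<close>; so \<open>w\<close> is continuous.\<close>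
  define \<nu> where "\<nu> = density \<mu> g"
  interpret nu: locally_finite_measure T \<nu>
  proof
    show "sets \<nu> = sets (borel_sigma T)" by (simp add: \<nu>_def sets_borel)
    show "Hausdorff_space T" by (rule Hausdorff_T)
    fix K assume K: "compactin T K"
    note [measurable] = compact_sets[OF K]
    have "emeasure \<nu> K = (\<integral>\<^sup>+y. g y * indicator K y \<partial>\<mu>)"
      unfolding \<nu>_def by (rule emeasure_density) measurable
    also have "\<dots> \<le> (\<integral>\<^sup>+y. indicator K y + (g y)\<^sup>2 \<partial>\<mu>)"
    proof (rule nn_integral_mono)
      fix y
      have "a \<le> 1 + a\<^sup>2" for a :: ennreal
      proof (cases "a \<le> 1")
        case False
        then have "1 * a \<le> a * a" by (intro mult_right_mono) auto
        then show ?thesis by (simp add: power2_eq_square add_increasing)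
      qed (auto intro: order_trans)
      then show "g y * indicator K y \<le> indicator K y + (g y)\<^sup>2"
        by (auto simp: indicator_def)
    qed
    also have "\<dots> = emeasure \<mu> K + (\<integral>\<^sup>+y. (g y)\<^sup>2 \<partial>\<mu>)"
      by (subst nn_integral_add) auto
    also have "\<dots> \<le> emeasure \<mu> K + 1" by (intro add_left_mono g1)
    also have "\<dots> < \<infinity>" using finite_compact[OF K] by simp
    finally show "emeasure \<nu> K < \<infinity>" .
  qed
  define wr where "wr x = (LINT y|\<nu>. f (x \<otimes> inv y))" for x
  have fy: "(\<lambda>y. f (x \<otimes> inv y)) \<in> CP T" if "x \<in> carrier G" for x
    using CP_inverse[OF CP_left_translate[OF f that]] .
  have w_wr: "w x = ennreal (wr x)" if x: "x \<in> carrier G" for x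
  proof -
    have "w x = (\<integral>\<^sup>+y. ennreal (f (x \<otimes> inv y)) \<partial>\<nu>)"
      unfolding w_def \<nu>_def using continuous_measurable[OF CP_cont[OF fy[OF x]]]
      by (simp add: nn_integral_density mult.commute)
    then show ?thesis using nu.CP_nn_integral[OF fy[OF x]] by (simp add: wr_def)
  qed
  have wr0: "0 \<le> wr x" if "x \<in> carrier G" for x
    using nu.CP_integral_nonneg[OF fy[OF that]] by (simp add: wr_def)
  have wcont: "continuous_map T euclideanreal wr"
    unfolding wr_def
  proof (rule nu.continuous_map_parametric_integral)
    show "continuous_map (prod_topology T T) euclideanreal (\<lambda>(x, y). f (x \<otimes> inv y))"
      unfolding split_beta by (intro continuous_map_CP_compose[OF f] cont_intros)
    fix x assume "x \<in> topspace T"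
    then obtain U L where U: "openin T U" "compactin T L" "x \<in> U" "U \<subseteq> L"
      using relatively_compact_nhd_point[of x] by auto
    have "f (x' \<otimes> inv y) = 0" if x': "x' \<in> U" and y: "y \<in> topspace T - ((\<lambda>x. inv x) ` A <#> L)" for x' y
    proof -
      have c: "x' \<in> carrier G" "y \<in> carrier G" using x' y carrier_of_openin[OF U(1)] by auto
      have "x' \<otimes> inv y \<notin> A"
      proof
        assume "x' \<otimes> inv y \<in> A"
        then have "inv (x' \<otimes> inv y) \<otimes> x' \<in> (\<lambda>x. inv x) ` A <#> L"
          using x' U(4) by (intro set_multI) auto
        then show False using y c by (simp add: inv_mult_group m_assoc)
      qed
      then show ?thesis using A(2) c by simp
    qed
    then show "\<exists>U K. openin T U \<and> x \<in> U \<and> compactin T K \<and>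
        (\<forall>x'\<in>U. \<forall>y\<in>topspace T - K. f (x' \<otimes> inv y) = 0)"
      using U compactin_set_mult[OF compactin_inv_image[OF A(1)] U(2)] by blast
  qed
  note wm[measurable] = continuous_measurable[OF wcont]
  have "w \<in> borel_measurable \<mu> \<longleftrightarrow> (\<lambda>x. ennreal (wr x)) \<in> borel_measurable \<mu>"
    by (rule measurable_cong) (simp add: w_wr)
  then show wmeas[measurable]: "w \<in> borel_measurable \<mu>" by simp
  have pair: "(\<integral>\<^sup>+x. ennreal (u x) * w x \<partial>\<mu>) \<le> ennreal (D * CP_norm \<mu> u)" if u: "u \<in> CP T" for u
  proof -
    obtain B where B: "compactin T B" "\<And>x. x \<in> topspace T \<Longrightarrow> x \<notin> B \<Longrightarrow> u x = 0"
      using CP_support[OF u] by blast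
    define v where "v y = (LINT x|\<mu>. u x * f (x \<otimes> inv y))" for y
    have hcont: "continuous_map (prod_topology T T) euclideanreal (\<lambda>(x, y). u x * f (x \<otimes> inv y))"
      unfolding split_beta
      by (intro continuous_map_real_mult continuous_map_CP_compose[OF f] continuous_map_CP_compose[OF u] cont_intros)
    have swapcont: "continuous_map (prod_topology T T) euclideanreal (\<lambda>(y, x). u x * f (x \<otimes> inv y))"
      unfolding split_beta
      by (intro continuous_map_real_mult continuous_map_CP_compose[OF f] continuous_map_CP_compose[OF u] cont_intros)
    have hsupp: "u x * f (x \<otimes> inv y) = 0"
      if "x \<in> carrier G" "y \<in> carrier G" "(x, y) \<notin> B \<times> ((\<lambda>x. inv x) ` A <#> B)" for x y
    proof -
      have "x \<notin> B \<or> x \<otimes> inv y \<notin> A"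
      proof (rule ccontr)
        assume "\<not> ?thesis"
        then have x: "x \<in> B" "x \<otimes> inv y \<in> A" by auto
        then have "inv (x \<otimes> inv y) \<otimes> x \<in> (\<lambda>x. inv x) ` A <#> B"
          by (intro set_multI) auto
        then show False using that x by (simp add: inv_mult_group m_assoc)
      qed
      then show ?thesis using A(2) B(2) that by auto
    qed
    have h: "(\<lambda>x. u x * f (x \<otimes> inv y)) \<in> CP T" if "y \<in> carrier G" for y
      by (rule CP_mult[OF u])
         (use that CP_ge0[OF f] in \<open>auto intro!: continuous_map_CP_compose[OF f] cont_intros\<close>)
    have v: "v \<in> CP T"
    proof (rule CP_I)
      show "continuous_map T euclideanreal v"
        unfolding v_def
      proof (rule continuous_map_parametric_integral[OF swapcont])
        fix y assume "y \<in> topspace T"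
        then show "\<exists>U K. openin T U \<and> y \<in> U \<and> compactin T K \<and>
            (\<forall>y'\<in>U. \<forall>x\<in>topspace T - K. u x * f (x \<otimes> inv y') = 0)"
          using B openin_carrier by - (rule exI[of _ "carrier G"], rule exI[of _ B], auto)
      qed
      show "0 \<le> v y" if "y \<in> topspace T" for y
        using CP_integral_nonneg[OF h] that by (simp add: v_def)
      show "compactin T ((\<lambda>x. inv x) ` A <#> B)"
        by (intro compactin_set_mult compactin_inv_image A B)
      show "v y = 0" if "y \<in> topspace T" "y \<notin> (\<lambda>x. inv x) ` A <#> B" for y
      proof -
        have "v y = (LINT x|\<mu>. 0)"
          unfolding v_def using that by (intro Bochner_Integration.integral_cong refl hsupp) auto
        then show ?thesis by simp
      qed
    qed
    have inner: "(\<integral>\<^sup>+x. ennreal (u x * f (x \<otimes> inv y)) * a \<partial>\<mu>) = ennreal (v y) * a"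
      if "y \<in> carrier G" for y and a :: ennreal
      using continuous_measurable[OF CP_cont[OF h[OF that]]]
      by (simp add: nn_integral_multc CP_nn_integral[OF h[OF that]] v_def)
    have duality: "(\<integral>\<^sup>+x. \<integral>\<^sup>+y. ennreal (u x * f (x \<otimes> inv y)) * b y \<partial>\<mu> \<partial>\<mu>) = (\<integral>\<^sup>+y. ennreal (v y) * b y \<partial>\<mu>)"
      if "b \<in> borel_measurable \<mu>" for b
    proof -
      have "(\<integral>\<^sup>+x. \<integral>\<^sup>+y. ennreal (u x * f (x \<otimes> inv y)) * b y \<partial>\<mu> \<partial>\<mu>)
          = (\<integral>\<^sup>+y. \<integral>\<^sup>+x. ennreal (u x * f (x \<otimes> inv y)) * b y \<partial>\<mu> \<partial>\<mu>)"
        by (rule compact_support_Tonelli[OF locally_finite_measure_axioms sigma_finite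
              locally_finite_measure_axioms sigma_finite hcont B(1)
              compactin_set_mult[OF compactin_inv_image[OF A(1)] B(1)] _ that]) (simp add: hsupp)
      also have "\<dots> = (\<integral>\<^sup>+y. ennreal (v y) * b y \<partial>\<mu>)"
        by (rule nn_integral_cong) (simp add: inner)
      finally show ?thesis .
    qed
    have nv: "CP_norm \<mu> v \<le> D * CP_norm \<mu> u"
    proof -
      have "trilinear G \<mu> f v u = (\<integral>\<^sup>+x. \<integral>\<^sup>+y. ennreal (u x * f (x \<otimes> inv y)) * ennreal (v y) \<partial>\<mu> \<partial>\<mu>)"
        unfolding trilinear_def
        by (intro nn_integral_cong) (use CP_ge0[OF u] CP_ge0[OF f] in \<open>simp add: ennreal_mult'\<close>)
      also have "\<dots> = (\<integral>\<^sup>+y. (ennreal (v y))\<^sup>2 \<partial>\<mu>)"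
        using duality[of "\<lambda>y. ennreal (v y)"] continuous_measurable[OF CP_cont[OF v]]
        by (simp add: power2_eq_square)
      also have "\<dots> = ennreal ((CP_norm \<mu> v)\<^sup>2)" by (rule CP_norm_nn[OF v])
      finally have "ennreal ((CP_norm \<mu> v)\<^sup>2) \<le> ennreal (D * CP_norm \<mu> v * CP_norm \<mu> u)"
        using bound[OF v u] by simp
      then have "CP_norm \<mu> v * CP_norm \<mu> v \<le> CP_norm \<mu> v * (D * CP_norm \<mu> u)"
        using D CP_norm_nonneg[of \<mu> v] CP_norm_nonneg[of \<mu> u]
        by (simp add: power2_eq_square mult_ac)
      then show ?thesis
        using D CP_norm_nonneg[of \<mu> v] CP_norm_nonneg[of \<mu> u]
        by (cases "CP_norm \<mu> v = 0") auto
    qed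
    have "(\<integral>\<^sup>+x. ennreal (u x) * w x \<partial>\<mu>) = (\<integral>\<^sup>+x. \<integral>\<^sup>+y. ennreal (u x * f (x \<otimes> inv y)) * g y \<partial>\<mu> \<partial>\<mu>)"
    proof (rule nn_integral_cong)
      fix x assume "x \<in> space \<mu>"
      then have x: "x \<in> carrier G" by simp
      have "(\<integral>\<^sup>+y. ennreal (u x * f (x \<otimes> inv y)) * g y \<partial>\<mu>)
          = (\<integral>\<^sup>+y. ennreal (u x) * (ennreal (f (x \<otimes> inv y)) * g y) \<partial>\<mu>)"
        by (rule nn_integral_cong) (use CP_ge0[OF u x] in \<open>simp add: ennreal_mult' mult.assoc\<close>)
      also have "\<dots> = ennreal (u x) * w x"
        unfolding w_def using continuous_measurable[OF CP_cont[OF fy[OF x]]]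
        by (intro nn_integral_cmult borel_measurable_times_ennreal g) simp
      finally show "ennreal (u x) * w x = (\<integral>\<^sup>+y. ennreal (u x * f (x \<otimes> inv y)) * g y \<partial>\<mu>)" by simp
    qed
    also have "\<dots> = (\<integral>\<^sup>+y. ennreal (v y) * g y \<partial>\<mu>)" by (rule duality[OF g])
    finally have eq: "(\<integral>\<^sup>+x. ennreal (u x) * w x \<partial>\<mu>) = (\<integral>\<^sup>+y. ennreal (v y) * g y \<partial>\<mu>)" .
    have "(\<integral>\<^sup>+y. ennreal (v y) * g y \<partial>\<mu>)\<^sup>2 \<le> (\<integral>\<^sup>+y. (ennreal (v y))\<^sup>2 \<partial>\<mu>) * (\<integral>\<^sup>+y. (g y)\<^sup>2 \<partial>\<mu>)"
      using continuous_measurable[OF CP_cont[OF v]] by (intro Cauchy_Schwarz_nn_integral) auto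
    also have "\<dots> \<le> ennreal ((CP_norm \<mu> v)\<^sup>2) * 1"
      by (intro mult_mono g1) (simp_all add: CP_norm_nn[OF v])
    also have "\<dots> \<le> ennreal ((D * CP_norm \<mu> u)\<^sup>2)"
      using power_mono[OF nv CP_norm_nonneg, of 2] by (simp add: ennreal_leI)
    also have "\<dots> = (ennreal (D * CP_norm \<mu> u))\<^sup>2"
      using D CP_norm_nonneg[of \<mu> u] by (simp add: ennreal_power)
    finally show ?thesis
      unfolding eq by (rule ennreal_power2_le_imp_le) (use D CP_norm_nonneg[of \<mu> u] in simp)
  qed
  have local_bound: "(\<integral>\<^sup>+x. (w x)\<^sup>2 * indicator K x \<partial>\<mu>) \<le> ennreal (D\<^sup>2)" if K: "compactin T K" for K
  proof -
    have "K \<subseteq> topspace T" using compactin_subset_topspace[OF K] .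
    then obtain cut where cut: "cut \<in> CP T" "\<And>x. x \<in> carrier G \<Longrightarrow> cut x \<le> 1" "\<And>x. x \<in> K \<Longrightarrow> cut x = 1"
      using CP_bump[OF K openin_topspace] by metis
    define u where "u x = cut x * wr x" for x
    have u: "u \<in> CP T" unfolding u_def by (rule CP_mult[OF cut(1) wcont]) (simp add: wr0)
    have uw: "(\<lambda>x. u x * wr x) \<in> CP T" by (rule CP_mult[OF u wcont]) (simp add: wr0)
    define J where "J = (LINT x|\<mu>. u x * wr x)"
    have J0: "0 \<le> J" unfolding J_def by (rule CP_integral_nonneg[OF uw])
    have J: "(\<integral>\<^sup>+x. ennreal (u x * wr x) \<partial>\<mu>) = ennreal J"
      unfolding J_def by (rule CP_nn_integral[OF uw])
    have "(\<integral>\<^sup>+x. ennreal (u x * wr x) \<partial>\<mu>) = (\<integral>\<^sup>+x. ennreal (u x) * w x \<partial>\<mu>)"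
      by (rule nn_integral_cong) (use CP_ge0[OF u] in \<open>simp add: w_wr ennreal_mult'\<close>)
    then have "ennreal J \<le> ennreal (D * CP_norm \<mu> u)" using pair[OF u] J by simp
    then have JD: "J \<le> D * CP_norm \<mu> u" using D CP_norm_nonneg[of \<mu> u] by simp
    have "(CP_norm \<mu> u)\<^sup>2 \<le> J"
      unfolding CP_norm_square J_def
    proof (rule integral_mono)
      show "integrable \<mu> (\<lambda>x. (u x)\<^sup>2)" "integrable \<mu> (\<lambda>x. u x * wr x)"
        by (rule CP_integrable[OF CP_square[OF u]], rule CP_integrable[OF uw])
      fix x assume "x \<in> space \<mu>"
      then have x: "x \<in> carrier G" by simp
      have "u x \<le> wr x" unfolding u_def using cut(2)[OF x] wr0[OF x] CP_ge0[OF cut(1) x]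
        by (simp add: mult_left_le_one_le)
      then show "(u x)\<^sup>2 \<le> u x * wr x"
        using CP_ge0[OF u x] by (simp add: power2_eq_square mult_left_mono)
    qed
    then have "J\<^sup>2 \<le> D\<^sup>2 * J"
      using power_mono[OF JD J0, of 2] D
      by (simp add: power_mult_distrib) (meson mult_left_mono order_trans zero_le_power2)
    then have JD2: "J \<le> D\<^sup>2" using J0 by (cases "J = 0") (auto simp: power2_eq_square)
    have "(\<integral>\<^sup>+x. (w x)\<^sup>2 * indicator K x \<partial>\<mu>) \<le> (\<integral>\<^sup>+x. ennreal (u x * wr x) \<partial>\<mu>)"
    proof (rule nn_integral_mono)
      fix x assume "x \<in> space \<mu>"
      then have x: "x \<in> carrier G" by simp
      show "(w x)\<^sup>2 * indicator K x \<le> ennreal (u x * wr x)"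
        using cut(3)[of x] wr0[OF x]
        by (cases "x \<in> K") (simp_all add: w_wr[OF x] u_def power2_eq_square ennreal_mult')
    qed
    also have "\<dots> \<le> ennreal (D\<^sup>2)" unfolding J using JD2 by (rule ennreal_leI)
    finally show ?thesis .
  qed
  obtain K where K: "\<And>n::nat. compactin T (K n)" "incseq K" "(\<Union>n. K n) = carrier G"
    using sigma_compact by blast
  have "(\<integral>\<^sup>+x. (w x)\<^sup>2 \<partial>\<mu>) = (\<integral>\<^sup>+x. (SUP n. (w x)\<^sup>2 * indicator (K n) x) \<partial>\<mu>)"
  proof (rule nn_integral_cong)
    fix x assume "x \<in> space \<mu>"
    then obtain n where n: "x \<in> K n" using K(3) by auto
    show "(w x)\<^sup>2 = (SUP n. (w x)\<^sup>2 * indicator (K n) x)"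
    proof (rule antisym)
      show "(w x)\<^sup>2 \<le> (SUP n. (w x)\<^sup>2 * indicator (K n) x)"
        using n by (intro SUP_upper2[of n]) auto
      show "(SUP n. (w x)\<^sup>2 * indicator (K n) x) \<le> (w x)\<^sup>2"
        by (intro SUP_least) (simp add: indicator_def)
    qed
  qed
  also have "\<dots> = (SUP n. \<integral>\<^sup>+x. (w x)\<^sup>2 * indicator (K n) x \<partial>\<mu>)"
  proof (rule nn_integral_monotone_convergence_SUP)
    show "incseq (\<lambda>n x. (w x)\<^sup>2 * indicator (K n) x)"
      using K(2) by (auto simp: incseq_def le_fun_def indicator_def)
    show "(\<lambda>x. (w x)\<^sup>2 * indicator (K n) x) \<in> borel_measurable \<mu>" for n
      using compact_sets[OF K(1)[of n]] by measurable
  qed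
  also have "\<dots> \<le> ennreal (D\<^sup>2)" by (intro SUP_least local_bound K(1))
  finally show "(\<integral>\<^sup>+x. (w x)\<^sup>2 \<partial>\<mu>) \<le> ennreal (D\<^sup>2)" .
qed

lemma Cc_norm_CP:
  assumes f: "f \<in> Cc T"
  shows "(\<lambda>x. cmod (f x)) \<in> CP T"
proof (rule CP_I)
  show "continuous_map T euclideanreal (\<lambda>x. cmod (f x))"
    using f by (auto simp: Cc_def intro: continuous_map_norm)
  show "compactin T (T closure_of {x \<in> topspace T. f x \<noteq> 0})" using f by (simp add: Cc_def)
  show "cmod (f x) = 0" if "x \<in> topspace T" "x \<notin> T closure_of {x \<in> topspace T. f x \<noteq> 0}" for x
    using that closure_of_subset[of "{x \<in> topspace T. f x \<noteq> 0}" T] by auto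
qed simp

lemma trilinear_imp_RD_wrt:
  assumes l: "is_length G T l" and s: "0 < s" and C: "0 < C"
    and bound: "trilinear_RD G T \<mu> l s C"
  shows "RD_wrt G T \<mu> l"
  unfolding RD_wrt_def
proof (rule conjI[OF l], rule exI[of _ s], rule conjI[OF s], rule exI[of _ C], rule conjI[OF C], rule ballI)
  fix f assume f: "f \<in> Cc T"
  define F where "F x = cmod (f x)" for x
  have F: "F \<in> CP T" unfolding F_def by (rule Cc_norm_CP[OF f])
  define L where "L = support_length G l f"
  obtain A where A: "compactin T A" "\<And>x. x \<in> topspace T \<Longrightarrow> x \<notin> A \<Longrightarrow> F x = 0"
    using CP_support[OF F] by blast
  obtain M where M: "0 \<le> M" "\<And>x. x \<in> A \<Longrightarrow> l x \<le> M"
    using length_bounded_on_compact[OF l A(1)] by blast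
  have bdd: "bdd_above (insert 0 (l ` {x \<in> carrier G. f x \<noteq> 0}))"
  proof (rule bdd_aboveI[of _ M])
    fix y assume "y \<in> insert 0 (l ` {x \<in> carrier G. f x \<noteq> 0})"
    then consider "y = 0" | x where "x \<in> carrier G" "F x \<noteq> 0" "y = l x" by (auto simp: F_def)
    then show "y \<le> M" using M A(2) by cases auto
  qed
  have L0: "0 \<le> L" unfolding L_def support_length_def using bdd by (intro cSup_upper) auto
  have Lb: "l x \<le> L" if "x \<in> carrier G" "F x \<noteq> 0" for x
    unfolding L_def support_length_def using bdd that by (intro cSup_upper) (auto simp: F_def)
  define D where "D = C * (1 + L) powr s * CP_norm \<mu> F"
  have D: "0 \<le> D" using C CP_norm_nonneg[of \<mu> F] by (simp add: D_def)
  have D_eq: "C * (1 + support_length G l f) powr s * L2_norm \<mu> f = D"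
    by (simp add: D_def L_def F_def L2_norm_def CP_norm_def)
  show "convolution_op_norm G \<mu> f \<le> ennreal (C * (1 + support_length G l f) powr s * L2_norm \<mu> f)"
    unfolding D_eq convolution_op_norm_def
  proof (rule SUP_least)
    fix g assume "g \<in> {g \<in> square_integrable \<mu>. L2_norm \<mu> g \<le> 1}"
    then have g: "g \<in> borel_measurable \<mu>" "integrable \<mu> (\<lambda>x. (cmod (g x))\<^sup>2)" "L2_norm \<mu> g \<le> 1"
      by (auto simp: square_integrable_def)
    let ?g = "\<lambda>y. ennreal (cmod (g y))"
    have gm: "?g \<in> borel_measurable \<mu>" using g(1) by simp
    have "(\<integral>\<^sup>+y. (?g y)\<^sup>2 \<partial>\<mu>) = (\<integral>\<^sup>+y. ennreal ((cmod (g y))\<^sup>2) \<partial>\<mu>)"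
      by (simp add: ennreal_power)
    also have "\<dots> = ennreal (LINT y|\<mu>. (cmod (g y))\<^sup>2)"
      by (rule nn_integral_eq_integral[OF g(2)]) simp
    also have "\<dots> \<le> 1"
      using g(3) by (simp add: L2_norm_def real_sqrt_le_1_iff ennreal_le_1)
    finally have g1: "(\<integral>\<^sup>+y. (?g y)\<^sup>2 \<partial>\<mu>) \<le> 1" .
    define w where "w x = (\<integral>\<^sup>+y. ennreal (F (x \<otimes> inv y)) * ?g y \<partial>\<mu>)" for x
    have "trilinear G \<mu> F a u \<le> ennreal (D * CP_norm \<mu> a * CP_norm \<mu> u)"
      if "a \<in> CP T" "u \<in> CP T" for a u
      using trilinear_RD_D[OF bound F that L0 Lb] by (simp add: D_def)
    from trilinear_bound_square_integrable(2)[OF F D this gm g1]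
    have w: "(\<integral>\<^sup>+x. (w x)\<^sup>2 \<partial>\<mu>) \<le> ennreal (D\<^sup>2)" unfolding w_def by simp
    have pointwise: "ennreal (cmod (left_convolution G \<mu> f g x)) \<le> w x" if x: "x \<in> carrier G" for x
    proof -
      have "ennreal (cmod (left_convolution G \<mu> f g x)) \<le> (\<integral>\<^sup>+y. ennreal (cmod (f (inv y) * g (y \<otimes> x))) \<partial>\<mu>)"
        unfolding left_convolution_def
        by (cases "integrable \<mu> (\<lambda>y. f (inv y) * g (y \<otimes> x))")
           (auto intro: integral_norm_bound_ennreal simp: not_integrable_integral_eq)
      also have "\<dots> = (\<integral>\<^sup>+y. ennreal (F (x \<otimes> inv (y \<otimes> x))) * ?g (y \<otimes> x) \<partial>\<mu>)"
        by (rule nn_integral_cong)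
           (use x in \<open>simp add: F_def norm_mult ennreal_mult' inv_mult_group m_assoc[symmetric]\<close>)
      also have "\<dots> = w x"
        unfolding w_def
        using continuous_measurable[OF CP_cont[OF CP_inverse[OF CP_left_translate[OF F x]]]]
        by (intro nn_integral_translate[OF x] borel_measurable_times_ennreal gm) simp
      finally show ?thesis .
    qed
    let ?c = "\<lambda>x. (cmod (left_convolution G \<mu> f g x))\<^sup>2"
    have "ennreal (LINT x|\<mu>. ?c x) \<le> (\<integral>\<^sup>+x. ennreal (?c x) \<partial>\<mu>)"
      by (cases "integrable \<mu> ?c") (simp_all add: nn_integral_eq_integral not_integrable_integral_eq)
    also have "\<dots> \<le> (\<integral>\<^sup>+x. (w x)\<^sup>2 \<partial>\<mu>)"
      by (intro nn_integral_mono) (simp add: pointwise power_mono flip: ennreal_power)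
    also have "\<dots> \<le> ennreal (D\<^sup>2)" by (rule w)
    finally have "(LINT x|\<mu>. ?c x) \<le> D\<^sup>2" by simp
    then have "L2_norm \<mu> (left_convolution G \<mu> f g) \<le> D"
      unfolding L2_norm_def using D real_sqrt_le_mono by fastforce
    then show "ennreal (L2_norm \<mu> (left_convolution G \<mu> f g)) \<le> ennreal D" by (rule ennreal_leI)
  qed
qed

end

section \<open>Integration along a group extension\<close>

text \<open>The Haar measures of \<open>G\<close>, \<open>N\<close> and \<open>Q\<close> are given independently, so they are compatible only up to
  a constant.\<close>

locale haar_extension =
  fixes G :: "('a, 'c) monoid_scheme" (structure) and T :: "'a topology" and N :: "'a set"
    and \<mu>G \<mu>N :: "'a measure" and \<mu>Q :: "'a set measure"
  assumes normal_N: "N \<lhd> G" and closed_N: "closedin T N"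
    and haar_G: "haar_group G T \<mu>G"
    and haar_N: "haar_group (G\<lparr>carrier := N\<rparr>) (subtopology T N) \<mu>N"
    and haar_Q: "haar_group (G Mod N) (quotient_topology T (\<lambda>x. N #> x)) \<mu>Q"

sublocale haar_extension \<subseteq> G: haar_group G T \<mu>G
  by (rule haar_G)

sublocale haar_extension \<subseteq> H: haar_group "G\<lparr>carrier := N\<rparr>" "subtopology T N" \<mu>N
  by (rule haar_N)

sublocale haar_extension \<subseteq> Q: haar_group "G Mod N" "quotient_topology T (\<lambda>x. N #> x)" \<mu>Q
  by (rule haar_Q)

context haar_extension
begin

abbreviation "TN \<equiv> subtopology T N"
abbreviation "TQ \<equiv> quotient_topology T (\<lambda>x. N #> x)"
abbreviation "H \<equiv> G\<lparr>carrier := N\<rparr>"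
abbreviation "Q \<equiv> G Mod N"
abbreviation "\<pi> \<equiv> \<lambda>x. N #> x"

lemma subgroup_N: "subgroup N G"
  using normal_N by (simp add: normal_def)

lemma N_carrier: "n \<in> N \<Longrightarrow> n \<in> carrier G"
  using subgroup.subset[OF subgroup_N] by blast

lemma N_sub: "N \<subseteq> carrier G"
  using N_carrier by blast

lemma N_mult: "m \<in> N \<Longrightarrow> n \<in> N \<Longrightarrow> m \<otimes> n \<in> N"
  using subgroup.m_closed[OF subgroup_N] .

lemma N_inv: "n \<in> N \<Longrightarrow> inv n \<in> N"
  using subgroup.m_inv_closed[OF subgroup_N] .

lemma inv_H: "n \<in> N \<Longrightarrow> inv\<^bsub>H\<^esub> n = inv n"
  using G.m_inv_consistent[OF subgroup_N] .

lemma conj_N: "z \<in> carrier G \<Longrightarrow> n \<in> N \<Longrightarrow> z \<otimes> n \<otimes> inv z \<in> N"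
  using normal.inv_op_closed2[OF normal_N] .

lemma topspace_TN [simp]: "topspace TN = N"
  using N_sub by auto

lemma space_\<mu>N [simp]: "space \<mu>N = N"
  using H.space_carrier by simp

lemma carrier_Q: "carrier Q = \<pi> ` carrier G"
  by (auto simp: FactGroup_def RCOSETS_def)

lemma pi_closed: "x \<in> carrier G \<Longrightarrow> \<pi> x \<in> carrier Q"
  by (simp add: carrier_Q)

lemma pi_mult: "x \<in> carrier G \<Longrightarrow> y \<in> carrier G \<Longrightarrow> \<pi> (x \<otimes> y) = \<pi> x \<otimes>\<^bsub>Q\<^esub> \<pi> y"
  using hom_mult[OF normal.r_coset_hom_Mod[OF normal_N]] .

lemma pi_inv: "x \<in> carrier G \<Longrightarrow> \<pi> (inv x) = inv\<^bsub>Q\<^esub> (\<pi> x)"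
proof -
  interpret group_hom G Q \<pi>
    using normal.r_coset_hom_Mod[OF normal_N]
    by (simp add: group_hom_def group_hom_axioms_def G.is_group Q.is_group)
  show "x \<in> carrier G \<Longrightarrow> \<pi> (inv x) = inv\<^bsub>Q\<^esub> (\<pi> x)" by (rule hom_inv)
qed

lemma pi_left: "n \<in> N \<Longrightarrow> x \<in> carrier G \<Longrightarrow> \<pi> (n \<otimes> x) = \<pi> x"
  using G.coset_mult_assoc[OF N_sub N_carrier, of n x] subgroup.rcos_const[OF subgroup_N G.is_group, of n]
  by simp

lemma pi_eqD:
  assumes "x \<in> carrier G" "y \<in> carrier G" "\<pi> x = \<pi> y"
  obtains n where "n \<in> N" "y = n \<otimes> x"
proof -
  have "y \<in> N #> x"
    using assms(3) G.rcos_self[OF assms(2) subgroup_N] by simp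
  then show ?thesis using that unfolding r_coset_def by blast
qed

text \<open>An arbitrary set-theoretic section; it is only applied to functions on \<open>G\<close> that are constant
  on the cosets of \<open>N\<close>, so it need not be measurable.\<close>

definition rep :: "'a set \<Rightarrow> 'a" where
  "rep q = (SOME x. x \<in> carrier G \<and> \<pi> x = q)"

lemma rep:
  assumes "q \<in> carrier Q"
  shows "rep q \<in> carrier G" "\<pi> (rep q) = q"
proof -
  have "\<exists>x. x \<in> carrier G \<and> \<pi> x = q" using assms carrier_Q by auto
  then have "rep q \<in> carrier G \<and> \<pi> (rep q) = q" unfolding rep_def by (rule someI_ex)
  then show "rep q \<in> carrier G" "\<pi> (rep q) = q" by auto
qed

lemma rep_pi_invariant:
  assumes "\<And>n y. n \<in> N \<Longrightarrow> y \<in> carrier G \<Longrightarrow> F (n \<otimes> y) = F y" and x: "x \<in> carrier G"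
  shows "F (rep (\<pi> x)) = F x"
proof -
  obtain n where "n \<in> N" "rep (\<pi> x) = n \<otimes> x"
    using pi_eqD[OF x rep(1)[OF pi_closed[OF x]]] rep(2)[OF pi_closed[OF x]] by metis
  then show ?thesis using assms by simp
qed

lemma continuous_map_pi: "continuous_map T TQ \<pi>"
  by (rule quotient_imp_continuous_map[OF quotient_map_quotient_topology])

lemma continuous_map_TN: "continuous_map X TN f \<Longrightarrow> continuous_map X T f"
  by (simp add: continuous_map_in_subtopology)

lemma continuous_map_fst_TN: "continuous_map (prod_topology TN Y) T fst"
  by (rule continuous_map_TN[OF continuous_map_fst])

lemma continuous_map_snd_TN: "continuous_map (prod_topology Y TN) T snd"
  by (rule continuous_map_TN[OF continuous_map_snd])

lemma continuous_map_incl_TN: "continuous_map TN T (\<lambda>x. x)"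
  by (rule continuous_map_TN[OF H.continuous_map_id'])

lemma compactin_TN: "compactin T K \<Longrightarrow> compactin TN (K \<inter> N)"
  by (simp add: compactin_subtopology compact_Int_closedin[OF _ closed_N])

lemma CP_restrict:
  assumes f: "f \<in> CP T" and x: "x \<in> carrier G"
  shows "(\<lambda>n. f (n \<otimes> x)) \<in> CP TN"
proof -
  note c = G.CP_right_translate[OF f x]
  obtain K where K: "compactin T K" "\<And>y. y \<in> topspace T \<Longrightarrow> y \<notin> K \<Longrightarrow> f (y \<otimes> x) = 0"
    using CP_support[OF c] by blast
  show ?thesis
  proof (rule CP_I[OF _ _ compactin_TN[OF K(1)]])
    show "continuous_map TN euclideanreal (\<lambda>n. f (n \<otimes> x))"
      by (rule continuous_map_from_subtopology[OF CP_cont[OF c]])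
  qed (use K(2) CP_nonneg[OF c] N_carrier in auto)
qed

text \<open>The integral of \<open>h\<close> over the coset of \<open>y\<close>; it depends on the coset only, since the Haar measure
  of \<open>N\<close> is right invariant.\<close>

definition fibre_integral :: "('a \<Rightarrow> real) \<Rightarrow> 'a \<Rightarrow> real" where
  "fibre_integral h y = (LINT n|\<mu>N. h (n \<otimes> y))"

lemma fibre_integral_invariant:
  assumes h: "continuous_map T euclideanreal h" and m: "m \<in> N" and y: "y \<in> carrier G"
  shows "fibre_integral h (m \<otimes> y) = fibre_integral h y"
proof -
  have "continuous_map T T (\<lambda>n. n \<otimes> y)" using y by (intro G.cont_intros)
  from continuous_map_compose[OF this h] have "continuous_map T euclideanreal (\<lambda>n. h (n \<otimes> y))"
    by (simp add: o_def)
  then have "(\<lambda>n. h (n \<otimes> y)) \<in> borel_measurable \<mu>N"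
    by (intro H.continuous_measurable continuous_map_from_subtopology)
  then have "(LINT n|\<mu>N. h ((n \<otimes> m) \<otimes> y)) = fibre_integral h y"
    using H.integral_translate[of m "\<lambda>n. h (n \<otimes> y)"] m by (simp add: fibre_integral_def)
  moreover have "(LINT n|\<mu>N. h ((n \<otimes> m) \<otimes> y)) = fibre_integral h (m \<otimes> y)"
    unfolding fibre_integral_def
    by (rule Bochner_Integration.integral_cong) (use m y N_carrier in \<open>auto simp: G.m_assoc\<close>)
  ultimately show ?thesis by simp
qed

lemma fibre_integral_continuous:
  assumes h: "continuous_map (prod_topology X T) euclideanreal (\<lambda>(x, y). h x y)"
    and B: "compactin T B"
    and supp: "\<And>x y. x \<in> topspace X \<Longrightarrow> y \<in> carrier G \<Longrightarrow> y \<notin> B \<Longrightarrow> h x y = 0"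
  shows "continuous_map (prod_topology X T) euclideanreal (\<lambda>(x, y). fibre_integral (h x) y)"
  unfolding fibre_integral_def split_beta
proof (rule H.continuous_map_parametric_integral[where h = "\<lambda>z n. h (fst z) (n \<otimes> snd z)"])
  have c1: "continuous_map (prod_topology (prod_topology X T) TN) X (\<lambda>w. fst (fst w))"
    using continuous_map_compose[OF continuous_map_fst continuous_map_fst] by (simp add: o_def)
  have c2: "continuous_map (prod_topology (prod_topology X T) TN) T (\<lambda>w. snd (fst w))"
    using continuous_map_compose[OF continuous_map_fst continuous_map_snd] by (simp add: o_def)
  have c: "continuous_map (prod_topology (prod_topology X T) TN) (prod_topology X T)
      (\<lambda>w. (fst (fst w), snd w \<otimes> snd (fst w)))"
    by (intro continuous_map_pairedI c1 G.continuous_map_mult c2 continuous_map_snd_TN)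
  show "continuous_map (prod_topology (prod_topology X T) TN) euclideanreal
      (\<lambda>(z, n). h (fst z) (n \<otimes> snd z))"
    using continuous_map_compose[OF c h] by (simp add: o_def case_prod_unfold)
  fix z assume "z \<in> topspace (prod_topology X T)"
  then have z: "fst z \<in> topspace X" "snd z \<in> carrier G" by auto
  obtain U L where U: "openin T U" "compactin T L" "snd z \<in> U" "U \<subseteq> L"
    using G.relatively_compact_nhd_point[OF z(2)] by blast
  show "\<exists>V K. openin (prod_topology X T) V \<and> z \<in> V \<and> compactin TN K \<and>
      (\<forall>z'\<in>V. \<forall>n\<in>topspace TN - K. h (fst z') (n \<otimes> snd z') = 0)"
  proof (rule exI[of _ "topspace X \<times> U"], rule exI[of _ "(B <#> (\<lambda>x. inv x) ` L) \<inter> N"], intro conjI ballI)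
    show "openin (prod_topology X T) (topspace X \<times> U)"
      by (simp add: openin_prod_Times_iff U)
    show "z \<in> topspace X \<times> U" using z U(3) by (simp add: mem_Times_iff)
    show "compactin TN ((B <#> (\<lambda>x. inv x) ` L) \<inter> N)"
      by (intro compactin_TN G.compactin_set_mult G.compactin_inv_image B U)
    fix z' n assume z': "z' \<in> topspace X \<times> U" and n: "n \<in> topspace TN - (B <#> (\<lambda>x. inv x) ` L) \<inter> N"
    then have c: "snd z' \<in> carrier G" "n \<in> N" "n \<in> carrier G" "fst z' \<in> topspace X" "snd z' \<in> L"
      using G.carrier_of_openin[OF U(1)] U(4) N_carrier by auto
    have "n \<otimes> snd z' \<notin> B"
    proof
      assume "n \<otimes> snd z' \<in> B"
      then have "(n \<otimes> snd z') \<otimes> inv (snd z') \<in> B <#> (\<lambda>x. inv x) ` L"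
        using c by (intro G.set_multI) auto
      then show False using n c by (simp add: G.m_assoc)
    qed
    then show "h (fst z') (n \<otimes> snd z') = 0" using supp c by simp
  qed
qed

text \<open>Continuity passes to the quotient because the product of a quotient map with the identity of a
  locally compact Hausdorff space is again a quotient map.\<close>

lemma fibre_integral_quotient_continuous:
  assumes h: "continuous_map (prod_topology X T) euclideanreal (\<lambda>(x, y). h x y)"
    and X: "locally_compact_space X" "Hausdorff_space X"
    and B: "compactin T B"
    and supp: "\<And>x y. x \<in> topspace X \<Longrightarrow> y \<in> carrier G \<Longrightarrow> y \<notin> B \<Longrightarrow> h x y = 0"
  shows "continuous_map (prod_topology X TQ) euclideanreal (\<lambda>(x, q). fibre_integral (h x) (rep q))"
proof (rule continuous_compose_quotient_map)
  show "quotient_map (prod_topology X T) (prod_topology X TQ) (\<lambda>(x, y). (x, \<pi> y))"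
    by (rule quotient_map_prod_right[OF X(1) _ quotient_map_quotient_topology]) (simp add: X(2))
  show "continuous_map (prod_topology X T) euclideanreal
      ((\<lambda>(x, q). fibre_integral (h x) (rep q)) \<circ> (\<lambda>(x, y). (x, \<pi> y)))"
  proof (rule continuous_map_eq[OF fibre_integral_continuous[OF h B supp]])
    fix z assume z: "z \<in> topspace (prod_topology X T)"
    have "fibre_integral (h (fst z)) (rep (\<pi> (snd z))) = fibre_integral (h (fst z)) (snd z)"
      by (rule rep_pi_invariant) (use z fibre_integral_invariant[OF slice_continuous[OF h]] in auto)
    then show "(case z of (x, y) \<Rightarrow> fibre_integral (h x) y) =
        ((\<lambda>(x, q). fibre_integral (h x) (rep q)) \<circ> (\<lambda>(x, y). (x, \<pi> y))) z"
      by (simp add: split_beta)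
  qed auto
qed

lemma fibre_integral_support:
  assumes q: "q \<in> carrier Q" "q \<notin> \<pi> ` B"
    and supp: "\<And>y. y \<in> carrier G \<Longrightarrow> y \<notin> B \<Longrightarrow> h y = 0"
  shows "fibre_integral h (rep q) = 0"
proof -
  have "h (n \<otimes> rep q) = 0" if n: "n \<in> N" for n
  proof -
    have "n \<otimes> rep q \<notin> B"
      using q(2) pi_left[OF n rep(1)[OF q(1)]] rep(2)[OF q(1)] by (metis image_eqI)
    then show ?thesis using supp rep(1)[OF q(1)] N_carrier[OF n] by simp
  qed
  then have "fibre_integral h (rep q) = (LINT n|\<mu>N. 0)"
    unfolding fibre_integral_def by (intro Bochner_Integration.integral_cong) auto
  then show ?thesis by simp
qed

lemma fibre_integral_nonneg:
  assumes "\<And>y. y \<in> carrier G \<Longrightarrow> 0 \<le> h y" "y \<in> carrier G"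
  shows "0 \<le> fibre_integral h y"
  unfolding fibre_integral_def
  by (rule integral_nonneg_AE) (use assms N_carrier in \<open>auto intro!: AE_I2\<close>)

lemma CP_fibre_integral:
  assumes f: "f \<in> CP T"
  shows "(\<lambda>q. fibre_integral f (rep q)) \<in> CP TQ"
proof -
  obtain B where B: "compactin T B" "\<And>x. x \<in> topspace T \<Longrightarrow> x \<notin> B \<Longrightarrow> f x = 0"
    using CP_support[OF f] by blast
  \<comment> \<open>A one-point parameter space.\<close>
  let ?X = "discrete_topology (UNIV :: unit set)"
  have "continuous_map (prod_topology ?X T) euclideanreal (\<lambda>(x, y). f y)"
    using G.continuous_map_CP_compose[OF f continuous_map_snd, of ?X] by (simp add: case_prod_unfold)
  from fibre_integral_quotient_continuous[OF this _ _ B(1)]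
  have "continuous_map (prod_topology ?X TQ) euclideanreal (\<lambda>(x, q). fibre_integral f (rep q))"
    using B(2) by (simp add: locally_compact_space_discrete_topology Hausdorff_space_discrete_topology)
  from slice_continuous[OF this, of "()"]
  have c: "continuous_map TQ euclideanreal (\<lambda>q. fibre_integral f (rep q))" by simp
  show ?thesis
  proof (rule CP_I[OF c _ image_compactin[OF B(1) continuous_map_pi]])
    fix q assume "q \<in> topspace TQ"
    then have q: "q \<in> carrier Q" by simp
    show "0 \<le> fibre_integral f (rep q)"
      by (rule fibre_integral_nonneg) (use G.CP_ge0[OF f] rep[OF q] in auto)
    show "fibre_integral f (rep q) = 0" if "q \<notin> \<pi> ` B"
      by (rule fibre_integral_support[OF q that]) (use B(2) in simp)
  qed
qed

lemma fibre_integral_Tonelli: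
  assumes M: "locally_finite_measure X M" "sigma_finite_measure M"
    and h: "continuous_map (prod_topology X T) euclideanreal (\<lambda>(x, y). h x y)"
    and X: "locally_compact_space X"
    and A: "compactin X A" and B: "compactin T B"
    and supp: "\<And>x y. x \<in> topspace X \<Longrightarrow> y \<in> carrier G \<Longrightarrow> (x, y) \<notin> A \<times> B \<Longrightarrow> h x y = 0"
  shows "(\<integral>\<^sup>+x. \<integral>\<^sup>+q. ennreal (fibre_integral (h x) (rep q)) \<partial>\<mu>Q \<partial>M)
       = (\<integral>\<^sup>+q. \<integral>\<^sup>+x. ennreal (fibre_integral (h x) (rep q)) \<partial>M \<partial>\<mu>Q)"
proof -
  have HX: "Hausdorff_space X" using M(1) by (simp add: locally_finite_measure_def)
  have c: "continuous_map (prod_topology X TQ) euclideanreal (\<lambda>(x, q). fibre_integral (h x) (rep q))"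
    by (rule fibre_integral_quotient_continuous[OF h X HX B]) (use supp in auto)
  have s: "fibre_integral (h x) (rep q) = 0"
    if "x \<in> topspace X" "q \<in> topspace TQ" "(x, q) \<notin> A \<times> \<pi> ` B" for x q
  proof (cases "x \<in> A")
    case True
    then show ?thesis using that supp[OF that(1)] by (intro fibre_integral_support[of q B]) auto
  next
    case False
    then show ?thesis using that supp[OF that(1)] by (intro fibre_integral_support[of q "{}"]) auto
  qed
  show ?thesis
    using compact_support_Tonelli[OF M Q.locally_finite_measure_axioms Q.sigma_finite c A
        image_compactin[OF B continuous_map_pi] s, of "\<lambda>_. 1"] by simp
qed

text \<open>The integral over the fibres followed by the integral over the quotient.\<close>

definition weil :: "('a \<Rightarrow> real) \<Rightarrow> ennreal" where
  "weil h = (\<integral>\<^sup>+q. ennreal (fibre_integral h (rep q)) \<partial>\<mu>Q)"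

lemma haar_functional_weil: "G.haar_functional weil"
proof (rule G.haar_functionalI)
  fix f g :: "'a \<Rightarrow> real" assume fg: "\<And>x. x \<in> carrier G \<Longrightarrow> f x = g x"
  show "weil f = weil g"
    unfolding weil_def fibre_integral_def
  proof (intro nn_integral_cong arg_cong[of _ _ ennreal] Bochner_Integration.integral_cong refl)
    fix q n assume "q \<in> space \<mu>Q" "n \<in> space \<mu>N"
    then show "f (n \<otimes> rep q) = g (n \<otimes> rep q)" using fg rep N_carrier by simp
  qed
next
  fix f and c :: real assume f: "f \<in> CP T" and c: "0 \<le> c"
  have "fibre_integral (\<lambda>x. c * f x) y = c * fibre_integral f y" for y
    by (simp add: fibre_integral_def)
  then show "weil (\<lambda>x. c * f x) = ennreal c * weil f"
    using c Q.continuous_measurable[OF CP_cont[OF CP_fibre_integral[OF f]]]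
    by (simp add: weil_def ennreal_mult' nn_integral_cmult)
next
  fix f a assume f: "f \<in> CP T" and a: "a \<in> carrier G"
  have "weil (\<lambda>x. f (x \<otimes> a)) = (\<integral>\<^sup>+q. ennreal (fibre_integral f (rep (q \<otimes>\<^bsub>Q\<^esub> \<pi> a))) \<partial>\<mu>Q)"
    unfolding weil_def
  proof (rule nn_integral_cong)
    fix q assume "q \<in> space \<mu>Q"
    then have q: "q \<in> carrier Q" by simp
    have "fibre_integral (\<lambda>x. f (x \<otimes> a)) (rep q) = fibre_integral f (rep q \<otimes> a)"
      unfolding fibre_integral_def
      by (rule Bochner_Integration.integral_cong) (use a rep[OF q] N_carrier in \<open>auto simp: G.m_assoc\<close>)
    also have "\<dots> = fibre_integral f (rep (\<pi> (rep q \<otimes> a)))"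
      by (rule rep_pi_invariant[symmetric]) (use fibre_integral_invariant[OF CP_cont[OF f]] a rep[OF q] in auto)
    also have "\<pi> (rep q \<otimes> a) = q \<otimes>\<^bsub>Q\<^esub> \<pi> a" using pi_mult[OF rep(1)[OF q] a] rep(2)[OF q] by simp
    finally show "ennreal (fibre_integral (\<lambda>x. f (x \<otimes> a)) (rep q))
        = ennreal (fibre_integral f (rep (q \<otimes>\<^bsub>Q\<^esub> \<pi> a)))" by simp
  qed
  also have "\<dots> = weil f"
    unfolding weil_def
    using Q.nn_integral_translate[OF pi_closed[OF a], of "\<lambda>q. ennreal (fibre_integral f (rep q))"]
      Q.continuous_measurable[OF CP_cont[OF CP_fibre_integral[OF f]]] by simp
  finally show "weil (\<lambda>x. f (x \<otimes> a)) = weil f" .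
next
  fix h :: "'a \<Rightarrow> 'a \<Rightarrow> real" and A B
  assume h: "continuous_map (prod_topology T T) euclideanreal (\<lambda>(x, y). h x y)"
    and h0: "\<And>x y. x \<in> carrier G \<Longrightarrow> y \<in> carrier G \<Longrightarrow> 0 \<le> h x y"
    and A: "compactin T A" and B: "compactin T B"
    and supp: "\<And>x y. x \<in> carrier G \<Longrightarrow> y \<in> carrier G \<Longrightarrow> (x, y) \<notin> A \<times> B \<Longrightarrow> h x y = 0"
  have hswap: "continuous_map (prod_topology T T) euclideanreal (\<lambda>(y, x). h x y)"
  proof -
    have "continuous_map (prod_topology T T) (prod_topology T T) (\<lambda>z. (snd z, fst z))"
      by (intro continuous_map_pairedI continuous_map_fst continuous_map_snd)
    from continuous_map_compose[OF this h] show ?thesis by (simp add: o_def case_prod_unfold)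
  qed
  have inner: "ennreal (fibre_integral (\<lambda>x. LINT y|\<mu>G. h x y) x)
      = (\<integral>\<^sup>+y. ennreal (fibre_integral (\<lambda>x. h x y) x) \<partial>\<mu>G)" if x: "x \<in> carrier G" for x
  proof -
    let ?A = "(A <#> {inv x}) \<inter> N"
    have cA: "compactin TN ?A" using x by (intro compactin_TN G.compactin_set_mult A) auto
    have c: "continuous_map (prod_topology TN T) (prod_topology T T) (\<lambda>z. (fst z \<otimes> x, snd z))"
      using x by (intro continuous_map_pairedI G.cont_intros continuous_map_fst_TN)
    have hx: "continuous_map (prod_topology TN T) euclideanreal (\<lambda>(n, y). h (n \<otimes> x) y)"
      using continuous_map_compose[OF c h] by (simp add: o_def case_prod_unfold)
    have suppx: "h (n \<otimes> x) y = 0" if "n \<in> N" "y \<in> carrier G" "(n, y) \<notin> ?A \<times> B" for n y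
    proof -
      have "n \<otimes> x \<notin> A \<or> y \<notin> B"
        using that G.set_multI[of "n \<otimes> x" A "inv x" "{inv x}"] x N_carrier by (auto simp: G.m_assoc)
      then show ?thesis using supp that x N_carrier by auto
    qed
    have hn: "(\<lambda>y. h (n \<otimes> x) y) \<in> CP T" if n: "n \<in> N" for n
      by (rule CP_I[OF slice_continuous[OF h] _ B]) (use n x h0 N_carrier supp in auto)
    have hy: "(\<lambda>n. h (n \<otimes> x) y) \<in> CP TN" if y: "y \<in> carrier G" for y
    proof (rule CP_restrict[OF _ x])
      show "(\<lambda>x. h x y) \<in> CP T"
        by (rule CP_I[OF slice_continuous[OF hswap] _ A]) (use y h0 supp in auto)
    qed
    have "continuous_map TN euclideanreal (\<lambda>n. LINT y|\<mu>G. h (n \<otimes> x) y)"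
    proof (rule G.continuous_map_parametric_integral[OF hx])
      fix n assume "n \<in> topspace TN"
      then show "\<exists>U K. openin TN U \<and> n \<in> U \<and> compactin T K \<and>
          (\<forall>x'\<in>U. \<forall>y\<in>topspace T - K. h (x' \<otimes> x) y = 0)"
        using B suppx H.openin_carrier by - (rule exI[of _ N], rule exI[of _ B], auto)
    qed
    then have "(\<lambda>n. LINT y|\<mu>G. h (n \<otimes> x) y) \<in> CP TN"
    proof (rule CP_I[OF _ _ cA])
      fix n assume n: "n \<in> topspace TN"
      show "0 \<le> (LINT y|\<mu>G. h (n \<otimes> x) y)" using G.CP_integral_nonneg[OF hn] n by simp
      show "(LINT y|\<mu>G. h (n \<otimes> x) y) = 0" if "n \<notin> ?A"
      proof -
        have "(LINT y|\<mu>G. h (n \<otimes> x) y) = (LINT y|\<mu>G. 0)"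
          using suppx n that by (intro Bochner_Integration.integral_cong) auto
        then show ?thesis by simp
      qed
    qed
    from H.CP_nn_integral[OF this]
    have "ennreal (fibre_integral (\<lambda>x. LINT y|\<mu>G. h x y) x) = (\<integral>\<^sup>+n. ennreal (LINT y|\<mu>G. h (n \<otimes> x) y) \<partial>\<mu>N)"
      by (simp add: fibre_integral_def)
    also have "\<dots> = (\<integral>\<^sup>+n. \<integral>\<^sup>+y. ennreal (h (n \<otimes> x) y) * 1 \<partial>\<mu>G \<partial>\<mu>N)"
      by (rule nn_integral_cong) (simp add: G.CP_nn_integral[OF hn])
    also have "\<dots> = (\<integral>\<^sup>+y. \<integral>\<^sup>+n. ennreal (h (n \<otimes> x) y) * 1 \<partial>\<mu>N \<partial>\<mu>G)"
      by (rule compact_support_Tonelli[OF H.locally_finite_measure_axioms H.sigma_finite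
            G.locally_finite_measure_axioms G.sigma_finite hx cA B]) (simp_all add: suppx)
    also have "\<dots> = (\<integral>\<^sup>+y. ennreal (fibre_integral (\<lambda>x. h x y) x) \<partial>\<mu>G)"
      by (rule nn_integral_cong) (simp add: H.CP_nn_integral[OF hy] fibre_integral_def)
    finally show ?thesis .
  qed
  have "weil (\<lambda>x. LINT y|\<mu>G. h x y) = (\<integral>\<^sup>+q. \<integral>\<^sup>+y. ennreal (fibre_integral (\<lambda>x. h x y) (rep q)) \<partial>\<mu>G \<partial>\<mu>Q)"
    unfolding weil_def by (rule nn_integral_cong) (simp add: inner rep)
  also have "\<dots> = (\<integral>\<^sup>+y. weil (\<lambda>x. h x y) \<partial>\<mu>G)"
    unfolding weil_def
    by (rule fibre_integral_Tonelli[OF G.locally_finite_measure_axioms G.sigma_finite hswap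
          G.locally_compact B A, symmetric]) (use supp in auto)
  finally show "weil (\<lambda>x. LINT y|\<mu>G. h x y) = (\<integral>\<^sup>+y. weil (\<lambda>x. h x y) \<partial>\<mu>G)" .
qed

text \<open>Weil's formula; the constant \<open>\<kappa>\<close> reflects the independent normalizations of the three Haar
  measures.\<close>

lemma weil_formula:
  obtains \<kappa> where "0 < \<kappa>" "\<forall>f\<in>CP T. weil f = ennreal \<kappa> * (\<integral>\<^sup>+x. ennreal (f x) \<partial>\<mu>G)"
proof (rule G.haar_functional_proportional[OF haar_functional_weil])
  fix f assume f: "f \<in> CP T" and f1: "0 < f \<one>"
  have "0 < fibre_integral f \<one>"
    unfolding fibre_integral_def
    by (rule H.CP_integral_pos[OF CP_restrict[OF f], of _ \<one>])
       (use f1 subgroup.one_closed[OF subgroup_N] in auto)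
  moreover have "fibre_integral f (rep (\<pi> \<one>)) = fibre_integral f \<one>"
    by (rule rep_pi_invariant) (use fibre_integral_invariant[OF CP_cont[OF f]] in auto)
  ultimately have "0 < (LINT q|\<mu>Q. fibre_integral f (rep q))"
    by (intro Q.CP_integral_pos[OF CP_fibre_integral[OF f], of "\<pi> \<one>"] pi_closed) auto
  then show "0 < weil f \<and> weil f < \<infinity>"
    unfolding weil_def by (simp add: Q.CP_nn_integral[OF CP_fibre_integral[OF f]])
qed (use that in blast)

end

lemma (in group) inv_cancel_left:
  "w \<in> carrier G \<Longrightarrow> x \<in> carrier G \<Longrightarrow> inv w \<otimes> (w \<otimes> x) = x"
  "w \<in> carrier G \<Longrightarrow> x \<in> carrier G \<Longrightarrow> w \<otimes> (inv w \<otimes> x) = x"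
  by (simp_all add: m_assoc[symmetric])

section \<open>The action of the extension on the Haar measure of the normal subgroup\<close>

context haar_extension
begin

lemma CP_nonneg_N: "f \<in> CP TN \<Longrightarrow> n \<in> N \<Longrightarrow> 0 \<le> f n"
  using H.CP_ge0[of f n] by simp

lemma CP_support_N:
  assumes "f \<in> CP TN"
  obtains K where "compactin TN K" "\<And>n. n \<in> N \<Longrightarrow> n \<notin> K \<Longrightarrow> f n = 0"
  using CP_support[OF assms] unfolding topspace_TN by blast

lemma conj_mult:
  "z \<in> carrier G \<Longrightarrow> m \<in> carrier G \<Longrightarrow> n \<in> carrier G \<Longrightarrow>
    z \<otimes> (m \<otimes> n) \<otimes> inv z = (z \<otimes> m \<otimes> inv z) \<otimes> (z \<otimes> n \<otimes> inv z)"
  by (simp add: G.m_assoc G.inv_cancel_left)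

lemma conj_inv:
  "z \<in> carrier G \<Longrightarrow> n \<in> carrier G \<Longrightarrow> inv (z \<otimes> n \<otimes> inv z) = z \<otimes> inv n \<otimes> inv z"
  by (simp add: G.m_assoc G.inv_mult_group)

lemma conj_conj_inv:
  "z \<in> carrier G \<Longrightarrow> n \<in> carrier G \<Longrightarrow> z \<otimes> (inv z \<otimes> n \<otimes> z) \<otimes> inv z = n"
  "z \<in> carrier G \<Longrightarrow> n \<in> carrier G \<Longrightarrow> inv z \<otimes> (z \<otimes> n \<otimes> inv z) \<otimes> z = n"
  by (simp_all add: G.m_assoc G.inv_cancel_left)

lemma conj_N': "z \<in> carrier G \<Longrightarrow> n \<in> N \<Longrightarrow> inv z \<otimes> n \<otimes> z \<in> N"
  using conj_N[of "inv z" n] by simp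

lemma continuous_map_conj:
  assumes "z \<in> carrier G"
  shows "continuous_map TN TN (\<lambda>n. z \<otimes> n \<otimes> inv z)"
  unfolding continuous_map_in_subtopology
  using assms conj_N by (auto intro!: G.continuous_map_mult continuous_map_incl_TN)

lemma CP_conj:
  assumes f: "f \<in> CP TN" and z: "z \<in> carrier G"
  shows "(\<lambda>n. f (z \<otimes> n \<otimes> inv z)) \<in> CP TN"
proof (rule CP_compose[OF f continuous_map_conj[OF z] continuous_map_conj[of "inv z"]])
  fix n assume "n \<in> topspace TN"
  then show "inv z \<otimes> (z \<otimes> n \<otimes> inv z) \<otimes> inv (inv z) = n"
    using conj_conj_inv(2)[OF z, of n] z N_carrier unfolding topspace_TN by simp
qed (use z in simp)

lemma haar_functional_conj:
  assumes z: "z \<in> carrier G"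
  shows "H.haar_functional (\<lambda>f. \<integral>\<^sup>+n. ennreal (f (z \<otimes> n \<otimes> inv z)) \<partial>\<mu>N)"
proof (rule H.haar_functionalI)
  fix f g :: "'a \<Rightarrow> real" assume "\<And>x. x \<in> carrier H \<Longrightarrow> f x = g x"
  then show "(\<integral>\<^sup>+n. ennreal (f (z \<otimes> n \<otimes> inv z)) \<partial>\<mu>N) = (\<integral>\<^sup>+n. ennreal (g (z \<otimes> n \<otimes> inv z)) \<partial>\<mu>N)"
    by (intro nn_integral_cong) (simp add: conj_N[OF z])
next
  fix f and c :: real assume "f \<in> CP TN" "0 \<le> c"
  then show "(\<integral>\<^sup>+n. ennreal (c * f (z \<otimes> n \<otimes> inv z)) \<partial>\<mu>N)
      = ennreal c * (\<integral>\<^sup>+n. ennreal (f (z \<otimes> n \<otimes> inv z)) \<partial>\<mu>N)"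
    using H.haar_functional_homog[OF H.haar_functional_integral CP_conj[OF _ z]] by simp
next
  fix f a assume f: "f \<in> CP TN" and a: "a \<in> carrier H"
  then have aN: "a \<in> N" by simp
  let ?b = "inv z \<otimes> a \<otimes> z"
  have "(\<integral>\<^sup>+n. ennreal (f (z \<otimes> n \<otimes> inv z \<otimes> a)) \<partial>\<mu>N) = (\<integral>\<^sup>+n. ennreal (f (z \<otimes> (n \<otimes> ?b) \<otimes> inv z)) \<partial>\<mu>N)"
    by (rule nn_integral_cong) (use z aN N_carrier in \<open>simp add: G.m_assoc G.inv_cancel_left\<close>)
  also have "\<dots> = (\<integral>\<^sup>+n. ennreal (f (z \<otimes> n \<otimes> inv z)) \<partial>\<mu>N)"
    using H.haar_functional_invar[OF H.haar_functional_integral CP_conj[OF f z], of ?b] conj_N'[OF z aN]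
    by simp
  finally show "(\<integral>\<^sup>+n. ennreal (f (z \<otimes> n \<otimes> inv z \<otimes>\<^bsub>H\<^esub> a)) \<partial>\<mu>N) = (\<integral>\<^sup>+n. ennreal (f (z \<otimes> n \<otimes> inv z)) \<partial>\<mu>N)"
    by simp
next
  fix h :: "'a \<Rightarrow> 'a \<Rightarrow> real" and A B
  assume h: "continuous_map (prod_topology TN TN) euclideanreal (\<lambda>(x, y). h x y)"
    and h0: "\<And>x y. x \<in> carrier H \<Longrightarrow> y \<in> carrier H \<Longrightarrow> 0 \<le> h x y"
    and A: "compactin TN A" and B: "compactin TN B"
    and supp: "\<And>x y. x \<in> carrier H \<Longrightarrow> y \<in> carrier H \<Longrightarrow> (x, y) \<notin> A \<times> B \<Longrightarrow> h x y = 0"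
  have "continuous_map (prod_topology TN TN) (prod_topology TN TN) (\<lambda>w. (z \<otimes> fst w \<otimes> inv z, snd w))"
    using continuous_map_compose[OF continuous_map_fst continuous_map_conj[OF z]]
    by (intro continuous_map_pairedI continuous_map_snd) (simp add: o_def)
  from continuous_map_compose[OF this h]
  have c: "continuous_map (prod_topology TN TN) euclideanreal (\<lambda>(x, y). h (z \<otimes> x \<otimes> inv z) y)"
    by (simp add: o_def case_prod_unfold)
  have "continuous_map TN TN (\<lambda>n. inv z \<otimes> n \<otimes> inv (inv z))"
    by (rule continuous_map_conj) (use z in simp)
  from image_compactin[OF A this]
  have A': "compactin TN ((\<lambda>n. inv z \<otimes> n \<otimes> z) ` A)" using z by simp
  show "(\<integral>\<^sup>+n. ennreal (LINT y|\<mu>N. h (z \<otimes> n \<otimes> inv z) y) \<partial>\<mu>N)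
      = (\<integral>\<^sup>+y. \<integral>\<^sup>+n. ennreal (h (z \<otimes> n \<otimes> inv z) y) \<partial>\<mu>N \<partial>\<mu>N)"
  proof (rule H.haar_functional_fubini[OF H.haar_functional_integral c _ A' B])
    fix x y assume xy: "x \<in> carrier H" "y \<in> carrier H"
    show "0 \<le> h (z \<otimes> x \<otimes> inv z) y" using h0 xy conj_N[OF z] by simp
    assume n: "(x, y) \<notin> (\<lambda>n. inv z \<otimes> n \<otimes> z) ` A \<times> B"
    have "(z \<otimes> x \<otimes> inv z, y) \<notin> A \<times> B"
    proof
      assume "(z \<otimes> x \<otimes> inv z, y) \<in> A \<times> B"
      then have "inv z \<otimes> (z \<otimes> x \<otimes> inv z) \<otimes> z \<in> (\<lambda>n. inv z \<otimes> n \<otimes> z) ` A" "y \<in> B" by auto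
      then show False using n conj_conj_inv(2)[OF z, of x] xy N_carrier by simp
    qed
    then show "h (z \<otimes> x \<otimes> inv z) y = 0" using supp xy conj_N[OF z] by simp
  qed
qed

text \<open>Conjugation by \<open>z\<close> scales the Haar integral of \<open>N\<close> by \<open>c\<close>. As a relation this is multiplicative
  without choosing the factor first.\<close>

definition has_modulus :: "'a \<Rightarrow> real \<Rightarrow> bool" where
  "has_modulus z c \<longleftrightarrow> 0 < c \<and>
     (\<forall>f\<in>CP TN. (LINT n|\<mu>N. f (z \<otimes> n \<otimes> inv z)) = c * (LINT n|\<mu>N. f n))"

lemma modulus_exists:
  assumes z: "z \<in> carrier G"
  obtains c where "has_modulus z c"
proof -
  obtain c where c: "0 < c" "\<And>f. f \<in> CP TN \<Longrightarrow>
      (\<integral>\<^sup>+n. ennreal (f (z \<otimes> n \<otimes> inv z)) \<partial>\<mu>N) = ennreal c * (\<integral>\<^sup>+n. ennreal (f n) \<partial>\<mu>N)"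
  proof (rule H.haar_functional_proportional[OF haar_functional_conj[OF z]])
    fix f assume f: "f \<in> CP TN" and "0 < f \<one>\<^bsub>H\<^esub>"
    then have "0 < (LINT n|\<mu>N. f (z \<otimes> n \<otimes> inv z))"
      by (intro H.CP_integral_pos[OF CP_conj[OF f z], of \<one>])
         (use z subgroup.one_closed[OF subgroup_N] in auto)
    then show "0 < (\<integral>\<^sup>+n. ennreal (f (z \<otimes> n \<otimes> inv z)) \<partial>\<mu>N) \<and>
        (\<integral>\<^sup>+n. ennreal (f (z \<otimes> n \<otimes> inv z)) \<partial>\<mu>N) < \<infinity>"
      by (simp add: H.CP_nn_integral[OF CP_conj[OF f z]])
  qed blast
  have "(LINT n|\<mu>N. f (z \<otimes> n \<otimes> inv z)) = c * (LINT n|\<mu>N. f n)" if f: "f \<in> CP TN" for f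
    using c(2)[OF f] c(1) H.CP_integral_nonneg[OF CP_conj[OF f z]] H.CP_integral_nonneg[OF f]
    by (simp add: H.CP_nn_integral[OF CP_conj[OF f z]] H.CP_nn_integral[OF f] flip: ennreal_mult)
  then have "has_modulus z c" using c(1) by (simp add: has_modulus_def)
  then show ?thesis by (rule that)
qed

lemma has_modulus_integral:
  "has_modulus z c \<Longrightarrow> f \<in> CP TN \<Longrightarrow> (LINT n|\<mu>N. f (z \<otimes> n \<otimes> inv z)) = c * (LINT n|\<mu>N. f n)"
  by (simp add: has_modulus_def)

lemma has_modulus_mult:
  assumes z: "z \<in> carrier G" "has_modulus z c" and w: "w \<in> carrier G" "has_modulus w d"
  shows "has_modulus (w \<otimes> z) (d * c)"
  unfolding has_modulus_def
proof (intro conjI ballI)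
  show "0 < d * c" using z w by (simp add: has_modulus_def)
  fix f assume f: "f \<in> CP TN"
  have "(LINT n|\<mu>N. f ((w \<otimes> z) \<otimes> n \<otimes> inv (w \<otimes> z))) = (LINT n|\<mu>N. f (w \<otimes> (z \<otimes> n \<otimes> inv z) \<otimes> inv w))"
    by (rule Bochner_Integration.integral_cong)
       (use z w N_carrier in \<open>simp_all add: G.m_assoc G.inv_mult_group\<close>)
  also have "\<dots> = d * c * (LINT n|\<mu>N. f n)"
    using has_modulus_integral[OF z(2) CP_conj[OF f w(1)]] has_modulus_integral[OF w(2) f] by simp
  finally show "(LINT n|\<mu>N. f ((w \<otimes> z) \<otimes> n \<otimes> inv (w \<otimes> z))) = d * c * (LINT n|\<mu>N. f n)" .
qed

lemma has_modulus_one: "has_modulus \<one> 1"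
  unfolding has_modulus_def
proof (intro conjI ballI)
  fix f :: "'a \<Rightarrow> real"
  show "(LINT n|\<mu>N. f (\<one> \<otimes> n \<otimes> inv \<one>)) = 1 * (LINT n|\<mu>N. f n)"
    using N_carrier by (auto intro!: Bochner_Integration.integral_cong)
qed simp

lemma has_modulus_power:
  fixes k :: nat
  assumes z: "z \<in> carrier G" "has_modulus z c"
  shows "has_modulus (z [^] k) (c ^ k)"
proof (induction k)
  case 0
  show ?case using has_modulus_one by simp
next
  case (Suc k)
  show ?case using has_modulus_mult[OF z _ Suc.IH] z by (simp add: mult.commute)
qed

lemma has_modulus_unique:
  assumes c: "has_modulus z c" and d: "has_modulus z d"
  shows "c = d"
proof -
  obtain f where f: "f \<in> CP TN" "f \<one> = 1" using H.CP_bump_one by auto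
  have "0 < (LINT n|\<mu>N. f n)"
    by (rule H.CP_integral_pos[OF f(1), of \<one>]) (use f(2) subgroup.one_closed[OF subgroup_N] in auto)
  moreover have "c * (LINT n|\<mu>N. f n) = d * (LINT n|\<mu>N. f n)"
    using has_modulus_integral[OF c f(1)] has_modulus_integral[OF d f(1)] by metis
  ultimately show ?thesis by simp
qed

lemma CP_norm_conj:
  assumes c: "has_modulus z c" and f: "f \<in> CP TN"
  shows "CP_norm \<mu>N (\<lambda>n. f (z \<otimes> n \<otimes> inv z)) = sqrt c * CP_norm \<mu>N f"
  using has_modulus_integral[OF c CP_square[OF f]] by (simp add: CP_norm_def real_sqrt_mult)

lemma trilinear_conj:
  assumes z: "z \<in> carrier G" and c: "has_modulus z c"
    and f: "f \<in> CP TN" and g: "g \<in> CP TN" and u: "u \<in> CP TN"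
  shows "trilinear H \<mu>N (\<lambda>n. f (z \<otimes> n \<otimes> inv z)) (\<lambda>n. g (z \<otimes> n \<otimes> inv z)) (\<lambda>n. u (z \<otimes> n \<otimes> inv z))
       = ennreal (c\<^sup>2) * trilinear H \<mu>N f g u"
proof -
  define k where "k x = (LINT y|\<mu>N. f (x \<otimes>\<^bsub>H\<^esub> inv\<^bsub>H\<^esub> y) * g y)" for x
  have k: "k \<in> CP TN" unfolding k_def by (rule H.CP_convolution[OF f g])
  have uk: "(\<lambda>x. u x * k x) \<in> CP TN"
    by (rule CP_mult[OF u CP_cont[OF k]]) (use CP_nonneg[OF k] in auto)
  have c0: "0 < c" using c by (simp add: has_modulus_def)
  have "trilinear H \<mu>N (\<lambda>n. f (z \<otimes> n \<otimes> inv z)) (\<lambda>n. g (z \<otimes> n \<otimes> inv z)) (\<lambda>n. u (z \<otimes> n \<otimes> inv z))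
      = (\<integral>\<^sup>+x. ennreal c * ennreal (u (z \<otimes> x \<otimes> inv z) * k (z \<otimes> x \<otimes> inv z)) \<partial>\<mu>N)"
    unfolding H.trilinear_convolution[OF CP_conj[OF f z] CP_conj[OF g z] CP_conj[OF u z]]
  proof (rule nn_integral_cong)
    fix x assume "x \<in> space \<mu>N"
    then have x: "x \<in> N" by simp
    have "(LINT y|\<mu>N. f (z \<otimes> (x \<otimes>\<^bsub>H\<^esub> inv\<^bsub>H\<^esub> y) \<otimes> inv z) * g (z \<otimes> y \<otimes> inv z))
        = (LINT y|\<mu>N. f ((z \<otimes> x \<otimes> inv z) \<otimes>\<^bsub>H\<^esub> inv\<^bsub>H\<^esub> (z \<otimes> y \<otimes> inv z)) * g (z \<otimes> y \<otimes> inv z))"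
      by (rule Bochner_Integration.integral_cong)
         (use x z N_carrier in \<open>simp_all add: inv_H conj_N conj_inv conj_mult\<close>)
    also have "\<dots> = c * k (z \<otimes> x \<otimes> inv z)"
      unfolding k_def
      by (rule has_modulus_integral[OF c H.CP_convolution_integrand[OF f g]]) (use conj_N[OF z x] in simp)
    finally show "ennreal (u (z \<otimes> x \<otimes> inv z) *
          (LINT y|\<mu>N. f (z \<otimes> (x \<otimes>\<^bsub>H\<^esub> inv\<^bsub>H\<^esub> y) \<otimes> inv z) * g (z \<otimes> y \<otimes> inv z)))
        = ennreal c * ennreal (u (z \<otimes> x \<otimes> inv z) * k (z \<otimes> x \<otimes> inv z))"
      using c0 by (simp add: mult_ac flip: ennreal_mult')
  qed
  also have "\<dots> = ennreal c * (\<integral>\<^sup>+x. ennreal (u (z \<otimes> x \<otimes> inv z) * k (z \<otimes> x \<otimes> inv z)) \<partial>\<mu>N)"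
    using H.continuous_measurable[OF CP_cont[OF CP_conj[OF uk z]]] by (simp add: nn_integral_cmult)
  also have "\<dots> = ennreal c * ennreal (c * (LINT x|\<mu>N. u x * k x))"
    using has_modulus_integral[OF c uk] by (simp add: H.CP_nn_integral[OF CP_conj[OF uk z]])
  also have "\<dots> = ennreal (c\<^sup>2) * trilinear H \<mu>N f g u"
    unfolding H.trilinear_convolution[OF f g u] k_def[symmetric] H.CP_nn_integral[OF uk]
    using c0 H.CP_integral_nonneg[OF uk] by (simp add: power2_eq_square mult_ac flip: ennreal_mult)
  finally show ?thesis .
qed

end

section \<open>Property RD for the extension\<close>

text \<open>The length \<open>l\<close> on \<open>G\<close> is a length in the algebraic sense only; it is Borel on \<open>N\<close>, as part
  of property RD of \<open>N\<close>, but not necessarily on \<open>G\<close>.\<close>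

locale RD_extension = haar_extension +
  fixes l :: "'a \<Rightarrow> real" and lQ :: "'a set \<Rightarrow> real"
  assumes l_one: "l \<one> = 0"
    and l_inv: "x \<in> carrier G \<Longrightarrow> l (inv x) = l x"
    and l_mult: "x \<in> carrier G \<Longrightarrow> y \<in> carrier G \<Longrightarrow> l (x \<otimes> y) \<le> l x + l y"
    and l_pi: "x \<in> carrier G \<Longrightarrow> lQ (N #> x) \<le> l x"
    and RD_N: "RD_wrt (G\<lparr>carrier := N\<rparr>) (subtopology T N) \<mu>N l"
    and RD_Q: "RD_wrt (G Mod N) (quotient_topology T (\<lambda>x. N #> x)) \<mu>Q lQ"
begin

lemma l_nonneg: "x \<in> carrier G \<Longrightarrow> 0 \<le> l x"
  using l_mult[of x "inv x"] l_inv[of x] l_one by simp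

lemma l_power: "z \<in> carrier G \<Longrightarrow> l (z [^] (k::nat)) \<le> real k * l z"
proof (induction k)
  case (Suc k)
  then show ?case using l_mult[of "z [^] k" z] by (simp add: algebra_simps)
qed (simp add: l_one)

lemma l_conj:
  assumes "z \<in> carrier G" "n \<in> N"
  shows "l n \<le> l (z \<otimes> n \<otimes> inv z) + 2 * l z"
proof -
  note n = N_carrier[OF assms(2)]
  have "l n = l ((inv z \<otimes> (z \<otimes> n \<otimes> inv z)) \<otimes> z)"
    using conj_conj_inv(2)[OF assms(1) n] by simp
  also have "\<dots> \<le> l (inv z \<otimes> (z \<otimes> n \<otimes> inv z)) + l z"
    using assms n by (intro l_mult) auto
  also have "l (inv z \<otimes> (z \<otimes> n \<otimes> inv z)) \<le> l (inv z) + l (z \<otimes> n \<otimes> inv z)"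
    using assms n by (intro l_mult) auto
  finally show ?thesis using l_inv[OF assms(1)] by simp
qed

text \<open>Conjugation preserves the Haar measure of \<open>N\<close>. If it scales the measure by \<open>c\<close>, then replacing
  \<open>f, g, u\<close> by their composites with conjugation by \<open>z [^] k\<close> multiplies the trilinear form by
  \<open>c ^ (2 * k)\<close> and the product of the three norms by \<open>c powr (3 * k / 2)\<close>, while the length of the
  support grows at most linearly in \<open>k\<close>; so \<open>c \<le> 1\<close>, since \<open>N\<close> has property RD for the length
  restricted from \<open>G\<close>.\<close>

lemma modulus_le_1:
  assumes z: "z \<in> carrier G" and c: "has_modulus z c"
  shows "c \<le> 1"
proof (rule ccontr)
  assume "\<not> c \<le> 1"
  define b where "b = sqrt c"
  have b: "1 < b" using \<open>\<not> c \<le> 1\<close> by (simp add: b_def)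
  have bc: "c = b\<^sup>2" using \<open>\<not> c \<le> 1\<close> by (simp add: b_def)
  have oneN: "\<one> \<in> N" by (rule subgroup.one_closed[OF subgroup_N])
  obtain s C where s: "0 < s" "0 < C" and bound: "trilinear_RD H TN \<mu>N l s C"
    using H.RD_wrt_imp_trilinear[OF RD_N] by blast
  obtain f where f: "f \<in> CP TN" "f \<one> = 1" using H.CP_bump_one by auto
  define k where "k x = (LINT y|\<mu>N. f (x \<otimes>\<^bsub>H\<^esub> inv\<^bsub>H\<^esub> y) * f y)" for x
  have k: "k \<in> CP TN" unfolding k_def by (rule H.CP_convolution[OF f(1) f(1)])
  have fk: "(\<lambda>x. f x * k x) \<in> CP TN"
    by (rule CP_mult[OF f(1) CP_cont[OF k]]) (use CP_nonneg[OF k] in auto)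
  have "0 < k \<one>"
    unfolding k_def
    by (rule H.CP_integral_pos[OF H.CP_convolution_integrand[OF f(1) f(1)], of _ \<one>])
       (use oneN f(2) in \<open>simp_all add: inv_H\<close>)
  define t where "t = (LINT x|\<mu>N. f x * k x)"
  have t: "0 < t"
    unfolding t_def
    by (rule H.CP_integral_pos[OF fk, of \<one>]) (use oneN f(2) \<open>0 < k \<one>\<close> in simp_all)
  have tri: "trilinear H \<mu>N f f f = ennreal t"
    unfolding H.trilinear_convolution[OF f(1) f(1) f(1)] k_def[symmetric] t_def
    by (rule H.CP_nn_integral[OF fk])
  obtain K where K: "compactin TN K" "\<And>x. x \<in> N \<Longrightarrow> x \<notin> K \<Longrightarrow> f x = 0"
    using CP_support_N[OF f(1)] by blast
  have "is_length H TN l" using RD_N by (simp add: RD_wrt_def)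
  then obtain M where M: "0 \<le> M" "\<And>x. x \<in> K \<Longrightarrow> l x \<le> M"
    using H.length_bounded_on_compact[OF _ K(1)] by blast
  note lz = l_nonneg[OF z]
  define R where "R = 1 + M + 2 * l z"
  have R: "0 < R" using M lz by (simp add: R_def add_pos_nonneg)
  define F where "F = CP_norm \<mu>N f"
  define E where "E = C * R powr s * F ^ 3"
  have ineq: "t \<le> E * ((1 + real j) powr s / b ^ j)" for j
  proof -
    let ?w = "z [^] j"
    have w: "?w \<in> carrier G" using z by simp
    have cw: "has_modulus ?w (c ^ j)" by (rule has_modulus_power[OF z c])
    let ?f = "\<lambda>n. f (?w \<otimes> n \<otimes> inv ?w)"
    define L where "L = M + 2 * (real j * l z)"
    have L: "0 \<le> L" using M lz by (simp add: L_def)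
    have "trilinear H \<mu>N ?f ?f ?f
        \<le> ennreal (C * (1 + L) powr s * CP_norm \<mu>N ?f * CP_norm \<mu>N ?f * CP_norm \<mu>N ?f)"
    proof (rule trilinear_RD_D[OF bound CP_conj[OF f(1) w] CP_conj[OF f(1) w] CP_conj[OF f(1) w] L])
      fix x assume x: "x \<in> carrier H" "?f x \<noteq> 0"
      then have "?w \<otimes> x \<otimes> inv ?w \<in> K" using K(2)[OF conj_N[OF w]] by auto
      then show "l x \<le> L"
        using M(2) l_conj[OF w, of x] l_power[OF z, of j] x unfolding L_def by fastforce
    qed
    also have "trilinear H \<mu>N ?f ?f ?f = ennreal ((c ^ j)\<^sup>2 * t)"
      unfolding trilinear_conj[OF w cw f(1) f(1) f(1)] tri using t by (simp add: ennreal_mult)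
    also have "CP_norm \<mu>N ?f = b ^ j * F"
      unfolding CP_norm_conj[OF cw f(1)] by (simp add: b_def F_def real_sqrt_power)
    finally have "(c ^ j)\<^sup>2 * t \<le> C * (1 + L) powr s * (b ^ j * F) * (b ^ j * F) * (b ^ j * F)"
      using s b CP_norm_nonneg[of \<mu>N f] by (subst (asm) ennreal_le_iff) (auto simp: F_def)
    also have "\<dots> = (C * (1 + L) powr s * F ^ 3) * (b ^ j) ^ 3"
      by (simp add: power3_eq_cube)
    also have "(c ^ j)\<^sup>2 * t = (b ^ j * t) * (b ^ j) ^ 3"
      by (simp add: bc power2_eq_square power3_eq_cube power_mult_distrib)
    finally have "b ^ j * t \<le> C * (1 + L) powr s * F ^ 3"
      using b by (simp add: mult_le_cancel_right)
    also have "\<dots> \<le> C * (R * (1 + real j)) powr s * F ^ 3"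
    proof -
      have "1 + L \<le> R * (1 + real j)"
        using M lz by (simp add: L_def R_def algebra_simps)
      then show ?thesis
        using s L CP_norm_nonneg[of \<mu>N f]
        by (intro mult_right_mono mult_left_mono powr_mono2) (auto simp: F_def)
    qed
    also have "\<dots> = E * (1 + real j) powr s"
      using R by (simp add: E_def powr_mult)
    finally show ?thesis using b by (simp add: field_simps)
  qed
  have "(\<lambda>j. (1 + real j) powr s / b ^ j) \<longlonglongrightarrow> 0"
    using b s by real_asymp
  then have "(\<lambda>j. E * ((1 + real j) powr s / b ^ j)) \<longlonglongrightarrow> E * 0"
    by (rule tendsto_mult_left)
  then have "t \<le> E * 0"
    by (rule LIMSEQ_le_const) (use ineq in blast)
  then show False using t by simp
qed

lemma modulus_1:
  assumes z: "z \<in> carrier G"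
  shows "has_modulus z 1"
proof -
  obtain c where c: "has_modulus z c" using modulus_exists[OF z] .
  obtain d where d: "has_modulus (inv z) d" using modulus_exists[of "inv z"] z by auto
  have "has_modulus (inv z \<otimes> z) (d * c)" by (rule has_modulus_mult[OF z c _ d]) (use z in simp)
  then have "d * c = 1" using has_modulus_unique[OF _ has_modulus_one] z by simp
  moreover have "c \<le> 1" "d \<le> 1"
    using modulus_le_1[OF z c] modulus_le_1[OF _ d] z by auto
  moreover have "0 < c" using c by (simp add: has_modulus_def)
  ultimately have "1 \<le> c" using mult_right_mono[of d 1 c] by simp
  then show ?thesis using c \<open>c \<le> 1\<close> by simp
qed

text \<open>The trilinear form of \<open>G\<close> restricted to the coset of \<open>x\<close> in the first variable and to that of
  \<open>y\<close> in the second.\<close>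

definition fibre_form :: "('a \<Rightarrow> real) \<Rightarrow> ('a \<Rightarrow> real) \<Rightarrow> ('a \<Rightarrow> real) \<Rightarrow> 'a \<Rightarrow> 'a \<Rightarrow> ennreal" where
  "fibre_form f g u x y =
     (\<integral>\<^sup>+m. \<integral>\<^sup>+n. ennreal (u (m \<otimes> x) * f (m \<otimes> x \<otimes> inv (n \<otimes> y)) * g (n \<otimes> y)) \<partial>\<mu>N \<partial>\<mu>N)"

text \<open>The bound on one pair of cosets. If \<open>f\<close> does not vanish on the coset of \<open>x \<otimes> inv y\<close>, that
  coset has a representative \<open>w\<close> of length at most \<open>L\<close>; translating the \<open>m\<close>-variable and conjugating
  the \<open>n\<close>-variable by \<open>w\<close> turns the integral into the trilinear form of \<open>N\<close>.\<close>

lemma fibre_trilinear: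
  assumes bound: "trilinear_RD H TN \<mu>N l s C"
    and f: "f \<in> CP T" and g: "g \<in> CP T" and u: "u \<in> CP T"
    and L: "0 \<le> L" "\<And>x. x \<in> carrier G \<Longrightarrow> f x \<noteq> 0 \<Longrightarrow> l x \<le> L"
    and x: "x \<in> carrier G" and y: "y \<in> carrier G"
  shows "fibre_form f g u x y
      \<le> ennreal (C * (1 + 2 * L) powr s * CP_norm \<mu>N (\<lambda>n. f (n \<otimes> (x \<otimes> inv y)))
                  * CP_norm \<mu>N (\<lambda>n. g (n \<otimes> y)) * CP_norm \<mu>N (\<lambda>n. u (n \<otimes> x)))"
proof (cases "\<exists>n0\<in>N. f (n0 \<otimes> (x \<otimes> inv y)) \<noteq> 0")
  case False
  have "fibre_form f g u x y = (\<integral>\<^sup>+m. \<integral>\<^sup>+n. 0 \<partial>\<mu>N \<partial>\<mu>N)"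
    unfolding fibre_form_def
  proof (intro nn_integral_cong)
    fix m n assume "m \<in> space \<mu>N" "n \<in> space \<mu>N"
    then have mn: "m \<in> N" "n \<in> N" by simp_all
    let ?z = "x \<otimes> inv y"
    have z: "?z \<in> carrier G" using x y by simp
    have "m \<otimes> x \<otimes> inv (n \<otimes> y) = (m \<otimes> (?z \<otimes> inv n \<otimes> inv ?z)) \<otimes> ?z"
      using x y mn N_carrier by (simp add: G.m_assoc G.inv_mult_group G.inv_cancel_left)
    moreover have "m \<otimes> (?z \<otimes> inv n \<otimes> inv ?z) \<in> N"
      using N_mult[OF mn(1) conj_N[OF z N_inv[OF mn(2)]]] .
    ultimately have "f (m \<otimes> x \<otimes> inv (n \<otimes> y)) = 0" using False by metis
    then show "ennreal (u (m \<otimes> x) * f (m \<otimes> x \<otimes> inv (n \<otimes> y)) * g (n \<otimes> y)) = 0" by simp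
  qed
  then show ?thesis by simp
next
  case True
  then obtain n0 where n0: "n0 \<in> N" "f (n0 \<otimes> (x \<otimes> inv y)) \<noteq> 0" by blast
  define w where "w = n0 \<otimes> (x \<otimes> inv y)"
  note n0c = N_carrier[OF n0(1)]
  have w: "w \<in> carrier G" using n0c x y by (simp add: w_def)
  have lw: "l w \<le> L" using L(2)[OF w] n0(2) by (simp add: w_def)
  define f' where "f' n = f (n \<otimes> w)" for n
  define g' where "g' n = g (inv w \<otimes> n \<otimes> inv (inv w) \<otimes> y)" for n
  define u' where "u' n = u (n \<otimes> (n0 \<otimes> x))" for n
  have f': "f' \<in> CP TN" unfolding f'_def by (rule CP_restrict[OF f w])
  have g': "g' \<in> CP TN"
    unfolding g'_def by (rule CP_conj[OF CP_restrict[OF g y], of "inv w"]) (use w in simp)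
  have u': "u' \<in> CP TN" unfolding u'_def by (rule CP_restrict[OF u]) (use n0c x in simp)
  have nf: "CP_norm \<mu>N f' = CP_norm \<mu>N (\<lambda>n. f (n \<otimes> (x \<otimes> inv y)))"
  proof -
    have "CP_norm \<mu>N f' = CP_norm \<mu>N (\<lambda>n. f ((n \<otimes>\<^bsub>H\<^esub> n0) \<otimes> (x \<otimes> inv y)))"
      by (rule CP_norm_cong) (use n0c x y N_carrier in \<open>simp add: f'_def w_def G.m_assoc\<close>)
    then show ?thesis using H.CP_norm_translate[OF _ CP_restrict[OF f, of "x \<otimes> inv y"], of n0] n0(1) x y by simp
  qed
  have nu: "CP_norm \<mu>N u' = CP_norm \<mu>N (\<lambda>n. u (n \<otimes> x))"
  proof -
    have "CP_norm \<mu>N u' = CP_norm \<mu>N (\<lambda>n. u ((n \<otimes>\<^bsub>H\<^esub> n0) \<otimes> x))"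
      by (rule CP_norm_cong) (use n0c x y N_carrier in \<open>simp add: u'_def G.m_assoc\<close>)
    then show ?thesis using H.CP_norm_translate[OF _ CP_restrict[OF u x], of n0] n0(1) by simp
  qed
  have ng: "CP_norm \<mu>N g' = CP_norm \<mu>N (\<lambda>n. g (n \<otimes> y))"
    using CP_norm_conj[OF modulus_1[of "inv w"] CP_restrict[OF g y]] w unfolding g'_def by simp
  define \<Phi> where "\<Phi> m = (\<integral>\<^sup>+n. ennreal (u' m * f' (m \<otimes>\<^bsub>H\<^esub> inv\<^bsub>H\<^esub> n) * g' n) \<partial>\<mu>N)" for m
  define k where "k m = (LINT n|\<mu>N. f' (m \<otimes>\<^bsub>H\<^esub> inv\<^bsub>H\<^esub> n) * g' n)" for m
  have k: "k \<in> CP TN" unfolding k_def by (rule H.CP_convolution[OF f' g'])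
  have integrand: "(\<lambda>n. u' m * f' (m \<otimes>\<^bsub>H\<^esub> inv\<^bsub>H\<^esub> n) * g' n) \<in> CP TN" if m: "m \<in> N" for m
  proof -
    have c: "(\<lambda>n. f' (m \<otimes>\<^bsub>H\<^esub> inv\<^bsub>H\<^esub> n) * g' n) \<in> CP TN"
      by (rule H.CP_convolution_integrand[OF f' g']) (use m in simp)
    have "(\<lambda>n. f' (m \<otimes>\<^bsub>H\<^esub> inv\<^bsub>H\<^esub> n) * g' n * u' m) \<in> CP TN"
      by (rule CP_mult[OF c]) (use CP_nonneg_N[OF u' m] in auto)
    then show ?thesis by (simp add: mult_ac)
  qed
  have \<Phi>_eq: "\<Phi> m = ennreal (LINT n|\<mu>N. u' m * f' (m \<otimes>\<^bsub>H\<^esub> inv\<^bsub>H\<^esub> n) * g' n)" if "m \<in> N" for m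
    unfolding \<Phi>_def by (rule H.CP_nn_integral[OF integrand[OF that]])
  have \<Phi>_meas: "\<Phi> \<in> borel_measurable \<mu>N"
  proof -
    have "\<Phi> \<in> borel_measurable \<mu>N \<longleftrightarrow> (\<lambda>m. ennreal (u' m * k m)) \<in> borel_measurable \<mu>N"
      by (rule measurable_cong) (simp add: \<Phi>_eq k_def mult.assoc)
    then show ?thesis
      using H.continuous_measurable[OF CP_cont[OF u']] H.continuous_measurable[OF CP_cont[OF k]] by simp
  qed
  have "fibre_form f g u x y = (\<integral>\<^sup>+m. \<Phi> (m \<otimes>\<^bsub>H\<^esub> inv n0) \<partial>\<mu>N)"
    unfolding fibre_form_def
  proof (rule nn_integral_cong)
    fix m assume "m \<in> space \<mu>N"
    then have m: "m \<in> N" by simp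
    define m0 where "m0 = m \<otimes> inv n0"
    have m0: "m0 \<in> N" unfolding m0_def by (rule N_mult[OF m N_inv[OF n0(1)]])
    let ?p = "\<lambda>n. u' m0 * f' (m0 \<otimes>\<^bsub>H\<^esub> inv\<^bsub>H\<^esub> n) * g' n"
    have "(\<integral>\<^sup>+n. ennreal (u (m \<otimes> x) * f (m \<otimes> x \<otimes> inv (n \<otimes> y)) * g (n \<otimes> y)) \<partial>\<mu>N)
        = (\<integral>\<^sup>+n. ennreal (?p (w \<otimes> n \<otimes> inv w)) \<partial>\<mu>N)"
    proof (rule nn_integral_cong)
      fix n assume "n \<in> space \<mu>N"
      then have n: "n \<in> N" by simp
      note c = N_carrier[OF n] N_carrier[OF m] n0c x y w
      have "m0 \<otimes> (n0 \<otimes> x) = m \<otimes> x"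
        using c by (simp add: m0_def G.m_assoc G.inv_cancel_left)
      moreover have "m0 \<otimes> inv\<^bsub>H\<^esub> (w \<otimes> n \<otimes> inv w) \<otimes> w = m \<otimes> x \<otimes> inv (n \<otimes> y)"
      proof -
        have "m0 \<otimes> inv\<^bsub>H\<^esub> (w \<otimes> n \<otimes> inv w) \<otimes> w = m \<otimes> (inv n0 \<otimes> (w \<otimes> inv n))"
          unfolding m0_def inv_H[OF conj_N[OF w n]] conj_inv[OF w N_carrier[OF n]]
          using c by (simp add: G.m_assoc)
        also have "\<dots> = m \<otimes> x \<otimes> inv (n \<otimes> y)"
          using c by (simp add: w_def G.inv_mult_group G.m_assoc G.inv_cancel_left)
        finally show ?thesis .
      qed
      moreover have "inv w \<otimes> (w \<otimes> n \<otimes> inv w) \<otimes> inv (inv w) \<otimes> y = n \<otimes> y"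
        using c by (simp add: G.m_assoc G.inv_cancel_left)
      ultimately show "ennreal (u (m \<otimes> x) * f (m \<otimes> x \<otimes> inv (n \<otimes> y)) * g (n \<otimes> y))
          = ennreal (?p (w \<otimes> n \<otimes> inv w))"
        by (simp add: u'_def f'_def g'_def)
    qed
    also have "\<dots> = ennreal (LINT n|\<mu>N. ?p (w \<otimes> n \<otimes> inv w))"
      by (rule H.CP_nn_integral[OF CP_conj[OF integrand[OF m0] w]])
    also have "\<dots> = \<Phi> m0"
      using has_modulus_integral[OF modulus_1[OF w] integrand[OF m0]] by (simp add: \<Phi>_eq[OF m0])
    finally show "(\<integral>\<^sup>+n. ennreal (u (m \<otimes> x) * f (m \<otimes> x \<otimes> inv (n \<otimes> y)) * g (n \<otimes> y)) \<partial>\<mu>N)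
        = \<Phi> (m \<otimes>\<^bsub>H\<^esub> inv n0)" by (simp add: m0_def)
  qed
  also have "\<dots> = trilinear H \<mu>N f' g' u'"
    using H.nn_integral_translate[OF _ \<Phi>_meas, of "inv n0"] N_inv[OF n0(1)]
    by (simp add: \<Phi>_def trilinear_def)
  also have "\<dots> \<le> ennreal (C * (1 + 2 * L) powr s * CP_norm \<mu>N f' * CP_norm \<mu>N g' * CP_norm \<mu>N u')"
  proof (rule trilinear_RD_D[OF bound f' g' u'])
    show "0 \<le> 2 * L" using L(1) by simp
    fix m assume "m \<in> carrier H" "f' m \<noteq> 0"
    then have m: "m \<in> carrier G" "f (m \<otimes> w) \<noteq> 0" using N_carrier by (auto simp: f'_def)
    have "l m = l ((m \<otimes> w) \<otimes> inv w)" using m w by (simp add: G.m_assoc)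
    also have "\<dots> \<le> l (m \<otimes> w) + l (inv w)" using m w by (intro l_mult) auto
    also have "\<dots> \<le> 2 * L" using L(2)[OF _ m(2)] m w lw l_inv[OF w] by simp
    finally show "l m \<le> 2 * L" .
  qed
  finally show ?thesis unfolding nf ng nu .
qed

end

context RD_extension
begin

text \<open>The \<open>L\<^sup>2\<close>-norms along the fibres, as a function on the quotient.\<close>

definition fibre_norm :: "('a \<Rightarrow> real) \<Rightarrow> 'a set \<Rightarrow> real" where
  "fibre_norm f q = CP_norm \<mu>N (\<lambda>n. f (n \<otimes> rep q))"

lemma fibre_norm_eq: "fibre_norm f q = sqrt (fibre_integral (\<lambda>x. (f x)\<^sup>2) (rep q))"
  by (simp add: fibre_norm_def CP_norm_def fibre_integral_def)

lemma fibre_norm_pi: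
  assumes f: "f \<in> CP T" and x: "x \<in> carrier G"
  shows "CP_norm \<mu>N (\<lambda>n. f (n \<otimes> x)) = fibre_norm f (\<pi> x)"
proof -
  have "fibre_integral (\<lambda>x. (f x)\<^sup>2) (rep (\<pi> x)) = fibre_integral (\<lambda>x. (f x)\<^sup>2) x"
    by (rule rep_pi_invariant) (use fibre_integral_invariant[OF CP_cont[OF CP_square[OF f]]] x in auto)
  then show ?thesis by (simp add: fibre_norm_eq) (simp add: CP_norm_def fibre_integral_def)
qed

lemma CP_fibre_norm:
  assumes f: "f \<in> CP T"
  shows "fibre_norm f \<in> CP TQ"
proof -
  note c = CP_fibre_integral[OF CP_square[OF f]]
  obtain K where K: "compactin TQ K"
    "\<And>q. q \<in> topspace TQ \<Longrightarrow> q \<notin> K \<Longrightarrow> fibre_integral (\<lambda>x. (f x)\<^sup>2) (rep q) = 0"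
    using CP_support[OF c] by blast
  show ?thesis
  proof (rule CP_I[OF _ _ K(1)])
    show "continuous_map TQ euclideanreal (fibre_norm f)"
      using continuous_map_compose[OF CP_cont[OF c] continuous_map_square_root]
      by (simp add: o_def fibre_norm_eq[abs_def])
    show "0 \<le> fibre_norm f q" for q by (simp add: fibre_norm_def CP_norm_nonneg)
    show "fibre_norm f q = 0" if "q \<in> topspace TQ" "q \<notin> K" for q
      using K(2)[OF that] by (simp add: fibre_norm_eq)
  qed
qed

lemma CP_norm_fibre_norm:
  assumes \<kappa>: "0 < \<kappa>" "\<forall>f\<in>CP T. weil f = ennreal \<kappa> * (\<integral>\<^sup>+x. ennreal (f x) \<partial>\<mu>G)"
    and f: "f \<in> CP T"
  shows "CP_norm \<mu>Q (fibre_norm f) = sqrt \<kappa> * CP_norm \<mu>G f"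
proof -
  have "ennreal ((CP_norm \<mu>Q (fibre_norm f))\<^sup>2) = (\<integral>\<^sup>+q. ennreal ((fibre_norm f q)\<^sup>2) \<partial>\<mu>Q)"
    by (simp add: CP_norm_square Q.CP_nn_integral[OF CP_square[OF CP_fibre_norm[OF f]]])
  also have "\<dots> = weil (\<lambda>x. (f x)\<^sup>2)"
    unfolding weil_def
    by (rule nn_integral_cong) (use rep in \<open>simp add: fibre_norm_eq fibre_integral_nonneg\<close>)
  also have "\<dots> = ennreal (\<kappa> * (CP_norm \<mu>G f)\<^sup>2)"
    using \<kappa> by (simp add: CP_square[OF f] CP_norm_square G.CP_nn_integral[OF CP_square[OF f]] ennreal_mult')
  finally have "(CP_norm \<mu>Q (fibre_norm f))\<^sup>2 = (sqrt \<kappa> * CP_norm \<mu>G f)\<^sup>2"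
    using \<kappa>(1) by (simp add: power_mult_distrib)
  then show ?thesis
    by (rule power2_eq_imp_eq) (use \<kappa>(1) in \<open>simp_all add: CP_norm_nonneg\<close>)
qed

text \<open>Weil's formula in both variables. Tonelli's theorem moves the integral over \<open>m\<close> past the one over
  the second quotient variable, so that each pair of cosets can be estimated on its own.\<close>

lemma trilinear_disintegration:
  assumes \<kappa>: "0 < \<kappa>" "\<forall>f\<in>CP T. weil f = ennreal \<kappa> * (\<integral>\<^sup>+x. ennreal (f x) \<partial>\<mu>G)"
    and f: "f \<in> CP T" and g: "g \<in> CP T" and u: "u \<in> CP T"
  shows "ennreal (\<kappa>\<^sup>2) * trilinear G \<mu>G f g u =
    (\<integral>\<^sup>+q. \<integral>\<^sup>+r. fibre_form f g u (rep q) (rep r) \<partial>\<mu>Q \<partial>\<mu>Q)"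
proof -
  define k where "k x = (LINT y|\<mu>G. f (x \<otimes> inv y) * g y)" for x
  have k: "k \<in> CP T" unfolding k_def by (rule G.CP_convolution[OF f g])
  have uk: "(\<lambda>x. u x * k x) \<in> CP T"
    by (rule CP_mult[OF u CP_cont[OF k]]) (use CP_nonneg[OF k] in auto)
  obtain B where B: "compactin T B" "\<And>x. x \<in> topspace T \<Longrightarrow> x \<notin> B \<Longrightarrow> g x = 0"
    using CP_support[OF g] by blast
  have inner: "ennreal \<kappa> * ennreal (fibre_integral (\<lambda>x. u x * k x) x) =
      (\<integral>\<^sup>+r. fibre_form f g u x (rep r) \<partial>\<mu>Q)" if x: "x \<in> carrier G" for x
  proof -
    define h where "h m y = u (m \<otimes> x) * f (m \<otimes> x \<otimes> inv y) * g y" for m y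
    have ux: "(\<lambda>m. u (m \<otimes> x)) \<in> CP TN" by (rule CP_restrict[OF u x])
    obtain A where A: "compactin TN A" "\<And>m. m \<in> N \<Longrightarrow> m \<notin> A \<Longrightarrow> u (m \<otimes> x) = 0"
      using CP_support_N[OF ux] by blast
    have hm: "h m \<in> CP T" if m: "m \<in> N" for m
    proof -
      have "(\<lambda>y. f (m \<otimes> x \<otimes> inv y) * g y * u (m \<otimes> x)) \<in> CP T"
        by (rule CP_mult[OF G.CP_convolution_integrand[OF f g]])
           (use m x N_carrier G.CP_ge0[OF u] in auto)
      then show ?thesis by (simp add: h_def[abs_def] mult_ac)
    qed
    have hy: "(\<lambda>n. h m (n \<otimes> y)) \<in> CP TN" if "m \<in> N" "y \<in> carrier G" for m y
      by (rule CP_restrict[OF hm that(2)]) (rule that(1))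
    have hcont: "continuous_map (prod_topology TN T) euclideanreal (\<lambda>(m, y). h m y)"
      unfolding h_def split_beta
      using x
      by (intro continuous_map_real_mult G.continuous_map_CP_compose[OF f] G.continuous_map_CP_compose[OF g]
          G.continuous_map_CP_compose[OF u] G.cont_intros continuous_map_fst_TN)
    have "ennreal \<kappa> * ennreal (fibre_integral (\<lambda>x. u x * k x) x)
        = ennreal \<kappa> * (\<integral>\<^sup>+m. ennreal (u (m \<otimes> x) * k (m \<otimes> x)) \<partial>\<mu>N)"
      by (simp add: fibre_integral_def H.CP_nn_integral[OF CP_restrict[OF uk x]])
    also have "\<dots> = (\<integral>\<^sup>+m. ennreal \<kappa> * ennreal (u (m \<otimes> x) * k (m \<otimes> x)) \<partial>\<mu>N)"
      using H.continuous_measurable[OF CP_cont[OF CP_restrict[OF uk x]]]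
      by (intro nn_integral_cmult[symmetric]) simp
    also have "\<dots> = (\<integral>\<^sup>+m. weil (h m) \<partial>\<mu>N)"
    proof (rule nn_integral_cong)
      fix m assume "m \<in> space \<mu>N"
      then have m: "m \<in> N" by simp
      have "u (m \<otimes> x) * k (m \<otimes> x) = (LINT y|\<mu>G. h m y)"
        by (simp add: k_def h_def mult.assoc)
      then show "ennreal \<kappa> * ennreal (u (m \<otimes> x) * k (m \<otimes> x)) = weil (h m)"
        by (simp add: \<kappa>(2)[rule_format, OF hm[OF m]] G.CP_nn_integral[OF hm[OF m]])
    qed
    also have "\<dots> = (\<integral>\<^sup>+r. \<integral>\<^sup>+m. ennreal (fibre_integral (h m) (rep r)) \<partial>\<mu>N \<partial>\<mu>Q)"
      unfolding weil_def
    proof (rule fibre_integral_Tonelli[OF H.locally_finite_measure_axioms H.sigma_finite hcont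
          H.locally_compact A(1) B(1)])
      fix m y assume "m \<in> topspace TN" "y \<in> carrier G" "(m, y) \<notin> A \<times> B"
      then show "h m y = 0" using A(2)[of m] B(2)[of y] unfolding topspace_TN h_def by auto
    qed
    also have "\<dots> = (\<integral>\<^sup>+r. \<integral>\<^sup>+m. \<integral>\<^sup>+n. ennreal (h m (n \<otimes> rep r)) \<partial>\<mu>N \<partial>\<mu>N \<partial>\<mu>Q)"
      by (intro nn_integral_cong) (simp add: fibre_integral_def H.CP_nn_integral[OF hy] rep)
    finally show ?thesis by (simp add: h_def fibre_form_def)
  qed
  have "ennreal (\<kappa>\<^sup>2) * trilinear G \<mu>G f g u = ennreal \<kappa> * weil (\<lambda>x. u x * k x)"
    using \<kappa>(1) unfolding G.trilinear_convolution[OF f g u] k_def[symmetric] \<kappa>(2)[rule_format, OF uk]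
    by (simp add: power2_eq_square ennreal_mult mult.assoc)
  also have "\<dots> = (\<integral>\<^sup>+q. ennreal \<kappa> * ennreal (fibre_integral (\<lambda>x. u x * k x) (rep q)) \<partial>\<mu>Q)"
    unfolding weil_def
    using Q.continuous_measurable[OF CP_cont[OF CP_fibre_integral[OF uk]]]
    by (intro nn_integral_cmult[symmetric]) simp
  also have "\<dots> = (\<integral>\<^sup>+q. \<integral>\<^sup>+r. fibre_form f g u (rep q) (rep r) \<partial>\<mu>Q \<partial>\<mu>Q)"
    by (intro nn_integral_cong inner) (simp add: rep)
  finally show ?thesis .
qed

text \<open>The bounds for \<open>N\<close> and for \<open>Q\<close> multiply. The functions \<open>f, g, u\<close> enter the bound on \<open>Q\<close> through
  their fibre norms, whose norms on \<open>Q\<close> are \<open>\<rho> = sqrt \<kappa>\<close> times those on \<open>G\<close>.\<close>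

theorem trilinear_extension_bound:
  obtains s C where "0 < s" "0 < C" "trilinear_RD G T \<mu>G l s C"
proof -
  obtain s1 C1 where s1: "0 < s1" "0 < C1" and bound1: "trilinear_RD H TN \<mu>N l s1 C1"
    by (rule H.RD_wrt_imp_trilinear[OF RD_N])
  obtain s2 C2 where s2: "0 < s2" "0 < C2" and bound2: "trilinear_RD Q TQ \<mu>Q lQ s2 C2"
    by (rule Q.RD_wrt_imp_trilinear[OF RD_Q])
  obtain \<kappa> where \<kappa>: "0 < \<kappa>" "\<forall>f\<in>CP T. weil f = ennreal \<kappa> * (\<integral>\<^sup>+x. ennreal (f x) \<partial>\<mu>G)"
    by (rule weil_formula)
  define \<rho> where "\<rho> = sqrt \<kappa>"
  have \<rho>: "0 < \<rho>" using \<kappa>(1) by (simp add: \<rho>_def)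
  have norms: "CP_norm \<mu>Q (fibre_norm f) = \<rho> * CP_norm \<mu>G f" if "f \<in> CP T" for f
    unfolding \<rho>_def by (rule CP_norm_fibre_norm[OF \<kappa> that])
  define C where "C = C1 * 2 powr s1 * C2 * \<rho> ^ 3 / \<kappa>\<^sup>2"
  show ?thesis
  proof (rule that[of "s1 + s2" C])
    show "0 < s1 + s2" "0 < C" using s1 s2 \<kappa>(1) \<rho> by (simp_all add: C_def)
    show "trilinear_RD G T \<mu>G l (s1 + s2) C"
      unfolding trilinear_RD_def
    proof (intro ballI allI impI)
      fix f g u and L :: real
      assume f: "f \<in> CP T" and g: "g \<in> CP T" and u: "u \<in> CP T"
        and L0: "0 \<le> L" and fL: "\<forall>x\<in>carrier G. f x \<noteq> 0 \<longrightarrow> l x \<le> L"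
      have "l x \<le> L" if "x \<in> carrier G" "f x \<noteq> 0" for x using fL that by blast
      note L = L0 this
      define D where "D = C1 * (1 + 2 * L) powr s1"
      have D: "0 \<le> D" using s1 by (simp add: D_def)
      let ?u = "\<lambda>q. D * fibre_norm u q"
      have Du: "?u \<in> CP TQ"
        using CP_mult[OF CP_fibre_norm[OF u], of "\<lambda>_. D"] D by (simp add: mult.commute)
      have nDu: "CP_norm \<mu>Q ?u = D * CP_norm \<mu>Q (fibre_norm u)"
        using D by (simp add: CP_norm_def power_mult_distrib real_sqrt_mult)
      have "ennreal (\<kappa>\<^sup>2) * trilinear G \<mu>G f g u \<le> trilinear Q \<mu>Q (fibre_norm f) (fibre_norm g) ?u"
        unfolding trilinear_disintegration[OF \<kappa> f g u] trilinear_def[of Q]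
      proof (intro nn_integral_mono)
        fix q r assume "q \<in> space \<mu>Q" "r \<in> space \<mu>Q"
        then have q: "q \<in> carrier Q" and r: "r \<in> carrier Q" by simp_all
        note x = rep(1)[OF q] and y = rep(1)[OF r]
        have z: "\<pi> (rep q \<otimes> inv (rep r)) = q \<otimes>\<^bsub>Q\<^esub> inv\<^bsub>Q\<^esub> r"
          using pi_mult[OF x G.inv_closed[OF y]] pi_inv[OF y] rep(2)[OF q] rep(2)[OF r] by simp
        have "fibre_form f g u (rep q) (rep r)
            \<le> ennreal (D * CP_norm \<mu>N (\<lambda>n. f (n \<otimes> (rep q \<otimes> inv (rep r))))
                    * CP_norm \<mu>N (\<lambda>n. g (n \<otimes> rep r)) * CP_norm \<mu>N (\<lambda>n. u (n \<otimes> rep q)))"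
          unfolding D_def by (rule fibre_trilinear[OF bound1 f g u L x y])
        also have "\<dots> = ennreal (?u q * fibre_norm f (q \<otimes>\<^bsub>Q\<^esub> inv\<^bsub>Q\<^esub> r) * fibre_norm g r)"
          using x y by (simp add: fibre_norm_pi[OF f] fibre_norm_pi[OF g] fibre_norm_pi[OF u] z rep(2)[OF q] rep(2)[OF r] mult_ac)
        finally show "fibre_form f g u (rep q) (rep r)
            \<le> ennreal (?u q * fibre_norm f (q \<otimes>\<^bsub>Q\<^esub> inv\<^bsub>Q\<^esub> r) * fibre_norm g r)" .
      qed
      also have "\<dots> \<le> ennreal (C2 * (1 + L) powr s2 * CP_norm \<mu>Q (fibre_norm f)
          * CP_norm \<mu>Q (fibre_norm g) * CP_norm \<mu>Q ?u)"
      proof (rule trilinear_RD_D[OF bound2 CP_fibre_norm[OF f] CP_fibre_norm[OF g] Du L(1)])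
        fix q assume q: "q \<in> carrier Q" and nz: "fibre_norm f q \<noteq> 0"
        have "\<exists>n\<in>N. f (n \<otimes> rep q) \<noteq> 0"
        proof (rule ccontr)
          assume "\<not> ?thesis"
          then have "fibre_norm f q = CP_norm \<mu>N (\<lambda>n. 0)"
            unfolding fibre_norm_def by (intro CP_norm_cong) auto
          then show False using nz by (simp add: CP_norm_def)
        qed
        then obtain n where n: "n \<in> N" "f (n \<otimes> rep q) \<noteq> 0" by blast
        have "lQ q \<le> l (n \<otimes> rep q)"
          using l_pi[of "n \<otimes> rep q"] pi_left[OF n(1) rep(1)[OF q]] rep[OF q] N_carrier[OF n(1)] by simp
        then show "lQ q \<le> L" using L(2)[OF _ n(2)] rep(1)[OF q] N_carrier[OF n(1)] by simp
      qed
      also have "\<dots> = ennreal (D * C2 * (1 + L) powr s2 * \<rho> ^ 3 * (CP_norm \<mu>G f * CP_norm \<mu>G g * CP_norm \<mu>G u))"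
        by (simp add: nDu norms f g u power3_eq_cube mult_ac)
      also have "\<dots> \<le> ennreal (\<kappa>\<^sup>2 * (C * (1 + L) powr (s1 + s2) * (CP_norm \<mu>G f * CP_norm \<mu>G g * CP_norm \<mu>G u)))"
      proof (rule ennreal_leI)
        have "(1 + 2 * L) powr s1 \<le> (2 * (1 + L)) powr s1"
          using L(1) s1 by (intro powr_mono2) auto
        also have "\<dots> = 2 powr s1 * (1 + L) powr s1"
          by (subst powr_mult) (use L(1) in auto)
        finally have "D \<le> C1 * (2 powr s1 * (1 + L) powr s1)"
          unfolding D_def using s1 by (intro mult_left_mono) auto
        then have "D * (C2 * (1 + L) powr s2 * \<rho> ^ 3 * (CP_norm \<mu>G f * CP_norm \<mu>G g * CP_norm \<mu>G u))
            \<le> C1 * (2 powr s1 * (1 + L) powr s1) * (C2 * (1 + L) powr s2 * \<rho> ^ 3 * (CP_norm \<mu>G f * CP_norm \<mu>G g * CP_norm \<mu>G u))"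
          using s2 \<rho> by (intro mult_right_mono) (auto intro!: mult_nonneg_nonneg simp: CP_norm_nonneg)
        also have "\<dots> = \<kappa>\<^sup>2 * (C * (1 + L) powr (s1 + s2) * (CP_norm \<mu>G f * CP_norm \<mu>G g * CP_norm \<mu>G u))"
          using \<kappa>(1) by (simp add: C_def powr_add)
        finally show "D * C2 * (1 + L) powr s2 * \<rho> ^ 3 * (CP_norm \<mu>G f * CP_norm \<mu>G g * CP_norm \<mu>G u)
            \<le> \<kappa>\<^sup>2 * (C * (1 + L) powr (s1 + s2) * (CP_norm \<mu>G f * CP_norm \<mu>G g * CP_norm \<mu>G u))"
          by (simp add: mult_ac)
      qed
      also have "\<dots> = ennreal (\<kappa>\<^sup>2) * ennreal (C * (1 + L) powr (s1 + s2) * (CP_norm \<mu>G f * CP_norm \<mu>G g * CP_norm \<mu>G u))"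
        by (rule ennreal_mult') simp
      finally have "trilinear G \<mu>G f g u \<le> ennreal (C * (1 + L) powr (s1 + s2) * (CP_norm \<mu>G f * CP_norm \<mu>G g * CP_norm \<mu>G u))"
        using \<kappa>(1) by (subst (asm) ennreal_mult_le_mult_iff) auto
      then show "trilinear G \<mu>G f g u \<le> ennreal (C * (1 + L) powr (s1 + s2) * CP_norm \<mu>G f * CP_norm \<mu>G g * CP_norm \<mu>G u)"
        by (simp add: mult.assoc)
    qed
  qed
qed

end

section \<open>Word-lengths\<close>

context group
begin

lemma symmetrized_closed: "S \<subseteq> carrier G \<Longrightarrow> S \<union> set_inv S \<subseteq> carrier G"
  by (auto simp: SET_INV_def)

lemma symmetrized_inv: "S \<subseteq> carrier G \<Longrightarrow> a \<in> S \<union> set_inv S \<Longrightarrow> inv a \<in> S \<union> set_inv S"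
  by (auto simp: SET_INV_def)

lemma word_length_le: "x \<in> set_power G (S \<union> set_inv S) n \<Longrightarrow> word_length G S x \<le> real n"
  by (simp add: word_length_def Least_le)

lemma word_length_attained:
  assumes "S \<subseteq> carrier G" "generate G S = carrier G" "x \<in> carrier G"
  obtains n where "word_length G S x = real n" "x \<in> set_power G (S \<union> set_inv S) n"
proof -
  have "x \<in> generate G (S \<union> set_inv S)"
    using mono_generate[of S "S \<union> set_inv S"] assms by auto
  then have "\<exists>n. x \<in> set_power G (S \<union> set_inv S) n"
    using generate_subset_set_power[OF symmetrized_closed[OF assms(1)]] symmetrized_inv[OF assms(1)]
    by blast
  then have "x \<in> set_power G (S \<union> set_inv S) (LEAST n. x \<in> set_power G (S \<union> set_inv S) n)"
    by (rule LeastI_ex)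
  then show ?thesis using that unfolding word_length_def by blast
qed

lemma word_length_one: "word_length G S \<one> = 0"
  using word_length_le[of \<one> S 0] by (simp add: word_length_def)

lemma word_length_mult:
  assumes S: "S \<subseteq> carrier G" "generate G S = carrier G" and xy: "x \<in> carrier G" "y \<in> carrier G"
  shows "word_length G S (x \<otimes> y) \<le> word_length G S x + word_length G S y"
proof -
  obtain m where m: "word_length G S x = real m" "x \<in> set_power G (S \<union> set_inv S) m"
    using word_length_attained[OF S xy(1)] .
  obtain n where n: "word_length G S y = real n" "y \<in> set_power G (S \<union> set_inv S) n"
    using word_length_attained[OF S xy(2)] .
  show ?thesis
    using word_length_le[OF set_power_add[OF symmetrized_closed[OF S(1)] m(2) n(2)]] m(1) n(1) by simp
qed

lemma word_length_inv:
  assumes S: "S \<subseteq> carrier G" "generate G S = carrier G" and x: "x \<in> carrier G"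
  shows "word_length G S (inv x) = word_length G S x"
proof -
  have le: "word_length G S (inv y) \<le> word_length G S y" if y: "y \<in> carrier G" for y
  proof -
    obtain m where m: "word_length G S y = real m" "y \<in> set_power G (S \<union> set_inv S) m"
      using word_length_attained[OF S y] .
    show ?thesis
      using word_length_le[OF set_power_inv[OF symmetrized_closed[OF S(1)] symmetrized_inv[OF S(1)] m(2)]] m(1)
      by simp
  qed
  show ?thesis using le[OF x] le[of "inv x"] x by simp
qed

end

text \<open>An open generating set has a Borel word-length, since its powers are open.\<close>

lemma (in haar_group) is_length_word_length_open:
  assumes U: "openin T U" "generate G U = carrier G"
  shows "is_length G T (word_length G U)"
proof -
  let ?A = "U \<union> set_inv U"
  have Uc: "U \<subseteq> carrier G" using carrier_of_openin[OF U(1)] by blast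
  have "set_inv U = {x \<in> topspace T. inv x \<in> U}"
    using Uc by (force simp: SET_INV_def)
  moreover have "openin T {x \<in> topspace T. inv x \<in> U}"
    by (rule openin_continuous_map_preimage[OF continuous_inv U(1)])
  ultimately have A: "openin T ?A" using U(1) by (simp add: openin_Un)
  have pw: "set_power G ?A n \<in> sets (borel_sigma T)" for n
  proof (cases n)
    case 0
    then show ?thesis
      using closedin_sets_borel_sigma[OF compactin_imp_closedin[OF Hausdorff, of "{\<one>}"]] by simp
  next
    case (Suc m)
    let ?P = "set_power G ?A m"
    have Pc: "?P \<subseteq> carrier G" by (rule set_power_closed[OF symmetrized_closed[OF Uc]])
    have "?P <#> ?A = (\<Union>x\<in>?P. {y \<in> topspace T. inv x \<otimes> y \<in> ?A})"
    proof (intro Set.set_eqI iffI)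
      fix y assume "y \<in> ?P <#> ?A"
      then obtain x a where "x \<in> ?P" "a \<in> ?A" "y = x \<otimes> a" unfolding set_mult_def by blast
      then show "y \<in> (\<Union>x\<in>?P. {y \<in> topspace T. inv x \<otimes> y \<in> ?A})"
        using Pc symmetrized_closed[OF Uc] by (intro UN_I[of x]) (auto simp: inv_cancel_left subset_iff)
    next
      fix y assume "y \<in> (\<Union>x\<in>?P. {y \<in> topspace T. inv x \<otimes> y \<in> ?A})"
      then obtain x where x: "x \<in> ?P" "y \<in> carrier G" "inv x \<otimes> y \<in> ?A" by auto
      then have "x \<otimes> (inv x \<otimes> y) \<in> ?P <#> ?A" by (intro set_multI)
      then show "y \<in> ?P <#> ?A" using x Pc by (simp add: inv_cancel_left subset_iff)
    qed
    moreover have "openin T {y \<in> topspace T. inv x \<otimes> y \<in> ?A}" if "x \<in> ?P" for x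
      by (rule openin_continuous_map_preimage[OF _ A]) (use that Pc in \<open>auto intro!: cont_intros\<close>)
    ultimately have "openin T (set_power G ?A n)" using Suc by auto
    then show ?thesis by (rule openin_sets_borel_sigma)
  qed
  have "(\<lambda>x. LEAST n. x \<in> set_power G ?A n) \<in> measurable (borel_sigma T) (count_space UNIV)"
  proof (rule measurable_Least)
    fix n
    have "{x \<in> space (borel_sigma T). x \<in> set_power G ?A n} = set_power G ?A n"
      using set_power_closed[OF symmetrized_closed[OF Uc]] by auto
    then show "Measurable.pred (borel_sigma T) (\<lambda>x. x \<in> set_power G ?A n)"
      unfolding pred_def using pw by simp
  qed
  then have "word_length G U \<in> borel_measurable (borel_sigma T)"
    unfolding word_length_def[abs_def] by (rule measurable_compose) simp
  then show ?thesis
    unfolding is_length_def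
    using word_length_one word_length_inv[OF Uc U(2)] word_length_mult[OF Uc U(2)]
    by (auto simp: word_length_def)
qed

context haar_extension
begin

lemma pi_set_power:
  assumes S: "S \<subseteq> carrier G"
  shows "set_power Q (\<pi> ` S \<union> set_inv\<^bsub>Q\<^esub> (\<pi> ` S)) n = \<pi> ` set_power G (S \<union> set_inv S) n"
proof (induction n)
  case 0
  have "\<one>\<^bsub>Q\<^esub> = \<pi> \<one>" using pi_mult[of \<one> \<one>] pi_closed[of \<one>] Q.r_cancel_one'[of "\<pi> \<one>" "\<pi> \<one>"] by simp
  then show ?case by simp
next
  case (Suc n)
  let ?A = "S \<union> set_inv S"
  have gens: "\<pi> ` S \<union> set_inv\<^bsub>Q\<^esub> (\<pi> ` S) = \<pi> ` ?A"
    using S pi_inv by (auto simp: SET_INV_def subset_iff image_iff)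
  have c: "?A \<subseteq> carrier G" "set_power G ?A n \<subseteq> carrier G"
    using G.symmetrized_closed[OF S] G.set_power_closed by blast+
  have "\<pi> ` X <#>\<^bsub>Q\<^esub> \<pi> ` Y = \<pi> ` (X <#> Y)" if "X \<subseteq> carrier G" "Y \<subseteq> carrier G" for X Y
  proof (intro Set.set_eqI iffI)
    fix q assume "q \<in> \<pi> ` X <#>\<^bsub>Q\<^esub> \<pi> ` Y"
    then obtain x y where xy: "x \<in> X" "y \<in> Y" "q = \<pi> x \<otimes>\<^bsub>Q\<^esub> \<pi> y" unfolding set_mult_def by blast
    then have "q = \<pi> (x \<otimes> y)" using pi_mult[of x y] that by auto
    then show "q \<in> \<pi> ` (X <#> Y)" using G.set_multI[OF xy(1,2)] by blast
  next
    fix q assume "q \<in> \<pi> ` (X <#> Y)"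
    then obtain x y where xy: "x \<in> X" "y \<in> Y" "q = \<pi> (x \<otimes> y)" unfolding set_mult_def by blast
    then have "q = \<pi> x \<otimes>\<^bsub>Q\<^esub> \<pi> y" using pi_mult[of x y] that by auto
    then show "q \<in> \<pi> ` X <#>\<^bsub>Q\<^esub> \<pi> ` Y" using xy unfolding set_mult_def by blast
  qed
  from this[OF c(2) c(1)] show ?case using Suc.IH gens by simp
qed

lemma pi_word_length_le:
  assumes S: "S \<subseteq> carrier G" "generate G S = carrier G" and x: "x \<in> carrier G"
  shows "word_length Q (\<pi> ` S) (\<pi> x) \<le> word_length G S x"
proof -
  obtain n where n: "word_length G S x = real n" "x \<in> set_power G (S \<union> set_inv S) n"
    using G.word_length_attained[OF S x] .
  have "\<pi> x \<in> set_power Q (\<pi> ` S \<union> set_inv\<^bsub>Q\<^esub> (\<pi> ` S)) n"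
    unfolding pi_set_power[OF S(1)] using n(2) by blast
  then show ?thesis using Q.word_length_le n(1) by simp
qed

text \<open>Although the word-length of \<open>G\<close> need not be Borel, it is bounded on compact sets: modulo \<open>N\<close>
  an element of a compact set is a word of bounded length, and the remaining factor lies in a
  compact subset of \<open>N\<close>.\<close>

lemma word_length_bounded_on_compact:
  assumes S: "relatively_compact_in T S" "generate G S = carrier G"
    and lN: "is_length H TN (word_length G S)" and lQ: "is_length Q TQ (word_length Q (\<pi> ` S))"
    and K: "compactin T K"
  obtains M where "0 \<le> M" "\<And>x. x \<in> K \<Longrightarrow> word_length G S x \<le> M"
proof -
  let ?A = "S \<union> set_inv S"
  have Sc: "S \<subseteq> carrier G" using S(1) by (simp add: relatively_compact_in_def)
  obtain M1 where M1: "0 \<le> M1" "\<And>q. q \<in> \<pi> ` K \<Longrightarrow> word_length Q (\<pi> ` S) q \<le> M1"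
    using Q.length_bounded_on_compact[OF lQ image_compactin[OF K continuous_map_pi]] by blast
  define C where "C = (T closure_of S) \<union> (\<lambda>x. inv x) ` (T closure_of S)"
  have C: "compactin T C"
    using S(1) unfolding C_def relatively_compact_in_def
    by (intro compactin_Un G.compactin_inv_image) auto
  have AC: "?A \<subseteq> C"
    using closure_of_subset[of S T] Sc by (auto simp: C_def SET_INV_def)
  define P where "P = (\<Union>n\<le>nat \<lceil>M1\<rceil>. set_power G C n)"
  have P: "compactin T P"
    unfolding P_def by (rule compactin_Union) (auto intro: G.compactin_set_power[OF C])
  obtain M2 where M2: "0 \<le> M2"
    "\<And>n. n \<in> (K <#> (\<lambda>x. inv x) ` P) \<inter> N \<Longrightarrow> word_length G S n \<le> M2"
    using H.length_bounded_on_compact[OF lN compactin_TN[OF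
        G.compactin_set_mult[OF K G.compactin_inv_image[OF P]]]] by blast
  show ?thesis
  proof (rule that)
    show "0 \<le> M1 + M2" using M1 M2 by simp
    fix x assume x: "x \<in> K"
    have xc: "x \<in> carrier G" using G.carrier_of_compactin[OF K x] .
    have piS: "\<pi> ` S \<subseteq> carrier Q" using Sc pi_closed by auto
    \<comment> \<open>A shortest word \<open>p\<close> representing the coset of \<open>x\<close>.\<close>
    obtain j where xj: "x \<in> set_power G ?A j"
      using G.word_length_attained[OF Sc S(2) xc] by blast
    have "\<pi> x \<in> set_power Q (\<pi> ` S \<union> set_inv\<^bsub>Q\<^esub> (\<pi> ` S)) j"
      unfolding pi_set_power[OF Sc] using xj by blast
    then have "\<pi> x \<in> set_power Q (\<pi> ` S \<union> set_inv\<^bsub>Q\<^esub> (\<pi> ` S))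
        (LEAST n. \<pi> x \<in> set_power Q (\<pi> ` S \<union> set_inv\<^bsub>Q\<^esub> (\<pi> ` S)) n)"
      by (rule LeastI)
    then obtain k where k: "\<pi> x \<in> \<pi> ` set_power G ?A k" "word_length Q (\<pi> ` S) (\<pi> x) = real k"
      unfolding pi_set_power[OF Sc] word_length_def by blast
    then obtain p where p: "p \<in> set_power G ?A k" "\<pi> x = \<pi> p" by blast
    have kM: "real k \<le> M1" using M1(2)[of "\<pi> x"] k(2) x by simp
    have pc: "p \<in> carrier G" using p(1) G.set_power_closed[OF G.symmetrized_closed[OF Sc]] by blast
    have pP: "p \<in> P"
      unfolding P_def
    proof (rule UN_I[of k])
      show "k \<in> {..nat \<lceil>M1\<rceil>}" using kM by (simp add: le_nat_iff ceiling_mono) linarith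
      show "p \<in> set_power G C k" using p(1) G.set_power_mono[OF AC] by blast
    qed
    obtain n where n: "n \<in> N" "x = n \<otimes> p" using pi_eqD[OF pc xc p(2)[symmetric]] .
    have "n = x \<otimes> inv p" using n pc N_carrier by (simp add: G.m_assoc)
    then have "n \<in> (K <#> (\<lambda>x. inv x) ` P) \<inter> N" using n(1) x pP by (auto intro: G.set_multI)
    then have "word_length G S n \<le> M2" by (rule M2(2))
    moreover have "word_length G S p \<le> M1" using G.word_length_le[OF p(1)] kM by linarith
    moreover have "word_length G S x \<le> word_length G S n + word_length G S p"
      unfolding n(2) by (rule G.word_length_mult[OF Sc S(2) N_carrier[OF n(1)] pc])
    ultimately show "word_length G S x \<le> M1 + M2" by linarith
  qed
qed

end

theorem theorem4p1:
  fixes G :: "('a, 'c) monoid_scheme" and T :: "'a topology" and N S :: "'a set"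
    and \<mu>\<^sub>G \<mu>\<^sub>N :: "'a measure" and \<mu>\<^sub>Q :: "'a set measure"
  defines "\<pi> \<equiv> \<lambda>x. N #>\<^bsub>G\<^esub> x"
  defines "H \<equiv> G\<lparr>carrier := N\<rparr>" and "T\<^sub>N \<equiv> subtopology T N"
  defines "Q \<equiv> G Mod N" and "T\<^sub>Q \<equiv> quotient_topology T \<pi>"
  assumes "N \<lhd> G" and "closedin T N"
    and "compactly_generated_group G T"
    and "compactly_generated_group H T\<^sub>N"
    and "compactly_generated_group Q T\<^sub>Q"
    and "right_haar_measure G T \<mu>\<^sub>G"
    and "right_haar_measure H T\<^sub>N \<mu>\<^sub>N"
    and "right_haar_measure Q T\<^sub>Q \<mu>\<^sub>Q"
    and "relatively_compact_in T S" and "generate G S = carrier G"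
    and "RD_wrt Q T\<^sub>Q \<mu>\<^sub>Q (word_length Q (\<pi> ` S))"
    and "RD_wrt H T\<^sub>N \<mu>\<^sub>N (word_length G S)"
  shows "property_RD G T \<mu>\<^sub>G"
proof -
  let ?l = "word_length G S"
  interpret E: haar_extension G T N \<mu>\<^sub>G \<mu>\<^sub>N \<mu>\<^sub>Q
    by (simp add: haar_extension_def haar_group_def haar_group_axioms_def
        assms(6-13)[unfolded H_def T\<^sub>N_def Q_def T\<^sub>Q_def \<pi>_def])
  note S = assms(14,15)
  note RD = assms(16,17)[unfolded H_def T\<^sub>N_def Q_def T\<^sub>Q_def \<pi>_def]
  have Sc: "S \<subseteq> carrier G" using S(1) by (simp add: relatively_compact_in_def)
  interpret R: RD_extension G T N \<mu>\<^sub>G \<mu>\<^sub>N \<mu>\<^sub>Q ?l "word_length (G Mod N) ((\<lambda>x. N #>\<^bsub>G\<^esub> x) ` S)"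
    by (unfold_locales; (rule RD E.G.word_length_one E.G.word_length_inv[OF Sc S(2)]
        E.G.word_length_mult[OF Sc S(2)] E.pi_word_length_le[OF Sc S(2)]; assumption?))
  have lN: "is_length (G\<lparr>carrier := N\<rparr>) (subtopology T N) ?l"
    and lQ: "is_length (G Mod N) (quotient_topology T (\<lambda>x. N #>\<^bsub>G\<^esub> x))
        (word_length (G Mod N) ((\<lambda>x. N #>\<^bsub>G\<^esub> x) ` S))"
    using RD by (simp_all add: RD_wrt_def)
  \<comment> \<open>The word-length of \<open>U\<close> is Borel and bounds that of \<open>S\<close> up to the constant \<open>M\<close>.\<close>
  have "compactin T (T closure_of S)" using S(1) by (simp add: relatively_compact_in_def)
  then obtain U L where U: "openin T U" "compactin T L" "T closure_of S \<subseteq> U" "U \<subseteq> L"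
    by (rule E.G.relatively_compact_nhd)
  have Uc: "U \<subseteq> carrier G" using E.G.carrier_of_openin[OF U(1)] by blast
  have SU: "S \<subseteq> U" using closure_of_subset[of S T] Sc U(3) by auto
  have genU: "generate G U = carrier G"
    using E.G.mono_generate[OF SU] S(2) E.G.generate_incl[OF Uc] by auto
  let ?lU = "word_length G U"
  obtain M where M: "0 \<le> M" "\<And>x. x \<in> L \<Longrightarrow> ?l x \<le> M"
    using E.word_length_bounded_on_compact[OF S lN lQ U(2)] by blast
  have gen_bound: "?l a \<le> M" if "a \<in> U \<union> set_inv\<^bsub>G\<^esub> U" for a
    using that M(2) U(4) Uc E.G.word_length_inv[OF Sc S(2)] by (auto simp: SET_INV_def subset_iff)
  have power_bound: "?l x \<le> M * real n" if "x \<in> set_power G (U \<union> set_inv\<^bsub>G\<^esub> U) n" for x n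
    using that
  proof (induction n arbitrary: x)
    case 0
    then show ?case by (simp add: E.G.word_length_one)
  next
    case (Suc n)
    then obtain y a where ya: "y \<in> set_power G (U \<union> set_inv\<^bsub>G\<^esub> U) n" "a \<in> U \<union> set_inv\<^bsub>G\<^esub> U" "x = y \<otimes>\<^bsub>G\<^esub> a"
      by (auto simp: set_mult_def)
    then have "?l x \<le> ?l y + ?l a"
      using E.G.symmetrized_closed[OF Uc] E.G.set_power_closed[OF E.G.symmetrized_closed[OF Uc]]
      by (auto intro!: E.G.word_length_mult[OF Sc S(2)])
    then show ?case using Suc.IH[OF ya(1)] gen_bound[OF ya(2)] by (simp add: algebra_simps)
  qed
  have compare: "?l x \<le> M * ?lU x" if x: "x \<in> carrier G" for x
    using E.G.word_length_attained[OF Uc genU x] power_bound by metis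
  obtain s C where s: "0 < s" "0 < C" and bound: "trilinear_RD G T \<mu>\<^sub>G ?l s C"
    by (rule R.trilinear_extension_bound)
  have "RD_wrt G T \<mu>\<^sub>G ?lU"
  proof (rule E.G.trilinear_imp_RD_wrt[where s = s and C = "C * (1 + M) powr s"])
    show "is_length G T ?lU" by (rule E.G.is_length_word_length_open[OF U(1) genU])
    show "0 < s" "0 < C * (1 + M) powr s" using s M(1) by simp_all
    show "trilinear_RD G T \<mu>\<^sub>G ?lU s (C * (1 + M) powr s)"
      unfolding trilinear_RD_def
    proof (intro ballI allI impI)
      fix f g u and L :: real
      assume f: "f \<in> CP T" and g: "g \<in> CP T" and u: "u \<in> CP T" and L: "0 \<le> L"
        and fL: "\<forall>x\<in>carrier G. f x \<noteq> 0 \<longrightarrow> ?lU x \<le> L"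
      have "trilinear G \<mu>\<^sub>G f g u
          \<le> ennreal (C * (1 + M * L) powr s * CP_norm \<mu>\<^sub>G f * CP_norm \<mu>\<^sub>G g * CP_norm \<mu>\<^sub>G u)"
      proof (rule trilinear_RD_D[OF bound f g u])
        show "0 \<le> M * L" using M(1) L by simp
        fix x assume x: "x \<in> carrier G" "f x \<noteq> 0"
        show "?l x \<le> M * L"
          using compare[OF x(1)] mult_left_mono[OF _ M(1), of "?lU x" L] fL x by force
      qed
      also have "\<dots> \<le> ennreal (C * (1 + M) powr s * (1 + L) powr s * CP_norm \<mu>\<^sub>G f * CP_norm \<mu>\<^sub>G g * CP_norm \<mu>\<^sub>G u)"
      proof (intro ennreal_leI mult_right_mono CP_norm_nonneg)
        have "(1 + M * L) powr s \<le> ((1 + M) * (1 + L)) powr s"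
          using s M(1) L by (intro powr_mono2) (auto simp: algebra_simps)
        then show "C * (1 + M * L) powr s \<le> C * (1 + M) powr s * (1 + L) powr s"
          using s M(1) L by (simp add: powr_mult)
      qed
      finally show "trilinear G \<mu>\<^sub>G f g u
          \<le> ennreal (C * (1 + M) powr s * (1 + L) powr s * CP_norm \<mu>\<^sub>G f * CP_norm \<mu>\<^sub>G g * CP_norm \<mu>\<^sub>G u)" .
    qed
  qed
  then show ?thesis unfolding property_RD_def by blast
qed

end
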